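(* Every D3-reducible graph has a Hamiltonian cycle, and such a cycle can be found in time linear in the size of the graph.
   Context: All graphs are finite and simple. The D3 reductions are the following two operations on a graph $G$. (D3a) Let $p,q,r$ be three vertices of degree three that induce a triangle in $G$ and whose neighbors outside $\{p,q,r\}$ are three distinct vertices; replace $p,q,r$ by a single new vertex adjacent to exactly those three outside neighbors. (D3b) Let $p,q,r$ be three vertices of degree three that induce a path with middle vertex $q$, and suppose there is a single vertex $s$ adjacent to all three of $p,q,r$; delete $q$ and add a new edge from $p$ to $r$. A graph is D3-reducible if it can be transformed into a graph isomorphic to $K_4$ by a finite sequence of D3 reductions. *)

theory Defs
  imports Main
begin

section \<open>Finite simple graphs\<close>

record 'a graph =
  verts :: "'a set"
  edges :: "'a set set"

definition simple_graph :: "'a graph \<Rightarrow> bool" where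
  "simple_graph G \<longleftrightarrow> finite (verts G) \<and> (\<forall>e\<in>edges G. e \<subseteq> verts G \<and> card e = 2)"

definition nbrs :: "'a graph \<Rightarrow> 'a \<Rightarrow> 'a set" where
  "nbrs G v = {u. {v, u} \<in> edges G}"

definition degree :: "'a graph \<Rightarrow> 'a \<Rightarrow> nat" where
  "degree G v = card (nbrs G v)"

definition graph_size :: "'a graph \<Rightarrow> nat" where
  "graph_size G = card (verts G) + card (edges G)"

definition isomorphic :: "'a graph \<Rightarrow> 'b graph \<Rightarrow> bool" where
  "isomorphic G H \<longleftrightarrow> (\<exists>f. bij_betw f (verts G) (verts H) \<and>
     (\<forall>u\<in>verts G. \<forall>v\<in>verts G. {u, v} \<in> edges G \<longleftrightarrow> {f u, f v} \<in> edges H))"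

definition K4 :: "nat graph" where
  "K4 = \<lparr>verts = {..<4}, edges = {e. e \<subseteq> {..<4} \<and> card e = 2}\<rparr>"

text \<open>The list enumerates the vertices in cyclic order; the last is adjacent to the first.\<close>

definition hamiltonian_cycle :: "'a graph \<Rightarrow> 'a list \<Rightarrow> bool" where
  "hamiltonian_cycle G c \<longleftrightarrow> length c \<ge> 3 \<and> distinct c \<and> set c = verts G \<and>
     (\<forall>i<length c. {c ! i, c ! (Suc i mod length c)} \<in> edges G)"

section \<open>D3 reductions\<close>

text \<open>
  The new vertex \<open>v\<close> only has to differ from the vertices that remain, so it may reuse one of the
  names \<open>p\<close>, \<open>q\<close>, \<open>r\<close>. Up to isomorphism this changes nothing, and it keeps the reduction
  applicable when the vertex type is finite and has no unused element.
\<close>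

definition D3a :: "'a graph \<Rightarrow> 'a graph \<Rightarrow> bool" where
  "D3a G H \<longleftrightarrow> (\<exists>p q r v N.
     p \<in> verts G \<and> q \<in> verts G \<and> r \<in> verts G \<and> distinct [p, q, r] \<and>
     degree G p = 3 \<and> degree G q = 3 \<and> degree G r = 3 \<and>
     {p, q} \<in> edges G \<and> {q, r} \<in> edges G \<and> {p, r} \<in> edges G \<and>
     N = (nbrs G p \<union> nbrs G q \<union> nbrs G r) - {p, q, r} \<and> card N = 3 \<and>
     v \<notin> verts G - {p, q, r} \<and>
     H = \<lparr>verts = insert v (verts G - {p, q, r}),
          edges = {e \<in> edges G. e \<inter> {p, q, r} = {}} \<union> {{v, x} | x. x \<in> N}\<rparr>)"

definition D3b :: "'a graph \<Rightarrow> 'a graph \<Rightarrow> bool" where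
  "D3b G H \<longleftrightarrow> (\<exists>p q r s.
     p \<in> verts G \<and> q \<in> verts G \<and> r \<in> verts G \<and> s \<in> verts G \<and> distinct [p, q, r] \<and>
     degree G p = 3 \<and> degree G q = 3 \<and> degree G r = 3 \<and>
     {p, q} \<in> edges G \<and> {q, r} \<in> edges G \<and> {p, r} \<notin> edges G \<and>
     {s, p} \<in> edges G \<and> {s, q} \<in> edges G \<and> {s, r} \<in> edges G \<and>
     H = \<lparr>verts = verts G - {q}, edges = insert {p, r} {e \<in> edges G. q \<notin> e}\<rparr>)"

definition D3_step :: "'a graph \<Rightarrow> 'a graph \<Rightarrow> bool" where
  "D3_step G H \<longleftrightarrow> D3a G H \<or> D3b G H"

definition D3_reducible :: "'a graph \<Rightarrow> bool" where
  "D3_reducible G \<longleftrightarrow> (\<exists>H. D3_step\<^sup>*\<^sup>* G H \<and> isomorphic H K4)"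

section \<open>A unit-cost random access machine\<close>

text \<open>
  Structured programs over finitely many registers and arrays of natural numbers (a program
  mentions only finitely many names). Every operator, test, memory access and control step costs
  one time unit. The only arithmetic is adding or subtracting one, so after \<open>t\<close> time units no
  value exceeds the largest constant or input value by more than \<open>t\<close>. For linear running times
  all values therefore fit into words of logarithmic length, and unit cost cannot be
  exploited through huge numbers.
\<close>

datatype exp =
    Const nat
  | Reg string
  | Elem string exp
  | Inc exp
  | Dec exp

datatype bexp =
    Eq exp exp
  | Less exp exp
  | Not bexp
  | And bexp bexp

datatype prog =
    Skip
  | Assign string exp
  | Update string exp exp
  | Seq prog prog
  | If bexp prog prog
  | While bexp prog

record store =
  regs :: "string \<Rightarrow> nat"
  arrs :: "string \<Rightarrow> nat \<Rightarrow> nat"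

fun exp_val :: "exp \<Rightarrow> store \<Rightarrow> nat" where
  "exp_val (Const k) s = k"
| "exp_val (Reg x) s = regs s x"
| "exp_val (Elem a e) s = arrs s a (exp_val e s)"
| "exp_val (Inc e) s = exp_val e s + 1"
| "exp_val (Dec e) s = exp_val e s - 1"

fun exp_cost :: "exp \<Rightarrow> nat" where
  "exp_cost (Const k) = 1"
| "exp_cost (Reg x) = 1"
| "exp_cost (Elem a e) = exp_cost e + 1"
| "exp_cost (Inc e) = exp_cost e + 1"
| "exp_cost (Dec e) = exp_cost e + 1"

fun bexp_val :: "bexp \<Rightarrow> store \<Rightarrow> bool" where
  "bexp_val (Eq e f) s \<longleftrightarrow> exp_val e s = exp_val f s"
| "bexp_val (Less e f) s \<longleftrightarrow> exp_val e s < exp_val f s"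
| "bexp_val (Not b) s \<longleftrightarrow> \<not> bexp_val b s"
| "bexp_val (And b c) s \<longleftrightarrow> bexp_val b s \<and> bexp_val c s"

fun bexp_cost :: "bexp \<Rightarrow> nat" where
  "bexp_cost (Eq e f) = exp_cost e + exp_cost f + 1"
| "bexp_cost (Less e f) = exp_cost e + exp_cost f + 1"
| "bexp_cost (Not b) = bexp_cost b + 1"
| "bexp_cost (And b c) = bexp_cost b + bexp_cost c + 1"

text \<open>\<open>exec c s t s'\<close>: started in \<open>s\<close>, program \<open>c\<close> halts in \<open>s'\<close> after exactly \<open>t\<close> time units.\<close>

inductive exec :: "prog \<Rightarrow> store \<Rightarrow> nat \<Rightarrow> store \<Rightarrow> bool" where
  Skip: "exec Skip s 1 s"
| Assign: "exec (Assign x e) s (exp_cost e + 1) (s\<lparr>regs := (regs s)(x := exp_val e s)\<rparr>)"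
| Update: "exec (Update a i e) s (exp_cost i + exp_cost e + 1)
    (s\<lparr>arrs := (arrs s)(a := (arrs s a)(exp_val i s := exp_val e s))\<rparr>)"
| Seq: "exec c s t s' \<Longrightarrow> exec d s' u s'' \<Longrightarrow> exec (Seq c d) s (t + u) s''"
| IfTrue: "bexp_val b s \<Longrightarrow> exec c s t s' \<Longrightarrow> exec (If b c d) s (bexp_cost b + t + 1) s'"
| IfFalse: "\<not> bexp_val b s \<Longrightarrow> exec d s t s' \<Longrightarrow> exec (If b c d) s (bexp_cost b + t + 1) s'"
| WhileFalse: "\<not> bexp_val b s \<Longrightarrow> exec (While b c) s (bexp_cost b + 1) s"
| WhileTrue: "bexp_val b s \<Longrightarrow> exec c s t s' \<Longrightarrow> exec (While b c) s' u s'' \<Longrightarrow>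
    exec (While b c) s (bexp_cost b + t + u + 1) s''"

section \<open>Graphs as machine input\<close>

text \<open>
  The vertices are \<open>0, \<dots>, n - 1\<close>, and \<open>xs ! v\<close> lists the neighbours of \<open>v\<close> in an arbitrary order.
\<close>

definition adjacency_lists :: "nat graph \<Rightarrow> nat list list \<Rightarrow> bool" where
  "adjacency_lists G xs \<longleftrightarrow> verts G = {..<length xs} \<and>
     (\<forall>v<length xs. distinct (xs ! v) \<and> set (xs ! v) = nbrs G v)"

text \<open>
  Register \<open>n\<close> holds the number of vertices, array \<open>adj\<close> the concatenation of all adjacency lists.
  The list of \<open>v\<close> occupies the positions from \<open>off[v]\<close> up to but excluding \<open>off[v + 1]\<close>. All other
  memory is zero.
\<close>

definition input_store :: "nat list list \<Rightarrow> store" where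
  "input_store xs =
    \<lparr>regs = (\<lambda>_. 0)(''n'' := length xs),
     arrs = (\<lambda>_ _. 0)
       (''off'' := (\<lambda>v. if v \<le> length xs then length (concat (take v xs)) else 0),
        ''adj'' := (\<lambda>i. if i < length (concat xs) then concat xs ! i else 0))\<rparr>"

definition output_list :: "nat \<Rightarrow> store \<Rightarrow> nat list" where
  "output_list n s = map (arrs s ''cyc'') [0..<n]"

end

(* Both reductions lift Hamiltonian cycles. When the triangle p, q, r was contracted to v, a cycle
   through v enters and leaves by two of the three outside edges, and the detour through the triangle
   can visit its three vertices in the matching order. When q was deleted between p and r, either the
   cycle uses the edge pr, where q is inserted, or it leaves p and r by their edges to s, and q is
   inserted between p and s. In both cases the lift is a sequence of operations "insert x after y"
   on the successor function of the cycle.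

   A greedy algorithm finds a reduction sequence because reductions are confluent: two reductions of
   the same graph either commute or lead to isomorphic graphs, and K4 is irreducible, so every
   reduction of a D3-reducible graph is again D3-reducible.

   The algorithm keeps the adjacency lists as an array of darts with twin pointers, so that each
   reduction takes constant time even at vertices of large degree. The twins come from transposing the
   adjacency lists twice, because the first transposition sorts them. Only the neighbourhoods of its
   three cubic vertices decide whether a reduction applies, so after a reduction it suffices to
   re-examine the constantly many vertices whose neighbourhood has changed; they are pushed on a stack.
   4 |V| plus the height of the stack decreases in each round. The cycle of the final K4 is
   lifted along the log of the reductions. *)

theory Submission
  imports Defs
begin

section \<open>Canonical D3 reductions\<close>

text \<open>D3a leaves the name of the new vertex open, so its result is fixed only up to
  isomorphism. A canonical reduction reuses a name of the pattern: its result is then a function of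
  the pattern, isomorphisms carry patterns and results along unchanged, and independent reductions
  commute as equalities of graphs. Confluence comes down to overlaps. A triangle and a path pattern
  never share a cubic vertex. Two path patterns that interfere have isomorphic results, and so have
  two triangles joined by two or more edges: there contracting one destroys the pattern of the
  other, but the two results are mirror images. As one step on each side always closes the gap, an
  induction on the number of vertices suffices. A vertex on the stack may be an end of a path whose
  middle is one of its neighbours, so a round examines the vertex and its neighbours as centers. A
  success removes at least one vertex and pushes three, which is why a vertex has to weigh four in
  the potential.\<close>

text \<open>
  \<open>confA G y u w s a b\<close>: the triangle \<open>y\<close>, \<open>u\<close>, \<open>w\<close> of a D3a reduction with the outside neighbours \<open>s\<close>,
  \<open>a\<close>, \<open>b\<close>, in this order; \<open>redA\<close> contracts it and reuses the name \<open>y\<close>. \<open>confB G y u w s\<close>: the path \<open>u\<close>, \<open>y\<close>, \<open>w\<close> of a D3b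
  reduction with the common neighbour \<open>s\<close>; \<open>redB\<close> deletes the middle vertex \<open>y\<close>.
\<close>

definition confA :: "'a graph \<Rightarrow> 'a \<Rightarrow> 'a \<Rightarrow> 'a \<Rightarrow> 'a \<Rightarrow> 'a \<Rightarrow> 'a \<Rightarrow> bool" where
  "confA G y u w s a b \<longleftrightarrow> distinct [y, u, w, s, a, b] \<and>
     nbrs G y = {u, w, s} \<and> nbrs G u = {y, w, a} \<and> nbrs G w = {y, u, b}"

definition confB :: "'a graph \<Rightarrow> 'a \<Rightarrow> 'a \<Rightarrow> 'a \<Rightarrow> 'a \<Rightarrow> bool" where
  "confB G y u w s \<longleftrightarrow> distinct [y, u, w, s] \<and> nbrs G y = {u, w, s} \<and>
     card (nbrs G u) = 3 \<and> card (nbrs G w) = 3 \<and>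
     s \<in> nbrs G u \<and> s \<in> nbrs G w \<and> w \<notin> nbrs G u"

definition redA :: "'a graph \<Rightarrow> 'a \<Rightarrow> 'a \<Rightarrow> 'a \<Rightarrow> 'a \<Rightarrow> 'a \<Rightarrow> 'a \<Rightarrow> 'a graph" where
  "redA G y u w s a b = \<lparr>verts = verts G - {u, w},
     edges = {e \<in> edges G. e \<inter> {y, u, w} = {}} \<union> {{y, s}, {y, a}, {y, b}}\<rparr>"

definition redB :: "'a graph \<Rightarrow> 'a \<Rightarrow> 'a \<Rightarrow> 'a \<Rightarrow> 'a graph" where
  "redB G y u w = \<lparr>verts = verts G - {y}, edges = insert {u, w} {e \<in> edges G. y \<notin> e}\<rparr>"

definition can_step :: "'a graph \<Rightarrow> 'a graph \<Rightarrow> bool" where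
  "can_step G H \<longleftrightarrow> (\<exists>y u w s a b. confA G y u w s a b \<and> H = redA G y u w s a b) \<or>
     (\<exists>y u w s. confB G y u w s \<and> H = redB G y u w)"

text \<open>Phrased by neighbourhoods, because the effect of a reduction is given by a formula for
  the neighbourhood of each vertex. On simple graphs it agrees with
  \<open>isomorphic\<close>.\<close>

definition iso_by :: "('a \<Rightarrow> 'b) \<Rightarrow> 'a graph \<Rightarrow> 'b graph \<Rightarrow> bool" where
  "iso_by f G H \<longleftrightarrow> bij_betw f (verts G) (verts H) \<and>
     (\<forall>v\<in>verts G. nbrs H (f v) = f ` nbrs G v)"

section \<open>Neighbourhoods in simple graphs\<close>

lemma in_nbrs: "u \<in> nbrs G v \<longleftrightarrow> {v, u} \<in> edges G"
  by (simp add: nbrs_def)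

lemma nbrs_sym: "u \<in> nbrs G v \<longleftrightarrow> v \<in> nbrs G u"
  by (simp add: nbrs_def insert_commute)

lemma nbrs_irrefl: "simple_graph G \<Longrightarrow> v \<notin> nbrs G v"
  by (auto simp: nbrs_def simple_graph_def)

lemma nbrs_verts: "simple_graph G \<Longrightarrow> u \<in> nbrs G v \<Longrightarrow> u \<in> verts G \<and> v \<in> verts G"
  by (auto simp: nbrs_def simple_graph_def)

lemma nbrs_subset: "simple_graph G \<Longrightarrow> nbrs G v \<subseteq> verts G"
  using nbrs_verts by fast

lemma finite_nbrs: "simple_graph G \<Longrightarrow> finite (nbrs G v)"
  by (meson finite_subset nbrs_subset simple_graph_def)

lemma edge_cases:
  assumes "simple_graph G" "e \<in> edges G"
  obtains x y where "e = {x, y}" "x \<noteq> y" "x \<in> verts G" "y \<in> verts G" "y \<in> nbrs G x"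
proof -
  have "card e = 2" "e \<subseteq> verts G" using assms by (auto simp: simple_graph_def)
  then obtain x y where "e = {x, y}" "x \<noteq> y" by (meson card_2_iff)
  then show thesis using that assms \<open>e \<subseteq> verts G\<close> by (auto simp: nbrs_def)
qed

text \<open>Every edge of a simple graph is a pair, so neighbourhoods determine the edge set. This
  turns the equality of two iterated contractions into a calculation at each vertex.\<close>

lemma graph_eqI:
  fixes G H :: "'a graph"
  assumes "simple_graph G" "simple_graph H" "verts G = verts H" "\<And>v. nbrs G v = nbrs H v"
  shows "G = H"
proof -
  have "edges G \<subseteq> edges H" if sG: "simple_graph G" and eq: "\<And>v. nbrs G v = nbrs H v" for G H :: "'a graph"
  proof
    fix e assume "e \<in> edges G"
    then obtain x y where "e = {x, y}" "y \<in> nbrs G x" using edge_cases[OF sG] by blast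
    then show "e \<in> edges H" using eq by (auto simp: nbrs_def)
  qed
  then have "edges G = edges H" using assms by (metis subset_antisym)
  then show ?thesis using assms(3) by simp
qed

section \<open>Patterns and the effect of canonical reductions\<close>

lemma confA_neq:
  assumes "confA G y u w s a b"
  shows "y \<noteq> u" "u \<noteq> y" "y \<noteq> w" "w \<noteq> y" "y \<noteq> s" "s \<noteq> y" "y \<noteq> a" "a \<noteq> y" "y \<noteq> b" "b \<noteq> y"
    "u \<noteq> w" "w \<noteq> u" "u \<noteq> s" "s \<noteq> u" "u \<noteq> a" "a \<noteq> u" "u \<noteq> b" "b \<noteq> u" "w \<noteq> s" "s \<noteq> w"
    "w \<noteq> a" "a \<noteq> w" "w \<noteq> b" "b \<noteq> w" "s \<noteq> a" "a \<noteq> s" "s \<noteq> b" "b \<noteq> s" "a \<noteq> b" "b \<noteq> a"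
  using assms by (simp_all add: confA_def eq_sym_conv)

lemma confA_verts:
  assumes "simple_graph G" "confA G y u w s a b"
  shows "{y, u, w, s, a, b} \<subseteq> verts G"
  using assms nbrs_subset[OF assms(1), of y] nbrs_subset[OF assms(1), of u]
    nbrs_subset[OF assms(1), of w] by (auto simp: confA_def)

lemma confA_outer:
  assumes "confA G y u w s a b"
  shows "v \<in> {y, u, w} \<or> y \<in> nbrs G v \<longleftrightarrow> v \<in> {y, u, w, s}"
    and "v \<in> {y, u, w} \<or> u \<in> nbrs G v \<longleftrightarrow> v \<in> {y, u, w, a}"
    and "v \<in> {y, u, w} \<or> w \<in> nbrs G v \<longleftrightarrow> v \<in> {y, u, w, b}"
  using assms by (auto simp: confA_def nbrs_sym[of _ G v])

lemma confA_not_nbr: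
  assumes "confA G y u w s a b" "v \<notin> {y, u, w}"
  shows "y \<in> nbrs G v \<longleftrightarrow> v = s" "u \<in> nbrs G v \<longleftrightarrow> v = a" "w \<in> nbrs G v \<longleftrightarrow> v = b"
  using assms by (auto simp: confA_def nbrs_sym[of _ G v])

lemma confB_verts:
  assumes "simple_graph G" "confB G y u w s"
  shows "{y, u, w, s} \<subseteq> verts G"
  using assms nbrs_subset[OF assms(1), of y] nbrs_verts[OF assms(1), of u y]
   nbrs_subset[OF assms(1), of u] by (auto simp: confB_def)

text \<open>Both ends have degree three and already see \<open>y\<close> and \<open>s\<close>, which
  leaves one neighbour each. The two may coincide: in a wheel with four spokes both are the rim
  vertex opposite \<open>y\<close>.\<close>

lemma confB_nbrs:
  assumes "simple_graph G" "confB G y u w s"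
  obtains a b where "nbrs G u = {y, s, a}" "nbrs G w = {y, s, b}" "a \<notin> {y, u, w, s}" "b \<notin> {y, u, w, s}"
proof -
  have *: "\<exists>a. nbrs G u = {y, s, a} \<and> a \<notin> {y, s}" if "card (nbrs G u) = 3" "y \<in> nbrs G u" "s \<in> nbrs G u" for u
  proof -
    have "card (nbrs G u - {y, s}) = 1"
      using that assms by (subst card_Diff_subset) (auto simp: confB_def)
    then obtain a where "nbrs G u - {y, s} = {a}" using card_1_singletonE by blast
    then show ?thesis using that by blast
  qed
  have yu: "y \<in> nbrs G u" "y \<in> nbrs G w" using assms nbrs_sym[of y G] by (auto simp: confB_def)
  obtain a b where ab: "nbrs G u = {y, s, a}" "a \<notin> {y, s}" "nbrs G w = {y, s, b}" "b \<notin> {y, s}"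
    using *[of u] *[of w] assms yu by (auto simp: confB_def)
  moreover have "w \<notin> nbrs G u" "u \<notin> nbrs G w" using assms nbrs_sym[of w G u] by (auto simp: confB_def)
  ultimately have "a \<notin> {y, u, w, s}" "b \<notin> {y, u, w, s}" using nbrs_irrefl[OF assms(1), of u] nbrs_irrefl[OF assms(1), of w]
    by auto
  then show thesis using that ab by blast
qed

lemma verts_redA [simp]: "verts (redA G y u w s a b) = verts G - {u, w}"
  by (simp add: redA_def)

lemma verts_redB [simp]: "verts (redB G y u w) = verts G - {y}"
  by (simp add: redB_def)

lemma in_nbrs_redA:
  assumes "confA G y u w s a b"
  shows "v \<in> nbrs (redA G y u w s a b) x \<longleftrightarrow>
    v \<in> nbrs G x \<and> v \<notin> {y, u, w} \<and> x \<notin> {y, u, w} \<or> x = y \<and> v \<in> {s, a, b} \<or> v = y \<and> x \<in> {s, a, b}"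
  using assms by (auto simp: redA_def nbrs_def confA_def doubleton_eq_iff)

text \<open>Because the new vertex is called \<open>y\<close>, the neighbourhood of \<open>s\<close>
  does not change. Among the surviving vertices only \<open>y\<close>, \<open>a\<close> and
  \<open>b\<close> change; these are the vertices that the program pushes.\<close>

lemma nbrs_redA:
  assumes "confA G y u w s a b"
  shows "nbrs (redA G y u w s a b) v = (if v = y then {s, a, b} else if v \<in> {u, w} then {}
    else if v = a then insert y (nbrs G a - {u}) else if v = b then insert y (nbrs G b - {w}) else nbrs G v)"
  using confA_outer[OF assms, of v] assms
  by (intro set_eqI, subst in_nbrs_redA[OF assms]) (auto simp: confA_def)

lemma in_nbrs_redB:
  assumes "confB G y u w s"
  shows "v \<in> nbrs (redB G y u w) x \<longleftrightarrow>
    v \<in> nbrs G x \<and> v \<noteq> y \<and> x \<noteq> y \<or> x = u \<and> v = w \<or> x = w \<and> v = u"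
  using assms by (auto simp: redB_def nbrs_def confB_def doubleton_eq_iff)

text \<open>The ends trade \<open>y\<close> for each other and keep degree three. Only
  \<open>s\<close> loses a neighbour.\<close>

lemma nbrs_redB:
  assumes "confB G y u w s"
  shows "nbrs (redB G y u w) v = (if v = y then {} else if v = u then insert w (nbrs G u - {y})
    else if v = w then insert u (nbrs G w - {y}) else if v = s then nbrs G s - {y} else nbrs G v)"
proof -
  have "y \<in> nbrs G v \<longleftrightarrow> v \<in> {u, w, s}" using assms nbrs_sym[of y G v] by (auto simp: confB_def)
  then show ?thesis using assms
    by (intro set_eqI, subst in_nbrs_redB[OF assms]) (auto simp: confB_def)
qed

lemma simple_redA:
  assumes "simple_graph G" "confA G y u w s a b"
  shows "simple_graph (redA G y u w s a b)"
proof -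
  have "e \<subseteq> verts G - {u, w} \<and> card e = 2" if "e \<in> {{y, s}, {y, a}, {y, b}}" for e
    using that confA_verts[OF assms] assms(2) by (elim insertE) (auto simp: confA_def)
  moreover have "e \<subseteq> verts G - {u, w} \<and> card e = 2" if "e \<in> edges G" "e \<inter> {y, u, w} = {}" for e
    using that assms(1) by (auto simp: simple_graph_def)
  ultimately show ?thesis
    using assms(1) unfolding simple_graph_def redA_def by simp blast
qed

lemma simple_redB:
  assumes "simple_graph G" "confB G y u w s"
  shows "simple_graph (redB G y u w)"
proof -
  have "{u, w} \<subseteq> verts G - {y} \<and> card {u, w} = 2"
    using confB_verts[OF assms] assms(2) by (auto simp: confB_def)
  then show ?thesis
    using assms(1) unfolding simple_graph_def redB_def by auto
qed

lemma simple_can_step: "simple_graph G \<Longrightarrow> can_step G H \<Longrightarrow> simple_graph H"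
  by (auto simp: can_step_def simple_redA simple_redB)

lemma card_can_step:
  assumes "simple_graph G" "can_step G H"
  shows "card (verts H) < card (verts G)"
proof -
  have "\<exists>x\<in>verts G. verts H \<subseteq> verts G - {x}"
    using assms(2) unfolding can_step_def
  proof (elim disjE exE conjE)
    fix y u w s a b assume "confA G y u w s a b" "H = redA G y u w s a b"
    then show ?thesis using confA_verts[OF assms(1)] by (intro bexI[of _ u]) auto
  next
    fix y u w s assume "confB G y u w s" "H = redB G y u w"
    then show ?thesis using confB_verts[OF assms(1)] by (intro bexI[of _ y]) auto
  qed
  then have "verts H \<subset> verts G" by blast
  then show ?thesis using assms by (simp add: psubset_card_mono simple_graph_def)
qed

text \<open>The pattern has all symmetries of the triangle, but reusing the name \<open>y\<close>
  singles out one vertex. Swapping \<open>u\<close> and \<open>w\<close> leaves the result equal; a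
  rotation changes the surviving name, so it preserves the result only up to isomorphism.\<close>

lemma confA_swap: "confA G y u w s a b \<Longrightarrow> confA G y w u s b a"
  by (auto simp: confA_def)
lemma confA_rot: "confA G y u w s a b \<Longrightarrow> confA G u y w a s b"
  by (auto simp: confA_def)
lemma confB_swap: "confB G y u w s \<Longrightarrow> confB G y w u s"
  using nbrs_sym[of u G w] by (auto simp: confB_def)
lemma redA_swap: "redA G y w u s b a = redA G y u w s a b"
  by (auto simp: redA_def)

section \<open>Transport of canonical steps along isomorphisms\<close>

lemma isomorphic_iff_iso_by:
  assumes "simple_graph G" "simple_graph H"
  shows "isomorphic G H \<longleftrightarrow> (\<exists>f. iso_by f G H)"
proof -
  have "(\<forall>u\<in>verts G. \<forall>v\<in>verts G. {u, v} \<in> edges G \<longleftrightarrow> {f u, f v} \<in> edges H) \<longleftrightarrow>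
      (\<forall>v\<in>verts G. nbrs H (f v) = f ` nbrs G v)" if f: "bij_betw f (verts G) (verts H)" for f
  proof -
    have img: "f ` verts G = verts H" and inj: "inj_on f (verts G)" using f by (auto simp: bij_betw_def)
    have "nbrs H (f v) \<subseteq> f ` verts G" for v using nbrs_subset[OF assms(2)] img by auto
    note calculation = this nbrs_subset[OF assms(1)]
    have "(\<forall>v\<in>verts G. {u, v} \<in> edges G \<longleftrightarrow> {f u, f v} \<in> edges H) \<longleftrightarrow> nbrs H (f u) = f ` nbrs G u" for u
    proof -
      have mem: "f v \<in> f ` nbrs G u \<longleftrightarrow> v \<in> nbrs G u" if "v \<in> verts G" for v
        using inj_on_image_mem_iff[OF inj that] calculation(2) by blast
      show ?thesis unfolding in_nbrs[symmetric]
      proof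
        assume L: "\<forall>v\<in>verts G. (v \<in> nbrs G u) = (f v \<in> nbrs H (f u))"
        show "nbrs H (f u) = f ` nbrs G u"
        proof (intro subset_antisym subsetI)
          fix x assume x: "x \<in> nbrs H (f u)"
          then obtain v where "v \<in> verts G" "x = f v" using calculation(1) by blast
          then show "x \<in> f ` nbrs G u" using x L by blast
        next
          fix x assume "x \<in> f ` nbrs G u"
          then show "x \<in> nbrs H (f u)" using L calculation(2) by blast
        qed
      next
        assume "nbrs H (f u) = f ` nbrs G u"
        then show "\<forall>v\<in>verts G. (v \<in> nbrs G u) = (f v \<in> nbrs H (f u))" using mem by simp
      qed
    qed
    then show ?thesis by simp
  qed
  then show ?thesis unfolding isomorphic_def iso_by_def by blast
qed

lemma iso_by_trans: 
  assumes "simple_graph G" "iso_by f G H" "iso_by g H K" shows "iso_by (g \<circ> f) G K"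
proof -
  have "f v \<in> verts H" if "v \<in> verts G" for v using assms that by (auto simp: iso_by_def bij_betw_def)
  then show ?thesis
    using assms by (auto simp: iso_by_def image_comp intro: bij_betw_trans)
qed

lemma iso_by_sym:
  assumes "simple_graph G" "iso_by f G H"
  shows "iso_by (inv_into (verts G) f) H G"
  unfolding iso_by_def
proof (intro conjI ballI)
  have f: "bij_betw f (verts G) (verts H)" using assms by (simp add: iso_by_def)
  then show "bij_betw (inv_into (verts G) f) (verts H) (verts G)" by (rule bij_betw_inv_into)
  fix v assume v: "v \<in> verts H"
  define u where "u = inv_into (verts G) f v"
  have u: "u \<in> verts G" "f u = v"
    using v f unfolding u_def by (auto simp: bij_betw_def inv_into_into f_inv_into_f)
  then have "nbrs H v = f ` nbrs G u" using assms(2) by (auto simp: iso_by_def)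
  then have "inv_into (verts G) f ` nbrs H v = nbrs G u"
    using f nbrs_subset[OF assms(1), of u] by (simp add: bij_betw_def inv_into_image_cancel)
  then show "nbrs G (inv_into (verts G) f v) = inv_into (verts G) f ` nbrs H v" by (simp add: u_def)
qed

lemma iso_by_refl: "iso_by id G G"
  by (simp add: iso_by_def)

lemma iso_by_confA:
  assumes "simple_graph G" "iso_by f G H" "confA G y u w s a b"
  shows "confA H (f y) (f u) (f w) (f s) (f a) (f b)"
proof -
  note V = confA_verts[OF assms(1,3)]
  have inj: "f x = f z \<longleftrightarrow> x = z" if "x \<in> verts G" "z \<in> verts G" for x z
    using that assms(2) by (auto simp: iso_by_def bij_betw_def inj_on_eq_iff)
  show ?thesis using V assms(2,3) by (auto simp: confA_def iso_by_def inj)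
qed

lemma iso_by_confB:
  assumes "simple_graph G" "iso_by f G H" "confB G y u w s"
  shows "confB H (f y) (f u) (f w) (f s)"
proof -
  note V = confB_verts[OF assms(1,3)]
  have I: "inj_on f (verts G)" using assms(2) by (auto simp: iso_by_def bij_betw_def)
  have inj: "f x = f z \<longleftrightarrow> x = z" if "x \<in> verts G" "z \<in> verts G" for x z
    using that I by (auto simp: inj_on_eq_iff)
  have c: "card (f ` nbrs G v) = card (nbrs G v)" for v
    using I nbrs_subset[OF assms(1)] by (meson card_image inj_on_subset)
  have w: "f w \<notin> f ` nbrs G u" if "w \<notin> nbrs G u" 
    using that V nbrs_subset[OF assms(1), of u] inj by auto
  show ?thesis using V assms(2,3) w by (auto simp: confB_def iso_by_def inj c)
qed

lemma iso_by_redA: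
  assumes "simple_graph G" "iso_by f G H" "confA G y u w s a b"
  shows "iso_by f (redA G y u w s a b) (redA H (f y) (f u) (f w) (f s) (f a) (f b))"
proof -
  note V = confA_verts[OF assms(1,3)]
  have I: "inj_on f (verts G)" and img: "f ` verts G = verts H" using assms(2) by (auto simp: iso_by_def bij_betw_def)
  have inj: "f x = f z \<longleftrightarrow> x = z" if "x \<in> verts G" "z \<in> verts G" for x z
    using that I by (auto simp: inj_on_eq_iff)
  have d: "f ` (nbrs G v - {x}) = f ` nbrs G v - {f x}" if "x \<in> verts G" for v x
    using inj_on_image_set_diff[OF I, of "nbrs G v" "{x}"] nbrs_subset[OF assms(1), of v] that by auto
  have n: "nbrs H (f v) = f ` nbrs G v" if "v \<in> verts G" for v using that assms(2) by (auto simp: iso_by_def)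
  have "bij_betw f (verts G - {u, w}) (verts H - {f u, f w})"
    using V I img inj_on_image_set_diff[OF I, of "verts G" "{u,w}"]
    by (auto simp: bij_betw_def intro: inj_on_subset)
  then show ?thesis using V
    by (auto simp: iso_by_def nbrs_redA[OF assms(3)] nbrs_redA[OF iso_by_confA[OF assms]] inj d n)
qed

lemma iso_by_redB:
  assumes "simple_graph G" "iso_by f G H" "confB G y u w s"
  shows "iso_by f (redB G y u w) (redB H (f y) (f u) (f w))"
proof -
  note V = confB_verts[OF assms(1,3)]
  have I: "inj_on f (verts G)" and img: "f ` verts G = verts H" using assms(2) by (auto simp: iso_by_def bij_betw_def)
  have inj: "f x = f z \<longleftrightarrow> x = z" if "x \<in> verts G" "z \<in> verts G" for x z
    using that I by (auto simp: inj_on_eq_iff)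
  have d: "f ` (nbrs G v - {x}) = f ` nbrs G v - {f x}" if "x \<in> verts G" for v x
    using inj_on_image_set_diff[OF I, of "nbrs G v" "{x}"] nbrs_subset[OF assms(1), of v] that by auto
  have n: "nbrs H (f v) = f ` nbrs G v" if "v \<in> verts G" for v using that assms(2) by (auto simp: iso_by_def)
  have "bij_betw f (verts G - {y}) (verts H - {f y})"
    using V I img inj_on_image_set_diff[OF I, of "verts G" "{y}"]
    by (auto simp: bij_betw_def intro: inj_on_subset)
  then show ?thesis using V
    by (auto simp: iso_by_def nbrs_redB[OF assms(3)] nbrs_redB[OF iso_by_confB[OF assms]] inj d n)
qed

text \<open>Canonical steps create no names, so the map that relates the graphs before the step also
  relates them afterwards.\<close>

lemma iso_by_can_step:
  assumes "simple_graph G" "iso_by f G H" "can_step G G'"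
  shows "\<exists>H'. can_step H H' \<and> iso_by f G' H'"
  using assms(3)[unfolded can_step_def]
proof (elim disjE exE conjE)
  fix y u w s a b assume c: "confA G y u w s a b" "G' = redA G y u w s a b"
  show ?thesis unfolding can_step_def c(2)
    using iso_by_redA[OF assms(1,2) c(1)] iso_by_confA[OF assms(1,2) c(1)] by blast
next
  fix y u w s assume c: "confB G y u w s" "G' = redB G y u w"
  show ?thesis unfolding can_step_def c(2)
    using iso_by_redB[OF assms(1,2) c(1)] iso_by_confB[OF assms(1,2) c(1)] by blast
qed

section \<open>D3 steps as canonical steps up to isomorphism\<close>

lemma D3b_confB:
  assumes "simple_graph G" "D3b G H"
  shows "\<exists>y u w s. confB G y u w s \<and> H = redB G y u w"
proof -
  obtain p q r s where *: "distinct [p, q, r]" "card (nbrs G p) = 3" "card (nbrs G q) = 3" "card (nbrs G r) = 3"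
    "q \<in> nbrs G p" "r \<in> nbrs G q" "r \<notin> nbrs G p" "s \<in> nbrs G p" "s \<in> nbrs G q" "s \<in> nbrs G r"
    "H = redB G q p r"
    using assms(2) unfolding D3b_def degree_def in_nbrs redB_def by (auto simp: insert_commute)
  have ne: "s \<noteq> p" "s \<noteq> q" "s \<noteq> r" using * nbrs_irrefl[OF assms(1)] by auto
  have "{p, r, s} \<subseteq> nbrs G q" using * nbrs_sym[of q G p] by auto
  moreover have "card {p, r, s} = 3" using * ne by auto
  ultimately have "nbrs G q = {p, r, s}"
    using card_subset_eq[OF finite_nbrs[OF assms(1)], of "{p, r, s}" q] * by simp
  then have "confB G q p r s" using * ne by (auto simp: confB_def)
  then show ?thesis using * by blast
qed

lemma D3a_confA:
  assumes "simple_graph G" "D3a G H"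
  shows "\<exists>y u w s a b f. confA G y u w s a b \<and> iso_by f H (redA G y u w s a b)"
proof -
  obtain p q r v N where *: "distinct [p, q, r]" "card (nbrs G p) = 3" "card (nbrs G q) = 3" "card (nbrs G r) = 3"
    "q \<in> nbrs G p" "r \<in> nbrs G q" "r \<in> nbrs G p" "p \<in> verts G"
    and N: "N = (nbrs G p \<union> nbrs G q \<union> nbrs G r) - {p, q, r}" "card N = 3"
    and v: "v \<notin> verts G - {p, q, r}"
    and H: "H = \<lparr>verts = insert v (verts G - {p, q, r}),
          edges = {e \<in> edges G. e \<inter> {p, q, r} = {}} \<union> {{v, x} | x. x \<in> N}\<rparr>"
    using assms(2) unfolding D3a_def degree_def in_nbrs by blast
  have third: "\<exists>c. nbrs G x = {z, z', c} \<and> c \<notin> {x, z, z'}" 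
    if "card (nbrs G x) = 3" "z \<in> nbrs G x" "z' \<in> nbrs G x" "z \<noteq> z'" for x z z'
  proof -
    have "card (nbrs G x - {z, z'}) = 1" using that by (subst card_Diff_subset) auto
    then obtain c where "nbrs G x - {z, z'} = {c}" using card_1_singletonE by blast
    moreover have "x \<notin> nbrs G x" using nbrs_irrefl[OF assms(1)] .
    ultimately show ?thesis using that by blast
  qed
  obtain s where s: "nbrs G p = {q, r, s}" "s \<notin> {p, q, r}" using third[of p q r] * by auto
  obtain a where a: "nbrs G q = {p, r, a}" "a \<notin> {p, q, r}" using third[of q p r] * nbrs_sym[of p G q] by auto
  obtain b where b: "nbrs G r = {p, q, b}" "b \<notin> {p, q, r}"
    using third[of r p q] * nbrs_sym[of p G r] nbrs_sym[of q G r] by auto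
  have Neq: "N = {s, a, b}" using N(1) s a b by auto
  \<comment> \<open>Each triangle vertex has exactly one outside neighbour; that \<open>N\<close>
    has three elements keeps the three apart.\<close>
  then have "distinct [s, a, b]" using N(2) by (auto simp: card_insert_if split: if_splits)
  then have conf: "confA G p q r s a b" using * s a b by (auto simp: confA_def)
  let ?R = "redA G p q r s a b"
  \<comment> \<open>Only the new vertex is renamed. It may be fresh or one of \<open>p\<close>,
    \<open>q\<close>, \<open>r\<close>; in every case it differs from the vertices that remain, and
    outside \<open>{p, q, r}\<close> it is not a vertex of \<open>G\<close>.\<close>
  let ?f = "\<lambda>x. if x = v then p else x"
  note V = confA_verts[OF assms(1) conf]
  have vE: "{v, x} \<notin> edges G" "{x, v} \<notin> edges G" if "x \<notin> {p, q, r}" "v \<notin> {p, q, r}" for x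
    using v that nbrs_verts[OF assms(1), of x v] by (auto simp: in_nbrs insert_commute)
  have NV: "v \<notin> {s, a, b}" using v V s a b by auto
  have "bij_betw ?f (verts H) (verts ?R)"
    using v V s(2) *(1) unfolding H by (auto simp: bij_betw_def inj_on_def)
  moreover have "nbrs ?R (?f x) = ?f ` nbrs H x" if "x \<in> verts H" for x
  proof (cases "x = v")
    case True
    have "nbrs H v = {s, a, b}" using vE NV v nbrs_verts[OF assms(1)]
      unfolding H Neq by (auto simp: nbrs_def doubleton_eq_iff)
    then show ?thesis using True NV by (auto simp: nbrs_redA[OF conf])
  next
    case False
    then have x: "x \<in> verts G" "x \<notin> {p, q, r}" using that H by auto
    have H': "z \<in> nbrs H x \<longleftrightarrow> z \<in> nbrs G x \<and> z \<notin> {p, q, r} \<or> z = v \<and> x \<in> {s, a, b}" for z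
      using x False unfolding H Neq by (auto simp: nbrs_def doubleton_eq_iff)
    have vx: "v \<in> nbrs G x \<Longrightarrow> v \<in> {p, q, r}" using vE(2)[of x] x by (auto simp: in_nbrs)
    show ?thesis
    proof (intro set_eqI iffI)
      fix z assume "z \<in> nbrs ?R (?f x)"
      then have "z \<in> nbrs G x \<and> z \<notin> {p, q, r} \<or> z = p \<and> x \<in> {s, a, b}"
        using False x by (auto simp: in_nbrs_redA[OF conf])
      then show "z \<in> ?f ` nbrs H x"
      proof
        assume "z \<in> nbrs G x \<and> z \<notin> {p, q, r}"
        then show ?thesis using H'[of z] vx by (intro image_eqI[of _ _ z]) auto
      next
        assume "z = p \<and> x \<in> {s, a, b}"
        then show ?thesis using H'[of v] by (intro image_eqI[of _ _ v]) auto
      qed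
    next
      fix z assume "z \<in> ?f ` nbrs H x"
      then obtain z' where "z' \<in> nbrs H x" "z = ?f z'" by blast
      then show "z \<in> nbrs ?R (?f x)" using H'[of z'] vx False x
        by (auto simp: in_nbrs_redA[OF conf])
    qed
  qed
  ultimately have "iso_by ?f H ?R" by (simp add: iso_by_def)
  then show ?thesis using conf by blast
qed

lemma D3_step_can_step:
  assumes "simple_graph G" "D3_step G H"
  shows "\<exists>H' f. can_step G H' \<and> iso_by f H H'"
  using assms(2) unfolding D3_step_def
proof
  assume "D3b G H"
  then show ?thesis using D3b_confB[OF assms(1)] iso_by_refl unfolding can_step_def by metis
next
  assume "D3a G H"
  then show ?thesis using D3a_confA[OF assms(1)] unfolding can_step_def by metis
qed

lemma simple_D3_step:
  assumes "simple_graph G" "D3_step G H"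
  shows "simple_graph H"
  using assms(2) unfolding D3_step_def
proof
  assume "D3b G H"
  then show ?thesis using D3b_confB[OF assms(1)] simple_redB[OF assms(1)] by blast
next
  assume "D3a G H"
  then obtain p q r v N where 
    N: "N = (nbrs G p \<union> nbrs G q \<union> nbrs G r) - {p, q, r}"
    and v: "v \<notin> verts G - {p, q, r}"
    and H: "H = \<lparr>verts = insert v (verts G - {p, q, r}),
          edges = {e \<in> edges G. e \<inter> {p, q, r} = {}} \<union> {{v, x} | x. x \<in> N}\<rparr>"
    unfolding D3a_def by blast
  have "N \<subseteq> verts G - {p, q, r}" using N nbrs_subset[OF assms(1)] by blast
  then have Nv: "x \<in> verts H \<and> v \<noteq> x" if "x \<in> N" for x using that v H by auto
  then have "e \<subseteq> verts H \<and> card e = 2" if e: "e \<in> {{v, x} | x. x \<in> N}" for e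
  proof -
    obtain x where "e = {v, x}" "x \<in> N" using e by blast
    then show ?thesis using Nv[of x] H by simp
  qed
  moreover have "e \<subseteq> verts H \<and> card e = 2" if "e \<in> edges G" "e \<inter> {p, q, r} = {}" for e
    using that assms(1) H by (auto simp: simple_graph_def)
  moreover have "finite (verts H)" using assms(1) H by (simp add: simple_graph_def)
  ultimately show ?thesis unfolding simple_graph_def H by simp blast
qed

lemma simple_K4: "simple_graph K4"
  by (auto simp: simple_graph_def K4_def)

definition can_reducible :: "'a graph \<Rightarrow> bool" where
  "can_reducible G \<longleftrightarrow> (\<exists>H f. can_step\<^sup>*\<^sup>* G H \<and> iso_by f H K4)"

lemma simple_can_steps: "can_step\<^sup>*\<^sup>* G H \<Longrightarrow> simple_graph G \<Longrightarrow> simple_graph H"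
  by (induction rule: rtranclp_induct) (auto intro: simple_can_step)

text \<open>The sequence is replayed along \<open>f\<close>. The same \<open>f\<close> relates the
  two final graphs, so its inverse, followed by the isomorphism of the first one to
  \<open>K4\<close>, serves the second.\<close>

lemma can_reducible_iso:
  assumes "simple_graph G" "iso_by f G H" "simple_graph H" "can_reducible G"
  shows "can_reducible H"
proof -
  obtain K g where K: "can_step\<^sup>*\<^sup>* G K" "iso_by g K K4" using assms(4) by (auto simp: can_reducible_def)
  have "\<exists>L. can_step\<^sup>*\<^sup>* H L \<and> iso_by f K L"
    using K(1)
  proof (induction rule: rtranclp_induct)
    case base
    then show ?case using assms by blast
  next
    case (step K K')
    then obtain L where L: "can_step\<^sup>*\<^sup>* H L" "iso_by f K L" by blast
    have "simple_graph K" using step.hyps(1) assms(1) simple_can_steps by blast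
    then show ?case using iso_by_can_step[OF _ L(2) step.hyps(2)] L(1) by (meson rtranclp.rtrancl_into_rtrancl)
  qed
  then obtain L where L: "can_step\<^sup>*\<^sup>* H L" "iso_by f K L" by blast
  have sK: "simple_graph K" using simple_can_steps K(1) assms(1) by blast
  have sL: "simple_graph L" using simple_can_steps L(1) assms(3) by blast
  show ?thesis unfolding can_reducible_def
    using L(1) iso_by_trans[OF sL iso_by_sym[OF sK L(2)] K(2)] by blast
qed

text \<open>A D3 step matches a canonical one only up to isomorphism, and the mismatches would pile
  up along the sequence. Peeling off the first step and using that reducibility is invariant under
  isomorphism absorbs them one at a time.\<close>

lemma D3_reducible_can_reducible:
  assumes "simple_graph G" "D3_reducible G"
  shows "can_reducible G"
proof -
  obtain H where H: "D3_step\<^sup>*\<^sup>* G H" "isomorphic H K4" using assms(2) by (auto simp: D3_reducible_def)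
  have sH: "simple_graph H" using H(1) assms(1)
    by (induction rule: rtranclp_induct) (auto intro: simple_D3_step)
  from H(1) assms(1) show ?thesis
  proof (induction rule: converse_rtranclp_induct)
    case base
    then show ?case using H(2) isomorphic_iff_iso_by[OF sH simple_K4] unfolding can_reducible_def by blast
  next
    case (step G G')
    then have s: "simple_graph G'" using simple_D3_step by blast
    then have r: "can_reducible G'" using step by blast
    obtain G'' f where G'': "can_step G G''" "iso_by f G' G''" using D3_step_can_step step by blast
    then have "can_reducible G''" using can_reducible_iso[OF s G''(2) _ r] simple_can_step[OF step.prems] by blast
    then show ?case unfolding can_reducible_def using G''(1) by (meson converse_rtranclp_into_rtranclp)
  qed
qed

section \<open>Confluence\<close>

definition iso_graphs :: "'a graph \<Rightarrow> 'b graph \<Rightarrow> bool" where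
  "iso_graphs G H \<longleftrightarrow> (\<exists>f. iso_by f G H)"

text \<open>Serves to compare reductions of one graph that differ only in the name of a surviving
  vertex. Adjacency is symmetric, so checking the renamed vertex from its own side also settles it
  from the side of its neighbours.\<close>

lemma iso_renameI:
  assumes "y \<in> verts G" "verts H = insert z (verts G - {y})" "z \<notin> verts G - {y}"
    and "simple_graph G" "simple_graph H"
    and "\<And>v x. v \<in> verts G \<Longrightarrow> x \<in> verts G \<Longrightarrow> v \<noteq> y \<Longrightarrow> x \<noteq> y \<Longrightarrow> x \<in> nbrs H v \<longleftrightarrow> x \<in> nbrs G v"
    and "\<And>x. x \<in> verts G \<Longrightarrow> x \<noteq> y \<Longrightarrow> x \<in> nbrs H z \<longleftrightarrow> x \<in> nbrs G y"
  shows "iso_graphs G H"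
proof -
  let ?f = "\<lambda>x. if x = y then z else x"
  have "bij_betw ?f (verts G) (verts H)"
    using assms(1-3) by (auto simp: bij_betw_def inj_on_def)
  moreover have "nbrs H (?f v) = ?f ` nbrs G v" if v: "v \<in> verts G" for v
  proof (intro set_eqI)
    fix x
    have im: "x \<in> ?f ` A \<longleftrightarrow> (x \<noteq> y \<and> x \<in> A) \<or> (x = z \<and> y \<in> A)" for A by auto
    show "x \<in> nbrs H (?f v) \<longleftrightarrow> x \<in> ?f ` nbrs G v"
    proof (cases "x \<in> verts H")
      case False
      then have "x \<notin> nbrs H (?f v)" "x \<notin> nbrs G v \<or> x = y" "x \<noteq> z"
        using nbrs_subset[OF assms(5)] nbrs_subset[OF assms(4)] assms(2) by auto
      then show ?thesis unfolding im by auto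
    next
      case True
      show ?thesis
      proof (cases "x = z")
        case True
        have "x \<noteq> y \<Longrightarrow> x \<notin> nbrs G v" using True assms(3) nbrs_subset[OF assms(4)] by auto
        moreover have "z \<in> nbrs H (?f v) \<longleftrightarrow> y \<in> nbrs G v"
        proof (cases "v = y")
          case True
          then show ?thesis using nbrs_irrefl[OF assms(5)] nbrs_irrefl[OF assms(4)] by auto
        next
          case False
          then show ?thesis using assms(7)[OF v False] nbrs_sym[of v H z] nbrs_sym[of v G y] by auto
        qed
        ultimately show ?thesis unfolding im using True nbrs_irrefl[OF assms(4)] by auto
      next
        case False
        then have x: "x \<in> verts G" "x \<noteq> y" using True assms(2) by auto
        then have "x \<in> nbrs H (?f v) \<longleftrightarrow> x \<in> nbrs G v"
          using assms(6)[OF v x(1)] assms(7) by auto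
        then show ?thesis unfolding im using False x by auto
      qed
    qed
  qed
  ultimately show ?thesis unfolding iso_graphs_def iso_by_def by blast
qed

lemma iso_graphs_trans: "simple_graph G \<Longrightarrow> iso_graphs G H \<Longrightarrow> iso_graphs H K \<Longrightarrow> iso_graphs G K"
  unfolding iso_graphs_def using iso_by_trans by blast

lemma iso_graphs_sym: "simple_graph G \<Longrightarrow> iso_graphs G H \<Longrightarrow> iso_graphs H G"
  unfolding iso_graphs_def using iso_by_sym by blast

lemma iso_graphs_refl: "iso_graphs G G"
  unfolding iso_graphs_def using iso_by_refl by blast

section \<open>Two triangles with a common vertex\<close>

lemma confA_rename:
  assumes "simple_graph G" "confA G y u w s a b"
  shows "iso_graphs (redA G y u w s a b) (redA G u y w a s b)"
proof (rule iso_renameI[of y _ _ u])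
  note c = assms(2)[unfolded confA_def] and c' = confA_rot[OF assms(2)]
  note n = nbrs_redA[OF assms(2)] nbrs_redA[OF c'] and n' = in_nbrs_redA[OF assms(2)] in_nbrs_redA[OF c']
  show "simple_graph (redA G y u w s a b)" "simple_graph (redA G u y w a s b)"
    by (simp_all add: simple_redA[OF assms] simple_redA[OF assms(1) c'])
  show "y \<in> verts (redA G y u w s a b)" "verts (redA G u y w a s b) = insert u (verts (redA G y u w s a b) - {y})"
    "u \<notin> verts (redA G y u w s a b) - {y}"
    using confA_verts[OF assms] c by auto
  fix v x assume vx: "v \<in> verts (redA G y u w s a b)" "x \<in> verts (redA G y u w s a b)" "v \<noteq> y" "x \<noteq> y"
  then show "x \<in> nbrs (redA G u y w a s b) v \<longleftrightarrow> x \<in> nbrs (redA G y u w s a b) v"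
    by (simp add: n')
next
  note c = assms(2)[unfolded confA_def] and c' = confA_rot[OF assms(2)]
  note n = nbrs_redA[OF assms(2)] nbrs_redA[OF c']
  fix x assume "x \<in> verts (redA G y u w s a b)" "x \<noteq> y"
  then show "x \<in> nbrs (redA G u y w a s b) u \<longleftrightarrow> x \<in> nbrs (redA G y u w s a b) y"
    by (auto simp: n)
qed

lemma confA_unique:
  assumes "confA G y u w s a b" "confA G y u w s' a' b'"
  shows "s' = s" "a' = a" "b' = b"
proof -
  have third: "z' = z" if "{x, y, z} = {x, y, z'}" "x \<noteq> z" "y \<noteq> z" "x \<noteq> z'" "y \<noteq> z'" for x y z z' :: 'a
  proof -
    have "z' \<in> {x, y, z}" unfolding that(1) by simp
    then show ?thesis using that(4,5) by auto
  qed
  note d = assms[unfolded confA_def]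
  show "s' = s" by (rule third[of u w]) (use d in simp_all)
  show "a' = a" by (rule third[of y w]) (use d in simp_all)
  show "b' = b" by (rule third[of y u]) (use d in simp_all)
qed

text \<open>Since \<open>s\<close> differs from \<open>a\<close> and \<open>b\<close>, it is
  adjacent to neither \<open>u\<close> nor \<open>w\<close>. So \<open>u\<close> and
  \<open>w\<close> form the only adjacent pair among the neighbours of \<open>y\<close>, and any
  triangle at \<open>y\<close> must use it.\<close>

lemma confA_same_vertex:
  assumes "confA G y u w s a b" "confA G y u' w' s' a' b'"
  shows "u' = u \<and> w' = w \<or> u' = w \<and> w' = u"
proof -
  have "s \<notin> nbrs G u" "s \<notin> nbrs G w" "u \<notin> nbrs G s" "w \<notin> nbrs G s"
    using assms(1) nbrs_sym[of _ G s] by (auto simp: confA_def)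
  moreover have "{u', w', s'} = {u, w, s}" "w' \<in> nbrs G u'" "u' \<in> nbrs G w'" "u' \<noteq> w'"
    using assms by (auto simp: confA_def)
  ultimately show ?thesis by (metis insertCI insertE singletonD)
qed

lemma redA_same_vertex:
  assumes "confA G y u w s a b" "confA G y u' w' s' a' b'"
  shows "redA G y u' w' s' a' b' = redA G y u w s a b"
  using confA_same_vertex[OF assms] confA_unique[OF assms(1), of s' a' b']
    confA_unique[OF confA_swap[OF assms(1)], of s' a' b'] assms(2) redA_swap by metis

lemma confA_rot2: "confA G y u w s a b \<Longrightarrow> confA G w y u b s a"
  by (auto simp: confA_def)

lemma redA_overlap:
  assumes "simple_graph G" "confA G y u w s a b" "confA G y' u' w' s' a' b'" "y' \<in> {y, u, w}"
  shows "iso_graphs (redA G y u w s a b) (redA G y' u' w' s' a' b')"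
proof -
  have "iso_graphs (redA G y u w s a b) (redA G w y u b s a)"
    using confA_rename[OF assms(1) confA_swap[OF assms(2)]] redA_swap by metis
  then show ?thesis
    using assms(4) iso_graphs_refl confA_rename[OF assms(1,2)]
    redA_same_vertex[OF assms(2), of u' w' s' a' b'] redA_same_vertex[OF confA_rot[OF assms(2)], of u' w' s' a' b']
    redA_same_vertex[OF confA_rot2[OF assms(2)], of u' w' s' a' b'] assms(3) by auto
qed

text \<open>Rotating both patterns so that a common vertex becomes their first vertex reduces this
  to uniqueness of the triangle at that vertex.\<close>

lemma confA_inter:
  assumes "confA G y u w s a b" "confA G y' u' w' s' a' b'" "{y, u, w} \<inter> {y', u', w'} \<noteq> {}"
  shows "y' \<in> {y, u, w}"
proof -
  have *: "y' \<in> {y, u, w}" if "confA G y u w s a b" "confA G y' u' w' s' a' b'" and yT: "y \<in> {y', u', w'}" for y u w s a b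
  proof -
    consider "y = y'" | "y = u'" | "y = w'" using yT by blast
    then show ?thesis
      using confA_same_vertex[OF that(1)] that(2) confA_rot[OF that(2)] confA_rot2[OF that(2)] by cases blast+
  qed
  consider "y \<in> {y', u', w'}" | "u \<in> {y', u', w'}" | "w \<in> {y', u', w'}" using assms(3) by blast
  then show ?thesis
    using *[OF assms(1,2)] *[OF confA_rot[OF assms(1)] assms(2)] *[OF confA_rot2[OF assms(1)] assms(2)]
    by cases blast+
qed

text \<open>Two triangles joined by two edges: after either contraction the other triangle is the
  mirror image of the first.\<close>

lemma redA_double_edge:
  assumes G: "simple_graph G" and c: "confA G y u w s u' w'" and c': "confA G y' u' w' s' u w"
    and d: "{y, u, w} \<inter> {y', u', w'} = {}"
  shows "iso_graphs (redA G y u w s u' w') (redA G y' u' w' s' u w)"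
proof -
  let ?H = "redA G y u w s u' w'" and ?K = "redA G y' u' w' s' u w"
  \<comment> \<open>In \<open>?H\<close> both \<open>y\<close> and \<open>y'\<close> are joined to
    the two ends of the surviving edge \<open>u' w'\<close>, and in \<open>?K\<close> to those of
    \<open>u w\<close>. So it suffices to move one edge onto the other and to fix \<open>y\<close>
    and \<open>y'\<close>.\<close>
  define f where "f = (\<lambda>x. if x = u' then u else if x = w' then w else x)"
  note c1 = c[unfolded confA_def] and c1' = c'[unfolded confA_def]
  note V = confA_verts[OF G c] confA_verts[OF G c']
  have "y \<noteq> y'" "y' \<noteq> y" using d by auto
  note neqs = confA_neq[OF c] confA_neq[OF c'] this
  have "bij_betw f (verts ?H) (verts ?K)"
    using V d c1 c1' unfolding f_def bij_betw_def inj_on_def by auto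
  moreover have "nbrs ?K (f v) = f ` nbrs ?H v" if "v \<in> verts ?H" for v
  proof -
    have v: "v \<notin> {u, w}" using that by simp
    have n: "u \<in> nbrs G v \<longleftrightarrow> v \<in> {y, w, u'}" "w \<in> nbrs G v \<longleftrightarrow> v \<in> {y, u, w'}" "y \<in> nbrs G v \<longleftrightarrow> v \<in> {u, w, s}"
      "u' \<in> nbrs G v \<longleftrightarrow> v \<in> {y', w', u}" "w' \<in> nbrs G v \<longleftrightarrow> v \<in> {y', u', w}" "y' \<in> nbrs G v \<longleftrightarrow> v \<in> {u', w', s'}"
      using c1 c1' nbrs_sym[of _ G v] by auto
    consider "v = y" | "v = y'" | "v = u'" | "v = w'" | "v \<notin> {y, u, w, y', u', w'}" using v by blast
    then show ?thesis
    proof cases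
      assume v: "v \<notin> {y, u, w, y', u', w'}"
      have "nbrs G v \<inter> {u, w, u', w'} = {}" using n v by auto
      then have "f ` nbrs G v = nbrs G v" unfolding f_def by (auto simp: image_iff)
      then show ?thesis using v n by (simp add: nbrs_redA[OF c] nbrs_redA[OF c'] f_def)
    next
      assume "v = y"
      then show ?thesis using c1 c1' by (simp add: nbrs_redA[OF c] nbrs_redA[OF c'] f_def neqs insert_commute)
    next
      assume "v = y'"
      then show ?thesis using c1 c1' by (simp add: nbrs_redA[OF c] nbrs_redA[OF c'] f_def neqs insert_commute)
    next
      assume v: "v = u'"
      have "nbrs G u - {u'} = {y, w}" "nbrs G u' - {u} = {y', w'}" using c1 c1' neqs by auto
      then show ?thesis using v by (simp add: nbrs_redA[OF c] nbrs_redA[OF c'] f_def neqs insert_commute)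
    next
      assume v: "v = w'"
      have "nbrs G w - {w'} = {y, u}" "nbrs G w' - {w} = {y', u'}" using c1 c1' neqs by auto
      then show ?thesis using v by (simp add: nbrs_redA[OF c] nbrs_redA[OF c'] f_def neqs insert_commute)
    qed
  qed
  ultimately show ?thesis unfolding iso_graphs_def iso_by_def by blast
qed

section \<open>Two disjoint triangles\<close>

definition joinable :: "'a graph \<Rightarrow> 'a graph \<Rightarrow> bool" where
  "joinable H K \<longleftrightarrow> iso_graphs H K \<or> (\<exists>J. can_step H J \<and> can_step K J)"

text \<open>From outside, a contraction is a collapsing map applied to neighbourhoods. In this form
  two contractions commute because their collapsing maps do.\<close>

lemma nbrs_redA_image:
  assumes "confA G y u w s a b" "v \<notin> {y, u, w}"
  shows "nbrs (redA G y u w s a b) v = (\<lambda>x. if x \<in> {y, u, w} then y else x) ` nbrs G v"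
proof (intro set_eqI)
  fix z
  have im: "z \<in> (\<lambda>x. if x \<in> T then y else x) ` A \<longleftrightarrow> (z \<notin> T \<and> z \<in> A) \<or> (z = y \<and> A \<inter> T \<noteq> {})" for A T
    by (auto simp: image_iff split: if_splits)
  have "nbrs G v \<inter> {y, u, w} \<noteq> {} \<longleftrightarrow> v \<in> {s, a, b}"
    using confA_not_nbr[OF assms] by auto
  then show "z \<in> nbrs (redA G y u w s a b) v \<longleftrightarrow> z \<in> (\<lambda>x. if x \<in> {y, u, w} then y else x) ` nbrs G v"
    unfolding im in_nbrs_redA[OF assms(1)] using assms(2) by auto
qed

text \<open>The other triangle survives unless two of its outside neighbours are collapsed into the
  same vertex.\<close>

lemma confA_redA:
  assumes c: "confA G y u w s a b" and c': "confA G y' u' w' s' a' b'"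
    and d: "{y, u, w} \<inter> {y', u', w'} = {}"
    and "\<not> (s' \<in> {y, u, w} \<and> a' \<in> {y, u, w})" "\<not> (s' \<in> {y, u, w} \<and> b' \<in> {y, u, w})"
      "\<not> (a' \<in> {y, u, w} \<and> b' \<in> {y, u, w})"
  defines "f \<equiv> \<lambda>x. if x \<in> {y, u, w} then y else x"
  shows "confA (redA G y u w s a b) y' u' w' (f s') (f a') (f b')"
proof -
  have d1: "y' \<notin> {y, u, w}" "u' \<notin> {y, u, w}" "w' \<notin> {y, u, w}" using d by auto
  then have fd: "f y' = y'" "f u' = u'" "f w' = w'" by (simp_all add: f_def)
  note C' = c'[unfolded confA_def]
  have n: "nbrs (redA G y u w s a b) v = f ` nbrs G v" if "v \<in> {y', u', w'}" for v
    using nbrs_redA_image[OF c, of v] that d1 unfolding f_def by auto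
  have i: "f x = f z \<longleftrightarrow> x = z \<or> x \<in> {y, u, w} \<and> z \<in> {y, u, w}" for x z
    unfolding f_def by auto
  have "distinct [f y', f u', f w', f s', f a', f b']"
    using C' assms(4-6) d1 by (simp add: i)
  then have "distinct [y', u', w', f s', f a', f b']" unfolding fd .
  then show ?thesis using C' fd by (simp add: confA_def n)
qed

text \<open>An edge between the triangles is an outside edge of both, so it can be seen from either
  side.\<close>

lemma crossing:
  assumes c: "confA G y u w s a b" and c': "confA G y' u' w' s' a' b'"
    and d: "{y, u, w} \<inter> {y', u', w'} = {}"
  shows "y' \<in> {s, a, b} \<longleftrightarrow> s' \<in> {y, u, w}"
proof -
  have "y' \<in> {s, a, b} \<longleftrightarrow> nbrs G y' \<inter> {y, u, w} \<noteq> {}"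
    using confA_not_nbr[OF c, of y'] d by auto
  moreover have "nbrs G y' = {u', w', s'}" using c' by (simp add: confA_def)
  ultimately show ?thesis using d by auto
qed

text \<open>The bound on the cardinality says that at most one edge joins the triangles. By
  \<open>crossing\<close> it applies to both sides, so each pattern survives the contraction of the
  other.\<close>

lemma redA_commute:
  assumes G: "simple_graph G" and c: "confA G y u w s a b" and c': "confA G y' u' w' s' a' b'"
    and d: "{y, u, w} \<inter> {y', u', w'} = {}"
    and one: "card ({s, a, b} \<inter> {y', u', w'}) \<le> 1"
  shows "joinable (redA G y u w s a b) (redA G y' u' w' s' a' b')"
proof -
  let ?T = "{y, u, w}" and ?T' = "{y', u', w'}"
  define f where "f = (\<lambda>x. if x \<in> ?T then y else x)"
  define g where "g = (\<lambda>x. if x \<in> ?T' then y' else x)"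
  note C = c[unfolded confA_def] and C' = c'[unfolded confA_def]
  note V = confA_verts[OF G c] confA_verts[OF G c']
  let ?H = "redA G y u w s a b" and ?K = "redA G y' u' w' s' a' b'"
  have d1: "y' \<notin> ?T" "u' \<notin> ?T" "w' \<notin> ?T" and d2: "y \<notin> ?T'" "u \<notin> ?T'" "w \<notin> ?T'" using d by auto
  have fd: "f y' = y'" "f u' = u'" "f w' = w'" and gd: "g y = y" "g u = u" "g w = w"
    using d1 d2 by (simp_all add: f_def g_def)
  have cross: "y' \<in> {s, a, b} \<longleftrightarrow> s' \<in> ?T" "u' \<in> {s, a, b} \<longleftrightarrow> a' \<in> ?T" "w' \<in> {s, a, b} \<longleftrightarrow> b' \<in> ?T"
  proof -
    have "{y, u, w} \<inter> {u', y', w'} = {}" "{y, u, w} \<inter> {w', y', u'} = {}" using d by blast+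
    note dd = this
    show "y' \<in> {s, a, b} \<longleftrightarrow> s' \<in> ?T" by (rule crossing[OF c c' d])
    show "u' \<in> {s, a, b} \<longleftrightarrow> a' \<in> ?T" by (rule crossing[OF c confA_rot[OF c'] dd(1)])
    show "w' \<in> {s, a, b} \<longleftrightarrow> b' \<in> ?T" by (rule crossing[OF c confA_rot2[OF c'] dd(2)])
  qed
  have two: "\<not> (v \<in> {s, a, b} \<inter> ?T' \<and> v' \<in> {s, a, b} \<inter> ?T' \<and> v \<noteq> v')" for v v'
  proof
    assume h: "v \<in> {s, a, b} \<inter> ?T' \<and> v' \<in> {s, a, b} \<inter> ?T' \<and> v \<noteq> v'"
    then have "card {v, v'} \<le> card ({s, a, b} \<inter> ?T')" by (intro card_mono) blast+
    then show False using one h by simp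
  qed
  have out: "\<not> (s' \<in> ?T \<and> a' \<in> ?T)" "\<not> (s' \<in> ?T \<and> b' \<in> ?T)" "\<not> (a' \<in> ?T \<and> b' \<in> ?T)"
    using two[of y' u'] two[of y' w'] two[of u' w'] C' unfolding cross[symmetric] by simp_all
  have out': "\<not> (s \<in> ?T' \<and> a \<in> ?T')" "\<not> (s \<in> ?T' \<and> b \<in> ?T')" "\<not> (a \<in> ?T' \<and> b \<in> ?T')"
    using two[of s a] two[of s b] two[of a b] C by simp_all
  have cH: "confA ?H y' u' w' (f s') (f a') (f b')"
    using confA_redA[OF c c' d out] by (simp add: f_def)
  have cK: "confA ?K y u w (g s) (g a) (g b)"
    using confA_redA[OF c' c _ out'] d by (simp add: g_def inf_commute)
  have "redA ?H y' u' w' (f s') (f a') (f b') = redA ?K y u w (g s) (g a) (g b)"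
  proof (rule graph_eqI)
    have "simple_graph ?H" "simple_graph ?K" using simple_redA[OF G c] simple_redA[OF G c'] by simp_all
    then show "simple_graph (redA ?H y' u' w' (f s') (f a') (f b'))" "simple_graph (redA ?K y u w (g s) (g a) (g b))"
      by (simp_all add: simple_redA[OF _ cH] simple_redA[OF _ cK])
    show "verts (redA ?H y' u' w' (f s') (f a') (f b')) = verts (redA ?K y u w (g s) (g a) (g b))" by auto
    fix v
    consider "v = y" | "v = y'" | "v \<in> {u, w, u', w'}" | "v \<notin> ?T \<union> ?T'" by blast
    then show "nbrs (redA ?H y' u' w' (f s') (f a') (f b')) v = nbrs (redA ?K y u w (g s) (g a) (g b)) v"
    proof cases
      case 1
      have "nbrs (redA ?H y' u' w' (f s') (f a') (f b')) y = g ` nbrs ?H y"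
        using nbrs_redA_image[OF cH d2(1)] by (simp only: g_def)
      also have "nbrs ?H y = {s, a, b}" by (simp add: nbrs_redA[OF c])
      finally show ?thesis using 1 nbrs_redA[OF cK, of y] by simp
    next
      case 2
      have "nbrs (redA ?K y u w (g s) (g a) (g b)) y' = f ` nbrs ?K y'"
        using nbrs_redA_image[OF cK d1(1)] by (simp only: f_def)
      also have "nbrs ?K y' = {s', a', b'}" by (simp add: nbrs_redA[OF c'])
      finally show ?thesis using 2 nbrs_redA[OF cH, of y'] by simp
    next
      case 3
      \<comment> \<open>These four vertices are contracted away on both sides, so both
        neighbourhoods are empty.\<close>
      have "v \<notin> verts (redA ?H y' u' w' (f s') (f a') (f b'))" "v \<notin> verts (redA ?K y u w (g s) (g a) (g b))"
        using 3 by auto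
      moreover have "nbrs L v = {}" if "simple_graph L" "v \<notin> verts L" for L using that nbrs_verts by fast
      ultimately show ?thesis using simple_redA[OF simple_redA[OF G c] cH] simple_redA[OF simple_redA[OF G c'] cK]
        by metis
    next
      case 4
      have "nbrs (redA ?H y' u' w' (f s') (f a') (f b')) v = g ` f ` nbrs G v"
        using nbrs_redA_image[OF cH] nbrs_redA_image[OF c] 4 unfolding f_def g_def by simp
      moreover have "nbrs (redA ?K y u w (g s) (g a) (g b)) v = f ` g ` nbrs G v"
        using nbrs_redA_image[OF cK] nbrs_redA_image[OF c'] 4 unfolding f_def g_def by simp
      moreover have "f (g x) = g (f x)" for x using d1 d2 unfolding f_def g_def by simp
      ultimately show ?thesis by (simp add: image_image)
    qed
  qed
  then show ?thesis using cH cK unfolding joinable_def can_step_def by metis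
qed

section \<open>A triangle and a path\<close>

text \<open>Among the neighbours of \<open>y\<close> only \<open>u\<close> and \<open>w\<close> are
  adjacent, and \<open>y\<close> is their only common neighbour. Among the neighbours of
  \<open>q\<close>, and also of \<open>t\<close>, there would be two adjacent pairs. If
  \<open>y\<close> were an end of the path, then \<open>q\<close> and \<open>t\<close> would be
  \<open>u\<close> and \<open>w\<close>, and the other end would be a second common
  neighbour.\<close>

lemma confAB_disjoint1:
  assumes G: "simple_graph G" and c: "confA G y u w s a b" and c': "confB G q p r t"
  shows "y \<notin> {q, p, r, t}"
proof -
  have sym: "x \<in> nbrs G z" if "z \<in> nbrs G x" for x z using that nbrs_sym by metis
  have A: "nbrs G y = {u, w, s}" "w \<in> nbrs G u" "s \<notin> nbrs G u" "s \<notin> nbrs G w" "u \<noteq> w"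
    and common: "\<And>z. z \<in> nbrs G u \<Longrightarrow> z \<in> nbrs G w \<Longrightarrow> z = y"
    using c by (auto simp: confA_def)
  have A': "u \<in> nbrs G w" "u \<notin> nbrs G s" "w \<notin> nbrs G s" using A sym by blast+
  have B: "nbrs G q = {p, r, t}" "r \<notin> nbrs G p" "t \<in> nbrs G p" "t \<in> nbrs G r" "p \<noteq> r" "distinct [q, p, r, t]"
    using c' by (auto simp: confB_def)
  have B': "p \<notin> nbrs G r" "p \<in> nbrs G t" "r \<in> nbrs G t" "q \<in> nbrs G p" "q \<in> nbrs G r" "q \<in> nbrs G t"
    using B sym by blast+
  show ?thesis
  proof (intro notI, elim insertE emptyE)
    assume "y = q"
    then have "p \<in> {u, w, s}" "r \<in> {u, w, s}" "t \<in> {u, w, s}" using A B by auto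
    then show False using A A' B B' by auto
  next
    assume y: "y = t"
    then have "p \<in> {u, w, s}" "r \<in> {u, w, s}" "q \<in> {u, w, s}" using A B' by auto
    then show False using A A' B B' by auto
  next
    assume y: "y = p"
    then have "q \<in> {u, w, s}" "t \<in> {u, w, s}" using A B B' by auto
    then have "q = u \<and> t = w \<or> q = w \<and> t = u" using A A' B B' by auto
    then have "r = y" using common[of r] sym B B' by blast
    then show False using y B by simp
  next
    assume y: "y = r"
    then have "q \<in> {u, w, s}" "t \<in> {u, w, s}" using A B B' by auto
    then have "q = u \<and> t = w \<or> q = w \<and> t = u" using A A' B B' by auto
    then have "p = y" using common[of p] sym B B' by blast
    then show False using y B by simp
  qed
qed

lemma card_swap:
  assumes "finite A" "z \<in> A" "x \<notin> A"
  shows "card (insert x (A - {z})) = card A"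
proof -
  have "card (insert x (A - {z})) = Suc (card (A - {z}))" using assms by simp
  then show ?thesis using card_Suc_Diff1[OF assms(1,2)] by simp
qed

text \<open>The contracted triangle may be adjacent to \<open>p\<close>, \<open>r\<close> or
  \<open>t\<close>. An end that loses a triangle vertex gains \<open>y\<close>, so it stays cubic,
  while the neighbourhood of \<open>q\<close> is untouched.\<close>

lemma redA_redB_commute:
  assumes G: "simple_graph G" and c: "confA G y u w s a b" and c': "confB G q p r t"
  shows "joinable (redA G y u w s a b) (redB G q p r)"
proof -
  have d: "{y, u, w} \<inter> {q, p, r, t} = {}"
    using confAB_disjoint1[OF G c c'] confAB_disjoint1[OF G confA_rot[OF c] c']
      confAB_disjoint1[OF G confA_rot2[OF c] c'] by blast
  note C = c[unfolded confA_def] and C' = c'[unfolded confB_def]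
  have q: "q \<notin> {s, a, b}" 
  proof -
    have "q \<notin> {y, u, w}" "{y, u, w} \<inter> nbrs G q = {}" using C' d by auto
    then show ?thesis using confA_not_nbr[OF c, of q] by auto
  qed
  have y: "y \<in> nbrs G v \<longleftrightarrow> v = s" "u \<in> nbrs G v \<longleftrightarrow> v = a" "w \<in> nbrs G v \<longleftrightarrow> v = b" if "v \<in> {q, p, r, t}" for v
  proof -
    have v: "v \<notin> {y, u, w}" using that d by auto
    show "y \<in> nbrs G v \<longleftrightarrow> v = s" "u \<in> nbrs G v \<longleftrightarrow> v = a" "w \<in> nbrs G v \<longleftrightarrow> v = b"
      using confA_not_nbr[OF c v] .
  qed
  have "confB (redA G y u w s a b) q p r t"
  proof -
    have "card (nbrs (redA G y u w s a b) v) = card (nbrs G v)" if "v \<in> {p, r}" for v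
      using that d y[of v] C card_swap[OF finite_nbrs[OF G], of _ a y] card_swap[OF finite_nbrs[OF G], of _ b y]
      by (auto simp: nbrs_redA[OF c])
    moreover have "nbrs (redA G y u w s a b) q = nbrs G q" using d q by (auto simp: nbrs_redA[OF c])
    moreover have "t \<in> nbrs (redA G y u w s a b) p" "t \<in> nbrs (redA G y u w s a b) r"
      "r \<notin> nbrs (redA G y u w s a b) p"
      using d C' by (auto simp: in_nbrs_redA[OF c])
    ultimately show ?thesis using C' by (simp add: confB_def)
  qed
  moreover have "confA (redB G q p r) y u w s a b"
    using C d by (auto simp: confA_def nbrs_redB[OF c'])
  moreover have "redB (redA G y u w s a b) q p r = redA (redB G q p r) y u w s a b"
  proof -
    have "verts G - {u, w} - {q} = verts G - {q} - {u, w}" by auto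
    moreover have "q \<noteq> y" "{p, r} \<inter> {y, u, w} = {}" using d by auto
    then have "insert {p, r} {e \<in> {e \<in> edges G. e \<inter> {y, u, w} = {}} \<union> {{y, s}, {y, a}, {y, b}}. q \<notin> e} =
      {e \<in> insert {p, r} {e \<in> edges G. q \<notin> e}. e \<inter> {y, u, w} = {}} \<union> {{y, s}, {y, a}, {y, b}}"
      using q by auto
    ultimately show ?thesis by (simp add: redA_def redB_def)
  qed
  ultimately show ?thesis unfolding joinable_def can_step_def by metis
qed

section \<open>Two paths\<close>

text \<open>Distinct middles interfere in three ways. If \<open>q' = t\<close>, then
  \<open>q\<close> and \<open>t\<close> are adjacent with the same other neighbours \<open>p\<close>
  and \<open>r\<close>. If \<open>q'\<close> is an end of the first path, the middles are
  consecutive around a common hub. If the paths share both ends, the middles have the same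
  neighbours. In each case one middle can stand in for the other; otherwise the deletions
  commute.\<close>

lemma redB_joinable:
  assumes G: "simple_graph G" and c: "confB G q p r t" and c': "confB G q' p' r' t'"
  shows "joinable (redB G q p r) (redB G q' p' r')"
proof -
  note C = c[unfolded confB_def] and C' = c'[unfolded confB_def]
  have sym: "x \<in> nbrs G z \<longleftrightarrow> z \<in> nbrs G x" for x z by (rule nbrs_sym)
  note V = confB_verts[OF G c] confB_verts[OF G c']
  note S = simple_redB[OF G c] simple_redB[OF G c']
  show ?thesis
  proof (cases "q' = q")
    case True
    \<comment> \<open>The ends are not adjacent, while \<open>t\<close> is adjacent to both
      \<open>p\<close> and \<open>r\<close>. So \<open>{p, r}\<close> is the only possible pair of
      ends.\<close>
    have "{p', r'} = {p, r}"
    proof -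
      have "p' \<in> {p, r, t}" "r' \<in> {p, r, t}" using C C' True by auto
      moreover have "p \<in> nbrs G t" "r \<in> nbrs G t" using C sym by blast+
      ultimately show ?thesis using C C' sym[of p' r'] by auto
    qed
    then show ?thesis using True unfolding joinable_def redB_def by (simp add: iso_graphs_refl)
  next
    case q: False
    show ?thesis
    proof (cases "q' \<in> {p, r, t} \<or> {p', r'} = {p, r}")
      case True
      have cases: "{p', r'} = {p, r} \<and> (t' = t \<or> q' = t \<and> t' = q) \<or> q' \<in> {p, r} \<and> t' = t \<and> q \<in> {p', r'}"
      proof -
        consider "q' = t" | "q' \<in> {p, r}" | "q' \<notin> {p, r, t}" "{p', r'} = {p, r}" using True by blast
        then show ?thesis
        proof cases
          case 1
          have "{q, p, r} \<subseteq> nbrs G t" using C sym[of _ t] by auto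
          then have "{q, p, r} \<subseteq> {p', r', t'}" using C' 1 by auto
          moreover have "p \<in> nbrs G q" "r \<in> nbrs G q" using C by auto
          moreover note sym[of q p] sym[of q r] sym[of p' r']
          ultimately have "{p', r'} = {p, r} \<and> t' = q" using C C' by (simp add: doubleton_eq_iff) metis
          then show ?thesis using 1 by simp
        next
          case 2
          have *: "t' = t \<and> q \<in> {p', r'}" if c: "confB G q p r t" and q': "q' = p" for p r
          proof -
            note C = c[unfolded confB_def]
            have "{q, t} \<subseteq> nbrs G p" using C sym[of _ p] by auto
            then have sub: "{q, t} \<subseteq> {p', r', t'}" using C' q' by auto
            have rt: "r \<in> nbrs G t" "t \<in> nbrs G r" using C sym by blast+
            have "t' \<noteq> q"
            proof
              assume "t' = q"
              then have "p' \<in> nbrs G q" "r' \<in> nbrs G q" using C' sym by blast+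
              then have "p' \<in> {p, r, t}" "r' \<in> {p, r, t}" using C by simp_all
              moreover have "p \<noteq> p'" "p \<noteq> r'" "p' \<noteq> r'" "r' \<notin> nbrs G p'" using C' q' by simp_all
              ultimately show False using rt by auto
            qed
            then have q: "q \<in> {p', r'}" using sub by simp
            then have "t' \<in> nbrs G q" using C' by blast
            then have "t' \<in> {p, r, t}" using C by simp
            moreover have "t' \<in> nbrs G p" using C' q' by simp
            ultimately have "t' = t" using C nbrs_irrefl[OF G, of p] by blast
            then show ?thesis using q by simp
          qed
          then show ?thesis using *[OF c] *[OF confB_swap[OF c]] 2 by blast
        next
          case 3
          obtain x where "nbrs G p = {q, t, x}" using confB_nbrs[OF G c] by metis
          moreover have "q' \<in> nbrs G p" "t' \<in> nbrs G p" using 3 C' sym[of q'] by (auto simp: doubleton_eq_iff)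
          moreover have "q \<noteq> t'" using C C' 3 sym[of q q'] by auto
          ultimately have "t' = t" using 3 q C' by auto
          then show ?thesis using 3 by simp
        qed
      qed
      have "iso_graphs (redB G q p r) (redB G q' p' r')"
      \<comment> \<open>The first reduction keeps \<open>q'\<close> and the second keeps
        \<open>q\<close>; the surviving middle is renamed.\<close>
      proof (rule iso_renameI[of q' _ _ q])
        show "simple_graph (redB G q p r)" "simple_graph (redB G q' p' r')" by (fact S)+
        show "q' \<in> verts (redB G q p r)" "verts (redB G q' p' r') = insert q (verts (redB G q p r) - {q'})"
          "q \<notin> verts (redB G q p r) - {q'}"
          using q V by auto
        fix v x assume vx: "v \<in> verts (redB G q p r)" "x \<in> verts (redB G q p r)" "v \<noteq> q'" "x \<noteq> q'"
        show "x \<in> nbrs (redB G q' p' r') v \<longleftrightarrow> x \<in> nbrs (redB G q p r) v"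
        proof -
          have "v = p' \<and> x = r' \<or> v = r' \<and> x = p' \<longleftrightarrow> v = p \<and> x = r \<or> v = r \<and> x = p"
          proof -
            have "v \<noteq> q" "x \<noteq> q" using vx by auto
            then show ?thesis using cases vx(3,4) by (simp add: doubleton_eq_iff) blast
          qed
          then show ?thesis using vx unfolding in_nbrs_redB[OF c] in_nbrs_redB[OF c'] by simp
        qed
      next
        fix x assume x: "x \<in> verts (redB G q p r)" "x \<noteq> q'"
        show "x \<in> nbrs (redB G q' p' r') q \<longleftrightarrow> x \<in> nbrs (redB G q p r) q'"
          using cases
        proof
          assume "{p', r'} = {p, r} \<and> (t' = t \<or> q' = t \<and> t' = q)"
          moreover have "nbrs G q = {p, r, t}" "nbrs G q' = insert t' {p', r'}" using C C' by auto
          moreover have "q \<notin> {p, r}" "q' \<notin> {p', r'}" using C C' by simp_all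
          ultimately show ?thesis using x q unfolding in_nbrs_redB[OF c] in_nbrs_redB[OF c']
            by simp blast
        next
          assume "q' \<in> {p, r} \<and> t' = t \<and> q \<in> {p', r'}"
          then have h: "q' \<in> {p, r}" "t' = t" "q \<in> {p', r'}" by simp_all
          have "x \<noteq> q" using x by simp
          then have "q = p' \<and> x = r' \<or> q = r' \<and> x = p' \<longleftrightarrow> x \<in> {p', r'}"
            "q' = p \<and> x = r \<or> q' = r \<and> x = p \<longleftrightarrow> x \<in> {p, r}"
            using h(1,3) x(2) C C' by blast+
          moreover have "nbrs G q = {p, r, t}" "nbrs G q' = {p', r', t'}" using C C' by simp_all
          ultimately show ?thesis using x h(2) q \<open>x \<noteq> q\<close>
            unfolding in_nbrs_redB[OF c] in_nbrs_redB[OF c'] by simp blast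
        qed
      qed
      then show ?thesis by (simp add: joinable_def)
    next
      case False
      have q1: "q' \<notin> {q, p, r, t}" using q False by auto
      have q2: "q \<notin> {q', p', r', t'}"
        using q1 C C' sym[of q' q] by auto
      \<comment> \<open>If the hub were an end of the other path, it would be cubic with neighbours
        \<open>q\<close>, \<open>p\<close>, \<open>r\<close>, and \<open>q'\<close> would have to be
        one of them.\<close>
      have apex: "p' \<noteq> t" 
        if c: "confB G q p r t" and c': "confB G q' p' r' t'" and q1: "q' \<notin> {q, p, r, t}" for q p r t q' p' r' t'
      proof
        assume t: "p' = t"
        have "card {q, p, r} = 3" "{q, p, r} \<subseteq> nbrs G t" using c sym[of _ t] by (auto simp: confB_def)
        moreover have "card (nbrs G t) = 3" using c' t by (simp add: confB_def)
        ultimately have "nbrs G t = {q, p, r}" using card_subset_eq[OF finite_nbrs[OF G]] by metis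
        moreover have "q' \<in> nbrs G t" using c' t sym by (auto simp: confB_def)
        ultimately show False using q1 by simp
      qed
      \<comment> \<open>The ends keep their degrees because they are not the hub \<open>t\<close>.
        That the pairs of ends differ prevents the new edge from joining \<open>p'\<close> and
        \<open>r'\<close>.\<close>
      have *: "confB (redB G q p r) q' p' r' t'" 
        if c: "confB G q p r t" and c': "confB G q' p' r' t'" and q1: "q' \<notin> {q, p, r, t}" and q2: "q \<notin> {q', p', r', t'}"
          and ne: "{p', r'} \<noteq> {p, r}" for q p r t q' p' r' t'
      proof -
        note C = c[unfolded confB_def] and C' = c'[unfolded confB_def]
        have pt: "p' \<noteq> t" "r' \<noteq> t" using apex[OF c c' q1] apex[OF c confB_swap[OF c'] q1] .
        have e: "q \<in> nbrs G p" "q \<in> nbrs G r" "r \<notin> nbrs G p" "p \<notin> nbrs G r" using C sym by blast+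
        have "card (nbrs (redB G q p r) v) = card (nbrs G v)" if "v \<in> {p', r'}" for v
          using that pt q2 card_swap[OF finite_nbrs[OF G] e(1,3)] card_swap[OF finite_nbrs[OF G] e(2,4)] 
          by (auto simp: nbrs_redB[OF c])
        moreover have "nbrs (redB G q p r) q' = nbrs G q'" using q1 by (auto simp: nbrs_redB[OF c])
        moreover have "t' \<in> nbrs (redB G q p r) p'" "t' \<in> nbrs (redB G q p r) r'" "r' \<notin> nbrs (redB G q p r) p'"
          using q2 ne C' unfolding in_nbrs_redB[OF c] by auto
        ultimately show ?thesis using C' by (simp add: confB_def)
      qed
      have "confB (redB G q p r) q' p' r' t'" "confB (redB G q' p' r') q p r t"
        using *[OF c c' q1 q2] *[OF c' c q2 q1] False by auto
      moreover have "redB (redB G q p r) q' p' r' = redB (redB G q' p' r') q p r"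
        using q1 q2 by (auto simp: redB_def)
      ultimately show ?thesis unfolding joinable_def can_step_def by metis
    qed
  qed
qed

text \<open>By the symmetries of the second pattern, the two vertices where the joining edges arrive
  can take the places of \<open>u'\<close> and \<open>w'\<close>. Their outside neighbours are then
  forced to be \<open>u\<close> and \<open>w\<close>.\<close>

lemma redA_two_edges:
  assumes G: "simple_graph G" and c: "confA G y u w s a b" and c': "confA G y' u' w' s' a' b'"
    and d: "{y, u, w} \<inter> {y', u', w'} = {}" and ab: "a \<in> {y', u', w'}" "b \<in> {y', u', w'}"
  shows "iso_graphs (redA G y u w s a b) (redA G y' u' w' s' a' b')"
proof -
  have "a \<noteq> b" using c by (simp add: confA_def)
  then have "\<exists>y2 s2 a2 b2. confA G y2 a b s2 a2 b2 \<and> y2 \<in> {y', u', w'}"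
    using ab c' confA_swap[OF c'] confA_rot[OF c'] confA_swap[OF confA_rot[OF c']]
      confA_rot2[OF c'] confA_swap[OF confA_rot2[OF c']] by blast
  then obtain y2 s2 a2 b2 where c2: "confA G y2 a b s2 a2 b2" "y2 \<in> {y', u', w'}" by blast
  have d2: "{y, u, w} \<inter> {y2, a, b} = {}" using d c2(2) ab by blast
  have "u \<in> nbrs G a" "w \<in> nbrs G b" using c nbrs_sym[of u G a] nbrs_sym[of w G b] by (simp_all add: confA_def)
  then have "a2 = u" "b2 = w" using c2(1) d2 by (auto simp: confA_def)
  then have "confA G y2 a b s2 u w" using c2 by simp
  then have "iso_graphs (redA G y u w s a b) (redA G y2 a b s2 u w)"
    using redA_double_edge[OF G c _ d2] by blast
  moreover have "iso_graphs (redA G y' u' w' s' a' b') (redA G y2 a b s2 u w)"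
    using redA_overlap[OF G c'] c2 \<open>a2 = u\<close> \<open>b2 = w\<close> by blast
  ultimately show ?thesis
    using iso_graphs_trans iso_graphs_sym simple_redA[OF G c] simple_redA[OF G c'] by blast
qed

lemma redA_joinable:
  assumes G: "simple_graph G" and c: "confA G y u w s a b" and c': "confA G y' u' w' s' a' b'"
  shows "joinable (redA G y u w s a b) (redA G y' u' w' s' a' b')"
proof (cases "{y, u, w} \<inter> {y', u', w'} = {}")
  case False
  then show ?thesis using redA_overlap[OF G c c'] confA_inter[OF c c'] by (simp add: joinable_def)
next
  case d: True
  show ?thesis
  proof (cases "card ({s, a, b} \<inter> {y', u', w'}) \<le> 1")
    case True
    then show ?thesis using redA_commute[OF G c c' d] by simp
  next
    case False
    let ?T' = "{y', u', w'}"
    \<comment> \<open>At least two of the three outside edges end in the other triangle; a rotation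
      makes them those of \<open>u\<close> and \<open>w\<close>.\<close>
    have "\<not> (\<exists>z. {s, a, b} \<inter> ?T' \<subseteq> {z})"
    proof
      assume "\<exists>z. {s, a, b} \<inter> ?T' \<subseteq> {z}"
      then obtain z where "{s, a, b} \<inter> ?T' \<subseteq> {z}" by blast
      then have "card ({s, a, b} \<inter> ?T') \<le> card {z}" by (intro card_mono) auto
      then show False using False by simp
    qed
    then consider "a \<in> ?T'" "b \<in> ?T'" | "s \<in> ?T'" "b \<in> ?T'" | "s \<in> ?T'" "a \<in> ?T'" by blast
    then have "iso_graphs (redA G y u w s a b) (redA G y' u' w' s' a' b')"
    proof cases
      case 1
      then show ?thesis using redA_two_edges[OF G c c' d] by blast
    next
      case 2
      have "{u, y, w} \<inter> ?T' = {}" using d by blast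
      then have "iso_graphs (redA G u y w a s b) (redA G y' u' w' s' a' b')"
        using redA_two_edges[OF G confA_rot[OF c] c'] 2 by blast
      then show ?thesis using confA_rename[OF G c] iso_graphs_trans simple_redA[OF G c] by blast
    next
      case 3
      have "{w, y, u} \<inter> ?T' = {}" using d by blast
      then have "iso_graphs (redA G w y u b s a) (redA G y' u' w' s' a' b')"
        using redA_two_edges[OF G confA_rot2[OF c] c'] 3 by blast
      moreover have "iso_graphs (redA G y u w s a b) (redA G w y u b s a)"
        using redA_overlap[OF G c confA_rot2[OF c]] by blast
      ultimately show ?thesis using iso_graphs_trans simple_redA[OF G c] by blast
    qed
    then show ?thesis by (simp add: joinable_def)
  qed
qed

section \<open>Reducibility is preserved by every step\<close>

lemma joinable_sym: "simple_graph H \<Longrightarrow> joinable H K \<Longrightarrow> joinable K H"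
  unfolding joinable_def using iso_graphs_sym by blast

lemma joinable_can_step:
  assumes G: "simple_graph G" and H: "can_step G H" and K: "can_step G K"
  shows "joinable H K"
  using H[unfolded can_step_def] K[unfolded can_step_def]
proof (elim disjE exE conjE)
  fix y u w s a b q p r t
  assume *: "confA G y u w s a b" "H = redA G y u w s a b" "confB G q p r t" "K = redB G q p r"
  then show ?thesis using redA_redB_commute[OF G] by blast
next
  fix y u w s a b q p r t
  assume *: "confA G y u w s a b" "K = redA G y u w s a b" "confB G q p r t" "H = redB G q p r"
  then show ?thesis using redA_redB_commute[OF G] joinable_sym simple_can_step[OF G K] by blast
qed (use redA_joinable[OF G] redB_joinable[OF G] in blast)+

text \<open>A triangle pattern needs six vertices, and a path pattern two vertices that are not
  adjacent.\<close>

lemma irreducible_K4: "\<not> can_step K4 H"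
proof -
  have n: "v \<in> nbrs K4 u" if "u \<in> verts K4" "v \<in> verts K4" "u \<noteq> v" for u v
    using that by (auto simp: nbrs_def K4_def)
  have "\<not> confA K4 y u w s a b" for y u w s a b
  proof
    assume c: "confA K4 y u w s a b"
    have "card {y, u, w, s, a, b} \<le> card (verts K4)"
      using confA_verts[OF simple_K4 c] by (intro card_mono) (auto simp: K4_def)
    then show False using c by (simp add: confA_def K4_def)
  qed
  moreover have "\<not> confB K4 y u w s" for y u w s
    using confB_verts[OF simple_K4, of y u w s] n[of u w] by (auto simp: confB_def)
  ultimately show ?thesis unfolding can_step_def by blast
qed

lemma can_reducible_cases:
  assumes "simple_graph G" "can_reducible G"
  shows "iso_graphs G K4 \<or> (\<exists>H. can_step G H \<and> can_reducible H)"
proof -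
  obtain K f where K: "can_step\<^sup>*\<^sup>* G K" "iso_by f K K4" using assms(2) by (auto simp: can_reducible_def)
  from K(1) show ?thesis
    by (cases rule: converse_rtranclpE) (use K(2) in \<open>auto simp: can_reducible_def iso_graphs_def\<close>)
qed

text \<open>Let \<open>K\<close> start a successful sequence. Then \<open>K\<close> is smaller and
  reducible, so by induction the graph \<open>J\<close> where \<open>K\<close> and \<open>H\<close>
  meet is reducible, and \<open>H\<close> reaches it. As \<open>G\<close> admits a step, it is not
  \<open>K4\<close>, so such a \<open>K\<close> exists.\<close>

theorem can_reducible_step:
  assumes "simple_graph G" "can_reducible G" "can_step G H"
  shows "can_reducible H"
  using assms
proof (induction "card (verts G)" arbitrary: G H rule: less_induct)
  case less
  note G = less.prems(1)
  have "\<not> iso_graphs G K4"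
    using iso_by_can_step[OF G _ less.prems(3)] irreducible_K4 unfolding iso_graphs_def by blast
  then obtain K where K: "can_step G K" "can_reducible K" using can_reducible_cases[OF G less.prems(2)] by blast
  note sK = simple_can_step[OF G K(1)] and sH = simple_can_step[OF G less.prems(3)]
  show ?case
    using joinable_can_step[OF G K(1) less.prems(3)] unfolding joinable_def
  proof
    assume "iso_graphs K H"
    then show ?thesis using can_reducible_iso[OF sK _ sH K(2)] unfolding iso_graphs_def by blast
  next
    assume "\<exists>J. can_step K J \<and> can_step H J"
    then obtain J where J: "can_step K J" "can_step H J" by blast
    then have "can_reducible J" using less.hyps[OF card_can_step[OF G K(1)] sK K(2)] by blast
    then show ?thesis using J(2) unfolding can_reducible_def by (meson converse_rtranclp_into_rtranclp)
  qed
qed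

section \<open>Lifting Hamiltonian cycles\<close>

definition cyclic_list :: "('a \<Rightarrow> 'a) \<Rightarrow> 'a list \<Rightarrow> bool" where
  "cyclic_list nx c \<longleftrightarrow> distinct c \<and> (\<forall>i<length c. nx (c ! i) = c ! (Suc i mod length c))"

definition cyclic_on :: "('a \<Rightarrow> 'a) \<Rightarrow> 'a set \<Rightarrow> bool" where
  "cyclic_on nx V \<longleftrightarrow> (\<exists>c. cyclic_list nx c \<and> set c = V)"

text \<open>Nothing is required of \<open>nx\<close> outside \<open>verts G\<close>, so a single
  array can hold the cycle of every intermediate graph.\<close>

definition ham :: "'a graph \<Rightarrow> ('a \<Rightarrow> 'a) \<Rightarrow> bool" where
  "ham G nx \<longleftrightarrow> cyclic_on nx (verts G) \<and> card (verts G) \<ge> 3 \<and> (\<forall>v\<in>verts G. nx v \<in> nbrs G v)"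

lemma cyclic_list_rotate:
  assumes "cyclic_list nx c"
  shows "cyclic_list nx (rotate k c)"
  unfolding cyclic_list_def
proof (intro conjI allI impI)
  show "distinct (rotate k c)" using assms by (simp add: cyclic_list_def)
  fix i assume i: "i < length (rotate k c)"
  let ?n = "length c"
  have n: "?n > 0" using i by auto
  have "nx (rotate k c ! i) = c ! (Suc ((k + i) mod ?n) mod ?n)"
    using i n assms by (simp add: nth_rotate cyclic_list_def)
  also have "\<dots> = rotate k c ! (Suc i mod ?n)"
    using n by (simp add: nth_rotate mod_Suc_eq mod_add_right_eq)
  finally show "nx (rotate k c ! i) = rotate k c ! (Suc i mod length (rotate k c))" by simp
qed

lemma cyclic_list_start:
  assumes "cyclic_list nx c" "x \<in> set c"
  obtains d where "cyclic_list nx (x # d)" "set (x # d) = set c"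
proof -
  obtain xs ys where c: "c = xs @ x # ys" using assms(2) by (meson split_list)
  have "rotate (length xs) c = x # ys @ xs" unfolding c by (simp add: rotate_append)
  then show thesis using that[of "ys @ xs"] cyclic_list_rotate[OF assms(1), of "length xs"] c by auto
qed

lemma cyclic_list_Cons:
  "cyclic_list nx (x # d) \<longleftrightarrow> distinct (x # d) \<and> 
     (\<forall>i<length d. nx ((x # d) ! i) = d ! i) \<and> nx (last (x # d)) = x"
proof -
  have "(\<forall>i<Suc (length d). P i) \<longleftrightarrow> (\<forall>i<length d. P i) \<and> P (length d)" for P
    using less_Suc_eq by auto
  then show ?thesis unfolding cyclic_list_def by (auto simp: last_conv_nth)
qed

text \<open>After a rotation that puts \<open>b\<close> first, \<open>x\<close> becomes the second
  entry.\<close>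

lemma cyclic_on_insert:
  assumes "cyclic_on nx V" "b \<in> V" "x \<notin> V"
  shows "cyclic_on (nx(x := nx b, b := x)) (insert x V)"
proof -
  obtain c where c: "cyclic_list nx c" "set c = V" using assms(1) by (auto simp: cyclic_on_def)
  obtain d where d: "cyclic_list nx (b # d)" "set (b # d) = V"
    using cyclic_list_start[OF c(1), of b] assms(2) c(2) by metis
  let ?nx = "nx(x := nx b, b := x)"
  \<comment> \<open>A cycle with one element is allowed; then \<open>b\<close> is its own
    successor.\<close>
  have nb: "nx b = (if d = [] then b else hd d)"
    using d(1) unfolding cyclic_list_Cons by (auto simp: hd_conv_nth)
  have "distinct (b # x # d)" using d assms(3) unfolding cyclic_list_Cons by auto
  moreover have "?nx ((b # x # d) ! i) = (x # d) ! i" if i: "i < Suc (length d)" for i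
  proof -
    consider "i = 0" | "i = 1" "d \<noteq> []" | j where "i = Suc (Suc j)" "Suc j < length d"
      using i by (metis One_nat_def Suc_less_eq length_greater_0_conv not0_implies_Suc)
    then show ?thesis
    proof cases
      case 2
      then show ?thesis using nb \<open>distinct (b # x # d)\<close> by (auto simp: hd_conv_nth)
    next
      case 3
      have "d ! j \<notin> {b, x}" using \<open>distinct (b # x # d)\<close> 3 by (metis Suc_lessD distinct.simps(2) insertE list.set_intros(2) nth_mem singletonD)
      moreover have "nx (d ! j) = d ! Suc j" using d(1) 3 unfolding cyclic_list_Cons by (metis nth_Cons_Suc)
      ultimately show ?thesis using 3 by simp
    qed simp
  qed
  moreover have "?nx (last (b # x # d)) = b"
  proof (cases "d = []")
    case True
    then show ?thesis using nb \<open>distinct (b # x # d)\<close> by simp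
  next
    case False
    then have "last d \<notin> {b, x}" "nx (last d) = b" using \<open>distinct (b # x # d)\<close> d(1)
      unfolding cyclic_list_Cons using last_in_set[of d] by auto
    then show ?thesis using False by simp
  qed
  ultimately have "cyclic_list ?nx (b # x # d)" unfolding cyclic_list_Cons[of ?nx b] by simp
  then show ?thesis unfolding cyclic_on_def using d(2) by (intro exI[of _ "b # x # d"]) auto
qed

lemma cyclic_on_bij:
  assumes "cyclic_on nx V"
  shows "bij_betw nx V V"
proof -
  obtain c where c: "cyclic_list nx c" "set c = V" using assms by (auto simp: cyclic_on_def)
  have im: "nx ` V = V"
  proof (intro set_eqI iffI)
    fix x assume "x \<in> nx ` V"
    then obtain i where "i < length c" "x = nx (c ! i)" unfolding c(2)[symmetric] by (auto simp: in_set_conv_nth)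
    then have "x = c ! (Suc i mod length c)" "Suc i mod length c < length c"
      using c(1) by (auto simp: cyclic_list_def intro!: mod_less_divisor)
    then show "x \<in> V" using c(2) by auto
  next
    fix x assume x: "x \<in> V"
    then obtain d where d: "cyclic_list nx (x # d)" "set (x # d) = set c" using cyclic_list_start[OF c(1)] c(2) by metis
    then show "x \<in> nx ` V" unfolding cyclic_list_Cons c(2)[symmetric] d(2)[symmetric]
      by (metis imageI last_in_set list.distinct(1))
  qed
  moreover have "finite V" using c(2) by auto
  ultimately show ?thesis by (simp add: bij_betw_def eq_card_imp_inj_on)
qed

text \<open>Guarantees that a cycle enters and leaves a vertex by different edges.\<close>

lemma cyclic_on_no_2cycle:
  assumes "cyclic_on nx V" "card V \<ge> 3" "x \<in> V"
  shows "nx (nx x) \<noteq> x" "nx x \<noteq> x"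
proof -
  obtain c where c: "cyclic_list nx c" "set c = V" using assms by (auto simp: cyclic_on_def)
  obtain d where d: "cyclic_list nx (x # d)" "set (x # d) = V" using cyclic_list_start[OF c(1), of x] c(2) assms(3) by metis
  have "length (x # d) \<ge> 3" using assms(2) d by (metis distinct_card cyclic_list_def)
  then obtain y z e where e: "d = y # z # e" by (cases d; cases "tl d") auto
  have "nx x = y" "nx y = z" "distinct [x, y, z]" using d(1) unfolding cyclic_list_Cons e by force+
  then show "nx (nx x) \<noteq> x" "nx x \<noteq> x" by auto
qed

lemma ham_cycle:
  assumes "ham G nx" "cyclic_list nx c" "set c = verts G"
  shows "hamiltonian_cycle G c"
proof -
  have "length c \<ge> 3" using assms by (metis ham_def cyclic_list_def distinct_card)
  moreover have "{c ! i, c ! (Suc i mod length c)} \<in> edges G" if "i < length c" for i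
  proof -
    have "c ! i \<in> verts G" using nth_mem[OF that] assms(3) by simp
    then have "nx (c ! i) \<in> nbrs G (c ! i)" using assms(1) by (simp add: ham_def)
    then show ?thesis using that assms(2) by (simp add: cyclic_list_def in_nbrs)
  qed
  ultimately show ?thesis using assms(2,3) by (auto simp: hamiltonian_cycle_def cyclic_list_def)
qed

text \<open>Without the edge between \<open>u\<close> and \<open>w\<close>, the cycle must pass
  \<open>u\<close> by its two other edges, one of which leads to \<open>s\<close>. The last branch
  therefore means that \<open>s\<close> precedes \<open>u\<close>.\<close>

definition undoB :: "'a \<Rightarrow> 'a \<Rightarrow> 'a \<Rightarrow> 'a \<Rightarrow> ('a \<Rightarrow> 'a) \<Rightarrow> 'a \<Rightarrow> 'a" where
  "undoB y u w s nx = (if nx u = w then nx(y := w, u := y) else if nx w = u then nx(y := u, w := y)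
     else if nx u = s then nx(y := s, u := y) else nx(y := u, s := y))"

definition undoA :: "'a \<Rightarrow> 'a \<Rightarrow> 'a \<Rightarrow> 'a \<Rightarrow> 'a \<Rightarrow> 'a \<Rightarrow> ('a \<Rightarrow> 'a) \<Rightarrow> 'a \<Rightarrow> 'a" where
  "undoA y u w s a b nx =
    (if nx s = y then if nx y = a then nx(u := a, w := u, y := w) else nx(w := b, u := w, y := u)
     else if nx a = y then if nx y = s then nx(a := u, u := w, w := y) else nx(a := u, u := y, w := b, y := w)
     else if nx y = s then nx(b := w, w := u, u := y) else nx(b := w, w := y, u := a, y := u))"

lemma ham_undoB:
  assumes G: "simple_graph G" and c: "confB G y u w s" and h: "ham (redB G y u w) nx"
  shows "ham G (undoB y u w s nx)"
proof -
  let ?H = "redB G y u w"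
  note V = confB_verts[OF G c] and C = c[unfolded confB_def]
  have cy: "cyclic_on nx (verts G - {y})" and 3: "card (verts G - {y}) \<ge> 3"
    and nb: "\<And>v. v \<in> verts G - {y} \<Longrightarrow> nx v \<in> nbrs ?H v"
    using h by (auto simp: ham_def)
  have ins: "insert y (verts G - {y}) = verts G" using V by auto
  have card: "card (verts G) \<ge> 3" using 3 card_mono[of "verts G" "verts G - {y}"] G by (simp add: simple_graph_def)
  have bij: "bij_betw nx (verts G - {y}) (verts G - {y})" using cyclic_on_bij[OF cy] .
  have yn: "y \<in> nbrs G u" "y \<in> nbrs G w" "y \<in> nbrs G s" using C nbrs_sym[of y G] by auto
  have old: "nx v \<in> nbrs G v" if "v \<in> verts G" "v \<noteq> y" "\<not> (v = u \<and> nx v = w)" "\<not> (v = w \<and> nx v = u)" for v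
    using nb[of v] that in_nbrs_redB[OF c, of "nx v" v] by auto
  \<comment> \<open>\<open>y\<close> is adjacent to all of \<open>u\<close>, \<open>w\<close>,
    \<open>s\<close>, so it fits into any step between two of them. The second condition says that
    no other step uses the added edge.\<close>
  have put: "ham G (nx(y := nx b, b := y))"
    if b: "b \<in> {u, w, s}" "nx b \<in> {u, w, s}" and others: "\<And>v. v \<noteq> b \<Longrightarrow> \<not> (v = u \<and> nx v = w) \<and> \<not> (v = w \<and> nx v = u)" for b
  proof -
    have "cyclic_on (nx(y := nx b, b := y)) (verts G)"
      using cyclic_on_insert[OF cy, of b y] b V C ins by auto
    moreover have "(nx(y := nx b, b := y)) v \<in> nbrs G v" if "v \<in> verts G" for v
      using that b C yn old[of v] others[of v] by auto
    ultimately show ?thesis using card by (simp add: ham_def)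
  qed
  have two: "\<not> (nx u = w \<and> nx w = u)"
    using cyclic_on_no_2cycle(1)[OF cy 3, of u] V C by auto
  show ?thesis
  proof (cases "nx u = w")
    case True
    then show ?thesis using put[of u] two by (auto simp: undoB_def)
  next
    case uw: False
    show ?thesis
    proof (cases "nx w = u")
      case True
      then show ?thesis using put[of w] two uw by (auto simp: undoB_def)
    next
      case wu: False
      show ?thesis
      proof (cases "nx u = s")
        case True
        then show ?thesis using put[of u] uw wu by (auto simp: undoB_def)
      next
        case us: False
        have u: "u \<in> verts G - {y}" using V C by auto
        \<comment> \<open>\<open>v\<close> is the predecessor of \<open>u\<close>. It is neither
          \<open>w\<close>, by assumption, nor \<open>a\<close>, which is already the successor;
          only \<open>s\<close> is left.\<close>
        obtain v where v: "v \<in> verts G - {y}" "nx v = u" using bij u by (metis bij_betw_imp_surj_on imageE)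
        have "nx v \<in> nbrs ?H v" using nb v by blast
        then have "v \<in> nbrs ?H u" using v nbrs_sym by metis
        obtain a where a: "nbrs G u = {y, s, a}" "a \<notin> {y, u, w, s}" using confB_nbrs[OF G c] by metis
        then have H: "nbrs ?H u = {w, s, a}" using C by (auto simp: nbrs_redB[OF c])
        have "nx u = a" using nb[OF u] H uw us by auto
        moreover have "nx u \<noteq> v" using cyclic_on_no_2cycle(1)[OF cy 3 u] cyclic_on_no_2cycle(1)[OF cy 3 v(1)] v(2) by auto
        ultimately have "v = s" using \<open>v \<in> nbrs ?H u\<close> H v wu by auto
        then have "nx s = u" using v by simp
        then show ?thesis using put[of s] uw wu us by (auto simp: undoB_def)
      qed
    qed
  qed
qed

lemma ham_undoA:
  assumes G: "simple_graph G" and c: "confA G y u w s a b" and h: "ham (redA G y u w s a b) nx"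
  shows "ham G (undoA y u w s a b nx)"
proof -
  let ?H = "redA G y u w s a b"
  note V = confA_verts[OF G c] and C = c[unfolded confA_def]
  have cy: "cyclic_on nx (verts G - {u, w})" and 3: "card (verts G - {u, w}) \<ge> 3"
    and nb: "\<And>v. v \<in> verts G - {u, w} \<Longrightarrow> nx v \<in> nbrs ?H v"
    using h by (auto simp: ham_def)
  have card: "card (verts G) \<ge> 3" using 3 card_mono[of "verts G" "verts G - {u, w}"] G by (simp add: simple_graph_def)
  have bij: "bij_betw nx (verts G - {u, w}) (verts G - {u, w})" using cyclic_on_bij[OF cy] .
  have y: "y \<in> verts G - {u, w}" using V C by auto
  obtain x where x: "x \<in> verts G - {u, w}" "nx x = y" using bij y by (metis bij_betw_imp_surj_on imageE)
  have "nx x \<in> nbrs ?H x" using nb x by blast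
  then have "x \<in> nbrs ?H y" using x nbrs_sym by metis
  then have xs: "x \<in> {s, a, b}" by (simp add: nbrs_redA[OF c])
  have ys: "nx y \<in> {s, a, b}" using nb[OF y] by (simp add: nbrs_redA[OF c])
  have xy: "x \<noteq> nx y" using cyclic_on_no_2cycle(1)[OF cy 3 y] x by auto
  have uniq: "nx v = y \<longleftrightarrow> v = x" if "v \<in> {s, a, b}" for v
  proof -
    have "v \<in> verts G - {u, w}" using that V C by auto
    then show ?thesis using x bij by (metis bij_betw_inv_into_left)
  qed
  have old: "nx v \<in> nbrs G v" if "v \<in> verts G" "v \<notin> {u, w, y, x}" for v
  proof -
    have "nx v \<noteq> y" using x bij that by (metis Diff_iff bij_betw_inv_into_left insertCI insertE)
    then show ?thesis using nb[of v] that in_nbrs_redA[OF c, of "nx v" v] by auto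
  qed
  have n: "y \<in> nbrs G u" "y \<in> nbrs G w" "y \<in> nbrs G s" "u \<in> nbrs G y" "w \<in> nbrs G y" "s \<in> nbrs G y"
    "u \<in> nbrs G w" "w \<in> nbrs G u" "u \<in> nbrs G a" "a \<in> nbrs G u" "w \<in> nbrs G b" "b \<in> nbrs G w"
    using C nbrs_sym[of _ G s] nbrs_sym[of _ G a] nbrs_sym[of _ G b] by auto
  \<comment> \<open>Two successive insertions, where the second may be made after the vertex just
    inserted.\<close>
  have put: "cyclic_on (nx(v := nx d, d := v, v' := (nx(v := nx d, d := v)) d', d' := v')) (verts G)"
    if "d \<in> verts G - {u, w}" "v \<in> {u, w}" "v' \<in> {u, w}" "v \<noteq> v'" "d' \<in> insert v (verts G - {u, w})" for v d v' d'
  proof -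
    have "insert v' (insert v (verts G - {u, w})) = verts G" using that(2-4) V by auto
    moreover have "cyclic_on (nx(v := nx d, d := v)) (insert v (verts G - {u, w}))"
      using cyclic_on_insert[OF cy that(1)] that(2) by auto
    moreover have "v' \<notin> insert v (verts G - {u, w})" using that by auto
    ultimately show ?thesis using cyclic_on_insert[of "nx(v := nx d, d := v)" _ d' v'] that(5) by metis
  qed
  have fin: "ham G nx'" if "cyclic_on nx' (verts G)" "\<And>v. v \<in> verts G \<Longrightarrow> v \<notin> {u, w, y, x} \<Longrightarrow> nx' v = nx v"
    "\<And>v. v \<in> {u, w, y, x} \<Longrightarrow> nx' v \<in> nbrs G v" for nx'
    using that old card unfolding ham_def by metis
  note neq = confA_neq[OF c]
  have inV: "s \<in> verts G - {u, w}" "a \<in> verts G - {u, w}" "b \<in> verts G - {u, w}"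
    using V neq by auto
  have un: "nx s = y \<longleftrightarrow> x = s" "nx a = y \<longleftrightarrow> x = a" "nx b = y \<longleftrightarrow> x = b" using uniq by auto
  consider "x = s" "nx y = a" | "x = s" "nx y = b" | "x = a" "nx y = s" | "x = a" "nx y = b" | "x = b" "nx y = s" | "x = b" "nx y = a"
    using xs ys xy by auto
  then show ?thesis
  proof cases
    case 1
    \<comment> \<open>First \<open>u\<close> and then \<open>w\<close> is inserted right after
      \<open>y\<close>, giving the order \<open>y\<close>, \<open>w\<close>, \<open>u\<close>. The
      other cases are decomposed in the same way.\<close>
    then have "undoA y u w s a b nx = nx(u := nx y, y := u, w := (nx(u := nx y, y := u)) y, y := w)"
      using neq un by (auto simp: undoA_def fun_eq_iff)
    then have "cyclic_on (undoA y u w s a b nx) (verts G)" using put[of y u w y] y neq by simp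
    then show ?thesis by (rule fin) (use 1 neq un n x in \<open>auto simp: undoA_def\<close>)
  next
    case 2
    then have "undoA y u w s a b nx = nx(w := nx y, y := w, u := (nx(w := nx y, y := w)) y, y := u)"
      using neq un by (auto simp: undoA_def fun_eq_iff)
    then have "cyclic_on (undoA y u w s a b nx) (verts G)" using put[of y w u y] y neq by simp
    then show ?thesis by (rule fin) (use 2 neq un n x in \<open>auto simp: undoA_def\<close>)
  next
    case 3
    then have "undoA y u w s a b nx = nx(u := nx a, a := u, w := (nx(u := nx a, a := u)) u, u := w)"
      using neq un by (auto simp: undoA_def fun_eq_iff)
    then have "cyclic_on (undoA y u w s a b nx) (verts G)" using put[of a u w u] inV neq by simp
    then show ?thesis by (rule fin) (use 3 neq un n x in \<open>auto simp: undoA_def\<close>)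
  next
    case 4
    then have "undoA y u w s a b nx = nx(u := nx a, a := u, w := (nx(u := nx a, a := u)) y, y := w)"
      using neq un by (auto simp: undoA_def fun_eq_iff)
    then have "cyclic_on (undoA y u w s a b nx) (verts G)" using put[of a u w y] inV y neq by simp
    then show ?thesis by (rule fin) (use 4 neq un n x in \<open>auto simp: undoA_def\<close>)
  next
    case 5
    then have "undoA y u w s a b nx = nx(w := nx b, b := w, u := (nx(w := nx b, b := w)) w, w := u)"
      using neq un by (auto simp: undoA_def fun_eq_iff)
    then have "cyclic_on (undoA y u w s a b nx) (verts G)" using put[of b w u w] inV neq by simp
    then show ?thesis by (rule fin) (use 5 neq un n x in \<open>auto simp: undoA_def\<close>)
  next
    case 6
    then have "undoA y u w s a b nx = nx(w := nx b, b := w, u := (nx(w := nx b, b := w)) y, y := u)"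
      using neq un by (auto simp: undoA_def fun_eq_iff)
    then have "cyclic_on (undoA y u w s a b nx) (verts G)" using put[of b w u y] inV y neq by simp
    then show ?thesis by (rule fin) (use 6 neq un n x in \<open>auto simp: undoA_def\<close>)
  qed
qed

lemma ham_complete4:
  assumes "verts G = {a, b, c, d}" "distinct [a, b, c, d]" "b \<in> nbrs G a" "c \<in> nbrs G b" "d \<in> nbrs G c" "a \<in> nbrs G d"
    "nx a = b" "nx b = c" "nx c = d" "nx d = a"
  shows "ham G nx"
proof -
  have "cyclic_list nx [a, b, c, d]" using assms(2,7-) unfolding cyclic_list_Cons by (auto simp: nth_Cons split: nat.splits)
  then have "cyclic_on nx (verts G)" unfolding cyclic_on_def assms(1) by (intro exI[of _ "[a, b, c, d]"]) simp
  moreover have "card (verts G) = 4" using assms(1,2) by simp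
  ultimately show ?thesis using assms by (auto simp: ham_def)
qed

lemma iso_K4:
  assumes "simple_graph G" "iso_graphs G K4"
  shows "card (verts G) = 4" "v \<in> verts G \<Longrightarrow> nbrs G v = verts G - {v}"
proof -
  obtain f where f: "iso_by f G K4" using assms(2) by (auto simp: iso_graphs_def)
  have bij: "bij_betw f (verts G) (verts K4)" using f by (simp add: iso_by_def)
  then show "card (verts G) = 4" by (simp add: bij_betw_same_card K4_def)
  assume v: "v \<in> verts G"
  have fv: "f v \<in> verts K4" using bij v by (auto simp: bij_betw_def)
  have nK: "nbrs K4 x = verts K4 - {x}" if "x \<in> verts K4" for x
    using that by (auto simp: nbrs_def K4_def card_insert_if split: if_splits)
  have "f ` nbrs G v = verts K4 - {f v}"
    using f v nK[OF fv] by (simp add: iso_by_def)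
  also have "\<dots> = f ` (verts G - {v})"
    using bij v inj_on_image_set_diff[of f "verts G" "verts G" "{v}"] by (auto simp: bij_betw_def)
  finally show "nbrs G v = verts G - {v}"
    using bij nbrs_subset[OF assms(1), of v] by (metis Diff_subset bij_betw_def inj_on_image_eq_iff)
qed

theorem can_reducible_ham:
  assumes "simple_graph G" "can_reducible G"
  shows "\<exists>nx. ham G nx"
proof -
  obtain K f where K: "can_step\<^sup>*\<^sup>* G K" "iso_by f K K4" using assms(2) by (auto simp: can_reducible_def)
  from K(1) assms(1) show ?thesis
  proof (induction rule: converse_rtranclp_induct)
    case base
    have iso: "iso_graphs K K4" using K(2) by (auto simp: iso_graphs_def)
    note K4 = iso_K4[OF base iso]
    obtain a b c d where v: "verts K = {a, b, c, d}" "distinct [a, b, c, d]"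
      using K4(1) by (auto simp: card_Suc_eq numeral_eq_Suc)
    show ?case
      by (rule exI, rule ham_complete4[OF v, of "(id(a := b, b := c, c := d, d := a))"]) (use v K4(2) in auto)
  next
    case (step G H)
    then obtain nx where nx: "ham H nx" using simple_can_step by blast
    show ?case using step.hyps(1)[unfolded can_step_def] ham_undoA[OF step.prems] ham_undoB[OF step.prems] nx by blast
  qed
qed

lemma D3_reducible_hamiltonian:
  assumes "simple_graph G" "D3_reducible G"
  shows "\<exists>c. hamiltonian_cycle G c"
proof -
  obtain nx where nx: "ham G nx" using can_reducible_ham D3_reducible_can_reducible assms by blast
  then obtain c where "cyclic_list nx c" "set c = verts G" by (auto simp: ham_def cyclic_on_def)
  then show ?thesis using ham_cycle[OF nx] by blast
qed

section \<open>Dart arrays under reductions\<close>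

text \<open>A dart of \<open>v\<close> is a position in the list of \<open>v\<close>. The list may
  shrink but stays inside the block up to \<open>off (Suc v)\<close>. As all \<open>v < n\<close>
  are covered, deleted vertices have empty lists. By injectivity \<open>tw d\<close> is the only
  dart that leads back.\<close>

definition adjrep :: "nat \<Rightarrow> (nat \<Rightarrow> nat) \<Rightarrow> (nat \<Rightarrow> nat) \<Rightarrow> (nat \<Rightarrow> nat) \<Rightarrow> (nat \<Rightarrow> nat) \<Rightarrow> nat graph \<Rightarrow> bool" where
  "adjrep n off en he tw G \<longleftrightarrow> simple_graph G \<and> verts G \<subseteq> {..<n} \<and>
     (\<forall>v<n. off v \<le> en v \<and> en v \<le> off (Suc v)) \<and>
     (\<forall>v<n. inj_on he {off v..<en v} \<and> he ` {off v..<en v} = nbrs G v) \<and>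
     (\<forall>v<n. \<forall>d\<in>{off v..<en v}. tw d \<in> {off (he d)..<en (he d)} \<and> he (tw d) = v)"

section \<open>Changing and deleting list entries\<close>

lemma inj_on_agree: "(\<And>i. i \<in> I \<Longrightarrow> f i = g i) \<Longrightarrow> inj_on g I \<Longrightarrow> inj_on f I"
  by (metis inj_on_cong)

lemma inj_image_update:
  assumes "inj_on h I" "i \<in> I" "x \<notin> h ` I"
  shows "inj_on (h(i := x)) I" "(h(i := x)) ` I = insert x (h ` I - {h i})"
proof -
  show "inj_on (h(i := x)) I" using assms by (auto simp: inj_on_def)
  show "(h(i := x)) ` I = insert x (h ` I - {h i})"
    using assms by (auto simp: inj_on_def)
qed

text \<open>Deletion without shifting: the last entry fills the gap. For \<open>z = b - 1\<close>
  the list is merely shortened.\<close>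

lemma inj_image_swap_delete:
  fixes a b z :: nat
  assumes "inj_on h {a..<b}" "z \<in> {a..<b}"
  shows "inj_on (h(z := h (b - 1))) {a..<b - 1}" "(h(z := h (b - 1))) ` {a..<b - 1} = h ` {a..<b} - {h z}"
proof -
  have sub: "{a..<b} = insert (b - 1) {a..<b - 1}" using assms(2) by auto
  have inj: "h x = h y \<longleftrightarrow> x = y" if "x \<in> {a..<b}" "y \<in> {a..<b}" for x y
    using assms(1) that by (simp add: inj_on_eq_iff)
  show "inj_on (h(z := h (b - 1))) {a..<b - 1}"
    using assms(2) by (auto simp: inj_on_def inj)
  show "(h(z := h (b - 1))) ` {a..<b - 1} = h ` {a..<b} - {h z}" (is "?L = ?R")
  proof (intro subset_antisym subsetI)
    fix x assume "x \<in> ?L"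
    then obtain i where "i \<in> {a..<b - 1}" "x = (h(z := h (b - 1))) i" by blast
    then show "x \<in> ?R" using assms(2) inj[of "b - 1" z] inj[of i z] by (auto split: if_splits)
  next
    fix x assume "x \<in> ?R"
    then obtain i where i: "i \<in> {a..<b}" "x = h i" "i \<noteq> z" by blast
    show "x \<in> ?L"
    proof (cases "i = b - 1")
      case True
      then show ?thesis using i assms(2) by (intro image_eqI[of _ _ z]) auto
    next
      case False
      then show ?thesis using i by (intro image_eqI[of _ _ i]) auto
    qed
  qed
qed

context
  fixes n off en he tw G
  assumes rep: "adjrep n off en he tw G"
begin

lemma adjrep_simple: "simple_graph G" and adjrep_verts: "v \<in> verts G \<Longrightarrow> v < n"
  and adjrep_bounds: "v < n \<Longrightarrow> off v \<le> en v" "v < n \<Longrightarrow> en v \<le> off (Suc v)"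
  and adjrep_inj: "v < n \<Longrightarrow> inj_on he {off v..<en v}"
  and adjrep_image: "v < n \<Longrightarrow> he ` {off v..<en v} = nbrs G v"
  and adjrep_twin: "v < n \<Longrightarrow> d \<in> {off v..<en v} \<Longrightarrow> tw d \<in> {off (he d)..<en (he d)}"
    "v < n \<Longrightarrow> d \<in> {off v..<en v} \<Longrightarrow> he (tw d) = v"
  using rep unfolding adjrep_def by auto

lemma adjrep_nbr_less: "u \<in> nbrs G v \<Longrightarrow> u < n" "u \<in> nbrs G v \<Longrightarrow> v < n"
  using adjrep_verts nbrs_verts[OF adjrep_simple] by blast+

lemma adjrep_head: "v < n \<Longrightarrow> d \<in> {off v..<en v} \<Longrightarrow> he d \<in> nbrs G v"
  using adjrep_image by blast

lemma adjrep_less: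
  assumes "v < v'" "v' < n"
  shows "en v \<le> off v'"
proof -
  have "off (Suc v) \<le> off v'"
    using assms
  proof (induction v')
    case (Suc v')
    then show ?case
      using adjrep_bounds[of v'] by (cases "v = v'") auto
  qed simp
  then show ?thesis using adjrep_bounds[of v] assms by auto
qed

text \<open>Blocks of different vertices are disjoint, so writing to a dart of one vertex leaves
  every other list as it is.\<close>

lemma adjrep_owner:
  assumes "v < n" "v' < n" "d \<in> {off v..<en v}" "d \<in> {off v'..<en v'}"
  shows "v = v'"
  using adjrep_less[of v v'] adjrep_less[of v' v] assms by (cases v v' rule: linorder_cases) auto

lemma adjrep_card: "v < n \<Longrightarrow> card (nbrs G v) = en v - off v"
  using card_image[OF adjrep_inj] adjrep_image by (metis card_atLeastLessThan)

lemma adjrep_deg3: "v < n \<Longrightarrow> en v = off v + 3 \<longleftrightarrow> card (nbrs G v) = 3"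
  using adjrep_card adjrep_bounds(1) by force

lemma adjrep_nbrs3:
  assumes "v < n" "en v = off v + 3"
  shows "nbrs G v = {he (off v), he (Suc (off v)), he (Suc (Suc (off v)))}"
    "distinct [he (off v), he (Suc (off v)), he (Suc (Suc (off v)))]"
proof -
  have I: "{off v..<en v} = {off v, Suc (off v), Suc (Suc (off v))}" using assms(2) by auto
  show "nbrs G v = {he (off v), he (Suc (off v)), he (Suc (Suc (off v)))}"
    using adjrep_image[OF assms(1)] unfolding I by auto
  show "distinct [he (off v), he (Suc (off v)), he (Suc (Suc (off v)))]"
    using adjrep_inj[OF assms(1)] unfolding I by (auto simp: inj_on_def)
qed

text \<open>Darts are redirected, not created: the dart from \<open>y\<close> to \<open>u\<close>
  becomes the one to \<open>a\<close>, the dart from \<open>a\<close> to \<open>u\<close> becomes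
  the one to \<open>y\<close>, and they are made twins; likewise for \<open>w\<close> and
  \<open>b\<close>. The dart from \<open>y\<close> to \<open>s\<close> stays.\<close>

lemma adjrep_redA:
  assumes c: "confA G y u w s a b"
    and z: "zu \<in> {off y..<en y}" "he zu = u" "zw \<in> {off y..<en y}" "he zw = w"
    and d: "du \<in> {off u..<en u}" "he du = a" "dw \<in> {off w..<en w}" "he dw = b"
  shows "adjrep n off (en(u := off u, w := off w)) (he(zu := a, zw := b, tw du := y, tw dw := y))
    (tw(zu := tw du, zw := tw dw, tw du := zu, tw dw := zw)) (redA G y u w s a b)"
    (is "adjrep n off ?en ?he ?tw ?H")
proof -
  note C = c[unfolded confA_def]
  note neq = confA_neq[OF c]
  have less: "y < n" "u < n" "w < n" "s < n" "a < n" "b < n"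
    using confA_verts[OF adjrep_simple c] adjrep_verts by auto
  let ?tu = "tw du" and ?tv = "tw dw"
  have tu: "?tu \<in> {off a..<en a}" "he ?tu = u" and tv: "?tv \<in> {off b..<en b}" "he ?tv = w"
    using adjrep_twin[OF less(2) d(1)] adjrep_twin[OF less(3) d(3)] d by auto
  have zz: "zu \<noteq> zw" using z neq by auto
  have own: "v = y" if "v < n" "zu \<in> {off v..<en v}" for v using adjrep_owner[OF that(1) less(1) that(2) z(1)] .
  have own': "v = y" if "v < n" "zw \<in> {off v..<en v}" for v using adjrep_owner[OF that(1) less(1) that(2) z(3)] .
  have own2: "v = a" if "v < n" "?tu \<in> {off v..<en v}" for v using adjrep_owner[OF that(1) less(5) that(2) tu(1)] .
  have own3: "v = b" if "v < n" "?tv \<in> {off v..<en v}" for v using adjrep_owner[OF that(1) less(6) that(2) tv(1)] .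
  have dist: "?tu \<noteq> zu" "?tu \<noteq> zw" "?tv \<noteq> zu" "?tv \<noteq> zw" "?tu \<noteq> ?tv"
    proof -
    show "?tu \<noteq> zu" using own[OF less(5)] tu(1) neq(8) by blast
    show "?tu \<noteq> zw" using own'[OF less(5)] tu(1) neq(8) by blast
    show "?tv \<noteq> zu" using own[OF less(6)] tv(1) neq(10) by blast
    show "?tv \<noteq> zw" using own'[OF less(6)] tv(1) neq(10) by blast
    show "?tu \<noteq> ?tv" using tu(2) tv(2) neq(11) by metis
  qed
  note R = nbrs_redA[OF c]
  have "inj_on ?he {off v..<?en v} \<and> ?he ` {off v..<?en v} = nbrs ?H v" if v: "v < n" for v
  proof -
    consider "v = y" | "v \<in> {u, w}" | "v = a" | "v = b" | "v \<notin> {y, u, w, a, b}" by blast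
    then show ?thesis
    proof cases
      case 1
      let ?I = "{off y..<en y}" and ?h = "he(zu := a, zw := b)"
      have N: "he ` ?I = {u, w, s}" using adjrep_image[OF less(1)] C by simp
      have 1: "inj_on (he(zu := a)) ?I" "(he(zu := a)) ` ?I = {a, w, s}"
        using inj_image_update[OF adjrep_inj[OF less(1)] z(1), of a] N z(2) neq by auto
      have 2: "inj_on ?h ?I" "?h ` ?I = {s, a, b}"
        using inj_image_update[OF 1(1) z(3), of b] 1(2) z zz neq by auto
      have eq: "?he i = ?h i" if "i \<in> ?I" for i 
      proof -
        have "i \<noteq> ?tu" "i \<noteq> ?tv" using that own2[OF less(1)] own3[OF less(1)] neq(7,9) by blast+
        then show ?thesis by simp
      qed
      have "inj_on ?he ?I" by (rule inj_on_agree[OF eq 2(1)])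
      moreover have "?he ` ?I = ?h ` ?I" using eq by (intro image_cong) auto
      ultimately show ?thesis using 2(2) \<open>v = y\<close> neq by (simp add: R)
    next
      case 2
      then show ?thesis using neq by (auto simp: R)
    next
      case 3
      let ?I = "{off a..<en a}"
      have "y \<notin> nbrs G a" using confA_not_nbr(1)[OF c, of a] neq by auto
      then have 1: "inj_on (he(?tu := y)) ?I" "(he(?tu := y)) ` ?I = insert y (nbrs G a - {u})"
        using inj_image_update[OF adjrep_inj[OF less(5)] tu(1), of y] adjrep_image[OF less(5)] tu(2) by auto
      have eq: "?he i = (he(?tu := y)) i" if "i \<in> ?I" for i
      proof -
        have "i \<noteq> zu" "i \<noteq> zw" "i \<noteq> ?tv"
          using that own[OF less(5)] own'[OF less(5)] own3[OF less(5)] neq(8,29) by blast+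
        then show ?thesis by simp
      qed
      have "inj_on ?he ?I" by (rule inj_on_agree[OF eq 1(1)])
      moreover have "?he ` ?I = (he(?tu := y)) ` ?I" using eq by (intro image_cong) auto
      ultimately show ?thesis using 1(2) 3 neq by (simp add: R)
    next
      case 4
      let ?I = "{off b..<en b}"
      have "y \<notin> nbrs G b" using confA_not_nbr(1)[OF c, of b] neq by auto
      then have 1: "inj_on (he(?tv := y)) ?I" "(he(?tv := y)) ` ?I = insert y (nbrs G b - {w})"
        using inj_image_update[OF adjrep_inj[OF less(6)] tv(1), of y] adjrep_image[OF less(6)] tv(2) by auto
      have eq: "?he i = (he(?tv := y)) i" if "i \<in> ?I" for i
      proof -
        have "i \<noteq> zu" "i \<noteq> zw" "i \<noteq> ?tu"
          using that own[OF less(6)] own'[OF less(6)] own2[OF less(6)] neq(10,30) by blast+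
        then show ?thesis by simp
      qed
      have "inj_on ?he ?I" by (rule inj_on_agree[OF eq 1(1)])
      moreover have "?he ` ?I = (he(?tv := y)) ` ?I" using eq by (intro image_cong) auto
      ultimately show ?thesis using 1(2) 4 neq by (simp add: R)
    next
      case 5
      let ?I = "{off v..<en v}"
      have eq: "?he i = he i" if "i \<in> ?I" for i
      proof -
        have "i \<noteq> zu" "i \<noteq> zw" "i \<noteq> ?tu" "i \<noteq> ?tv"
          using that own[OF v] own'[OF v] own2[OF v] own3[OF v] 5 by blast+
        then show ?thesis by simp
      qed
      have "inj_on ?he ?I" by (rule inj_on_agree[OF eq adjrep_inj[OF v]])
      moreover have "?he ` ?I = he ` ?I" using eq by (intro image_cong) auto
      ultimately show ?thesis using adjrep_image[OF v] 5 by (simp add: R)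
    qed
  qed
  moreover have "?tw e \<in> {off (?he e)..<?en (?he e)} \<and> ?he (?tw e) = v"
    if v: "v < n" and e: "e \<in> {off v..<?en v}" for v e
  proof -
    have vn: "v \<noteq> u" "v \<noteq> w" using e by (auto split: if_splits)
    then have e': "e \<in> {off v..<en v}" using e by auto
    have same: "e = e'" if "he e = he e'" "e' \<in> {off v..<en v}" for e'
      using adjrep_inj[OF v] e' that by (auto dest: inj_onD)
    consider "e = zu" | "e = zw" | "e = ?tu" | "e = ?tv" | "e \<notin> {zu, zw, ?tu, ?tv}" by blast
    then show ?thesis
    proof cases
      case 1
      have "v = y" using 1 own[OF v] e' by blast
      moreover have "?tw zu = ?tu" "?he zu = a" "?he ?tu = y" "?en a = en a" using dist zz neq by auto
      ultimately show ?thesis using 1 tu(1) by simp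
    next
      case 2
      have "v = y" using 2 own'[OF v] e' by blast
      moreover have "?tw zw = ?tv" "?he zw = b" "?he ?tv = y" "?en b = en b" using dist zz neq by auto
      ultimately show ?thesis using 2 tv(1) by simp
    next
      case 3
      have "v = a" using 3 own2[OF v] e' by blast
      moreover have "?tw ?tu = zu" "?he ?tu = y" "?he zu = a" "?en y = en y" using dist zz neq by auto
      ultimately show ?thesis using 3 z(1) by simp
    next
      case 4
      have "v = b" using 4 own3[OF v] e' by blast
      moreover have "?tw ?tv = zw" "?he ?tv = y" "?he zw = b" "?en y = en y" using dist zz neq by auto
      ultimately show ?thesis using 4 z(3) by simp
    next
      case 5
      then have E: "?he e = he e" "?tw e = tw e" by auto
      have T: "tw e \<in> {off (he e)..<en (he e)}" "he (tw e) = v" using adjrep_twin[OF v e'] by auto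
      have adj: "v \<in> nbrs G (he e)" using adjrep_head[OF v e'] nbrs_sym by metis
      \<comment> \<open>A dart into \<open>u\<close> starts at \<open>y\<close>, \<open>w\<close> or
        \<open>a\<close>. The list of \<open>w\<close> has been emptied, and the darts of
        \<open>y\<close> and \<open>a\<close> into \<open>u\<close> are \<open>zu\<close> and
        \<open>tw du\<close>.\<close>
      have "he e \<noteq> u"
      proof
        assume h: "he e = u"
        then have "v \<in> {y, a}" using adj C vn by auto
        then show False using same[of zu] same[of ?tu] h z tu 5 by auto
      qed
      moreover have "he e \<noteq> w"
      proof
        assume h: "he e = w"
        then have "v \<in> {y, b}" using adj C vn by auto
        then show False using same[of zw] same[of ?tv] h z tv 5 by auto
      qed
      moreover have "tw e \<notin> {zu, zw, ?tu, ?tv}" using T(2) vn z tu tv by auto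
      ultimately show ?thesis using E T by auto
    qed
  qed
  moreover have "off v \<le> ?en v \<and> ?en v \<le> off (Suc v)" if "v < n" for v
    using adjrep_bounds[OF that] by auto
  moreover have "verts ?H \<subseteq> {..<n}" using adjrep_verts by auto
  ultimately show ?thesis
    unfolding adjrep_def using simple_redA[OF adjrep_simple c] by blast
qed

text \<open>The darts from the ends to \<open>y\<close> are redirected to each other. The list of
  \<open>s\<close> loses its dart \<open>z\<close> to \<open>y\<close> by moving its last dart
  \<open>m\<close> there, so the twin of \<open>m\<close> has to point to \<open>z\<close>.\<close>

lemma adjrep_redB:
  assumes c: "confB G y u w s"
    and z: "gu \<in> {off u..<en u}" "he gu = y" "gw \<in> {off w..<en w}" "he gw = y" "z \<in> {off s..<en s}" "he z = y"
    and m: "m = en s - 1"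
  shows "adjrep n off (en(s := m, y := off y)) (he(z := he m, gu := w, gw := u))
    (tw(z := tw m, tw m := z, gu := gw, gw := gu)) (redB G y u w)"
    (is "adjrep n off ?en ?he ?tw ?H")
proof -
  note C = c[unfolded confB_def]
  have neq: "y \<noteq> u" "u \<noteq> y" "y \<noteq> w" "w \<noteq> y" "y \<noteq> s" "s \<noteq> y" "u \<noteq> w" "w \<noteq> u" "u \<noteq> s" "s \<noteq> u" "w \<noteq> s" "s \<noteq> w"
  proof -
    have "distinct [y, u, w, s]" using C by simp
    then show "y \<noteq> u" "u \<noteq> y" "y \<noteq> w" "w \<noteq> y" "y \<noteq> s" "s \<noteq> y" "u \<noteq> w" "w \<noteq> u" "u \<noteq> s" "s \<noteq> u" "w \<noteq> s" "s \<noteq> w"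
      by auto
  qed
  have less: "y < n" "u < n" "w < n" "s < n"
    using confB_verts[OF adjrep_simple c] adjrep_verts by auto
  have own: "v = u" if "v < n" "gu \<in> {off v..<en v}" for v using adjrep_owner[OF that(1) less(2) that(2) z(1)] .
  have own': "v = w" if "v < n" "gw \<in> {off v..<en v}" for v using adjrep_owner[OF that(1) less(3) that(2) z(3)] .
  have own2: "v = s" if "v < n" "z \<in> {off v..<en v}" for v using adjrep_owner[OF that(1) less(4) that(2) z(5)] .
  have mI: "m \<in> {off s..<en s}" using m z(5) by auto
  have tm: "tw m \<in> {off (he m)..<en (he m)}" "he (tw m) = s" using adjrep_twin[OF less(4) mI] by auto
  have dist: "gu \<noteq> gw" "gu \<noteq> z" "gw \<noteq> z" "tw m \<notin> {gu, gw, z}"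
    
  proof -
    show "gu \<noteq> gw" using own[OF less(3)] z(3) neq(8) by blast
    show "gu \<noteq> z" using own[OF less(4)] z(5) neq(10) by blast
    show "gw \<noteq> z" using own'[OF less(4)] z(5) neq(12) by blast
    show "tw m \<notin> {gu, gw, z}" using tm(2) z(2,4,6) neq(6) by auto
  qed
  note R = nbrs_redB[OF c]
  have wu: "w \<notin> nbrs G u" "u \<notin> nbrs G w" using C nbrs_sym[of w G u] by auto
  have "inj_on ?he {off v..<?en v} \<and> ?he ` {off v..<?en v} = nbrs ?H v" if v: "v < n" for v
  proof -
    consider "v = y" | "v = u" | "v = w" | "v = s" | "v \<notin> {y, u, w, s}" by blast
    then show ?thesis
    proof cases
      case 1
      then show ?thesis by (simp add: R)
    next
      case 2
      let ?I = "{off u..<en u}"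
      have 1: "inj_on (he(gu := w)) ?I" "(he(gu := w)) ` ?I = insert w (nbrs G u - {y})"
        using inj_image_update[OF adjrep_inj[OF less(2)] z(1), of w] adjrep_image[OF less(2)] z(2) wu by auto
      have eq: "?he i = (he(gu := w)) i" if "i \<in> ?I" for i
      proof -
        have "i \<noteq> gw" "i \<noteq> z" using that own'[OF less(2)] own2[OF less(2)] neq(7,9) by blast+
        then show ?thesis by simp
      qed
      have "inj_on ?he ?I" by (rule inj_on_agree[OF eq 1(1)])
      moreover have "?he ` ?I = (he(gu := w)) ` ?I" using eq by (intro image_cong) auto
      ultimately show ?thesis using 1(2) 2 neq by (simp add: R)
    next
      case 3
      let ?I = "{off w..<en w}"
      have 1: "inj_on (he(gw := u)) ?I" "(he(gw := u)) ` ?I = insert u (nbrs G w - {y})"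
        using inj_image_update[OF adjrep_inj[OF less(3)] z(3), of u] adjrep_image[OF less(3)] z(4) wu by auto
      have eq: "?he i = (he(gw := u)) i" if "i \<in> ?I" for i
      proof -
        have "i \<noteq> gu" "i \<noteq> z" using that own[OF less(3)] own2[OF less(3)] neq(8,11) by blast+
        then show ?thesis by simp
      qed
      have "inj_on ?he ?I" by (rule inj_on_agree[OF eq 1(1)])
      moreover have "?he ` ?I = (he(gw := u)) ` ?I" using eq by (intro image_cong) auto
      ultimately show ?thesis using 1(2) 3 neq by (simp add: R)
    next
      case 4
      let ?I = "{off s..<m}"
      have 1: "inj_on (he(z := he m)) ?I" "(he(z := he m)) ` ?I = nbrs G s - {y}"
        using inj_image_swap_delete[OF adjrep_inj[OF less(4)] z(5)] adjrep_image[OF less(4)] z(6) m by auto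
      have eq: "?he i = (he(z := he m)) i" if "i \<in> ?I" for i
      proof -
        have "i \<in> {off s..<en s}" using that m by auto
        then have "i \<noteq> gu" "i \<noteq> gw" using own[OF less(4)] own'[OF less(4)] neq(10,12) by blast+
        then show ?thesis by simp
      qed
      have "inj_on ?he ?I" by (rule inj_on_agree[OF eq 1(1)])
      moreover have "?he ` ?I = (he(z := he m)) ` ?I" using eq by (intro image_cong) auto
      ultimately show ?thesis using 1(2) 4 neq by (simp add: R)
    next
      case 5
      let ?I = "{off v..<en v}"
      have eq: "?he i = he i" if "i \<in> ?I" for i
      proof -
        have "i \<noteq> gu" "i \<noteq> gw" "i \<noteq> z" using that own[OF v] own'[OF v] own2[OF v] 5 by blast+
        then show ?thesis by simp
      qed
      have "inj_on ?he ?I" by (rule inj_on_agree[OF eq adjrep_inj[OF v]])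
      moreover have "?he ` ?I = he ` ?I" using eq by (intro image_cong) auto
      ultimately show ?thesis using adjrep_image[OF v] 5 by (simp add: R)
    qed
  qed
  moreover have "?tw e \<in> {off (?he e)..<?en (?he e)} \<and> ?he (?tw e) = v"
    if v: "v < n" and e: "e \<in> {off v..<?en v}" for v e
  proof -
    have vn: "v \<noteq> y" using e by (auto split: if_splits)
    have es: "v = s \<Longrightarrow> e < m" using e vn by auto
    have e': "e \<in> {off v..<en v}" using e vn mI by (auto split: if_splits)
    have same: "e = e'" if "he e = he e'" "e' \<in> {off v..<en v}" for e'
      using adjrep_inj[OF v] e' that by (auto dest: inj_onD)
    \<comment> \<open>\<open>z\<close> is the only dart from \<open>s\<close> to \<open>y\<close>,
      so a dart that is really moved leads to a vertex whose list is kept.\<close>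
    have zm: "he m \<noteq> y" if "z \<noteq> m"
      using adjrep_inj[OF less(4)] z(5,6) mI that by (auto dest: inj_onD)
    have hm: "he m \<noteq> s" using adjrep_head[OF less(4) mI] nbrs_irrefl[OF adjrep_simple] by metis
    consider "e = gu" | "e = gw" | "e = z" | "e = tw m" "e \<noteq> z" | "e \<notin> {gu, gw, z, tw m}" by blast
    then show ?thesis
    proof cases
      case 1
      have "v = u" using 1 own[OF v] e' by blast
      moreover have "?tw gu = gw" "?he gu = w" "?he gw = u" "?en w = en w" using dist neq by auto
      ultimately show ?thesis using 1 z(3) by simp
    next
      case 2
      have "v = w" using 2 own'[OF v] e' by blast
      moreover have "?tw gw = gu" "?he gw = u" "?he gu = w" "?en u = en u" using dist neq by auto
      ultimately show ?thesis using 2 z(1) by simp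
    next
      case 3
      have "v = s" "z \<noteq> m" using 3 own2[OF v] e' es by auto
      have "?tw z = tw m" "?he z = he m" "?he (tw m) = s" using dist tm(2) by auto
      moreover have "?en (he m) = en (he m)" using zm[OF \<open>z \<noteq> m\<close>] hm by simp
      ultimately show ?thesis using 3 tm(1) \<open>v = s\<close> by simp
    next
      case 4
      have hmn: "he m < n" using adjrep_head[OF less(4) mI] adjrep_nbr_less by blast
      have vm: "v = he m" using adjrep_owner[OF v hmn e'] tm 4 by simp
      then have "z \<noteq> m" using vn z by auto
      then have "z < m" using z(5) m by auto
      moreover have "?tw (tw m) = z" "?he (tw m) = s" "?he z = he m" using dist tm(2) by auto
      moreover have "?en s = m" using neq by simp
      ultimately show ?thesis using 4 vm z(5) by simp
    next
      case 5
      then have E: "?he e = he e" "?tw e = tw e" by auto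
      have T: "tw e \<in> {off (he e)..<en (he e)}" "he (tw e) = v" using adjrep_twin[OF v e'] by auto
      have adj: "v \<in> nbrs G (he e)" using adjrep_head[OF v e'] nbrs_sym by metis
      have hy: "he e \<noteq> y"
      proof
        assume h: "he e = y"
        then have "v \<in> {u, w, s}" using adj C by auto
        then show False using same[of gu] same[of gw] same[of z] h z 5 by auto
      qed
      \<comment> \<open>Position \<open>m\<close> has been cut off. The only dart whose twin is
        \<open>m\<close> is \<open>tw m\<close>, which is excluded in this case.\<close>
      have "tw e \<noteq> m" if "he e = s"
      proof
        assume t: "tw e = m"
        then have "tw m \<in> {off v..<en v}" using tm T by simp
        then show False using same[of "tw m"] tm that 5 by auto
      qed
      moreover have "tw e \<notin> {gu, gw, z}" using T(2) vn z by auto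
      ultimately show ?thesis using E T hy m by auto
    qed
  qed
  moreover have "off v \<le> ?en v \<and> ?en v \<le> off (Suc v)" if "v < n" for v
    using adjrep_bounds[OF that] adjrep_bounds[OF less(4)] mI by auto
  moreover have "verts ?H \<subseteq> {..<n}" using adjrep_verts by auto
  ultimately show ?thesis
    unfolding adjrep_def using simple_redB[OF adjrep_simple c] by blast
qed

end

section \<open>Running programs\<close>

fun loopfree :: "prog \<Rightarrow> bool" where
  "loopfree (Seq c d) \<longleftrightarrow> loopfree c \<and> loopfree d"
| "loopfree (If b c d) \<longleftrightarrow> loopfree c \<and> loopfree d"
| "loopfree (While b c) \<longleftrightarrow> False"
| "loopfree _ \<longleftrightarrow> True"

text \<open>A function in place of the relation \<open>exec\<close>, so that the simplifier can
  execute loop-free code symbolically. The clause for \<open>While\<close> is a dummy value, as in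
  \<open>max_cost\<close>.\<close>

fun run :: "prog \<Rightarrow> store \<Rightarrow> store" where
  "run Skip s = s"
| "run (Assign x e) s = s\<lparr>regs := (regs s)(x := exp_val e s)\<rparr>"
| "run (Update a i e) s = s\<lparr>arrs := (arrs s)(a := (arrs s a)(exp_val i s := exp_val e s))\<rparr>"
| "run (Seq c d) s = run d (run c s)"
| "run (If b c d) s = (if bexp_val b s then run c s else run d s)"
| "run (While b c) s = s"

fun max_cost :: "prog \<Rightarrow> nat" where
  "max_cost Skip = 1"
| "max_cost (Assign x e) = exp_cost e + 1"
| "max_cost (Update a i e) = exp_cost i + exp_cost e + 1"
| "max_cost (Seq c d) = max_cost c + max_cost d"
| "max_cost (If b c d) = bexp_cost b + max (max_cost c) (max_cost d) + 1"
| "max_cost (While b c) = 0"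

lemma exec_run: "loopfree c \<Longrightarrow> \<exists>t\<le>max_cost c. exec c s t (run c s)"
proof (induction c arbitrary: s)
  case (Seq c d)
  then obtain t u where "t \<le> max_cost c" "exec c s t (run c s)"
    "u \<le> max_cost d" "exec d (run c s) u (run d (run c s))" by fastforce
  then show ?case by (auto intro!: exI[of _ "t + u"] exec.Seq)
next
  case (If b c d)
  show ?case
  proof (cases "bexp_val b s")
    case True
    then obtain t where "t \<le> max_cost c" "exec c s t (run c s)" using If by fastforce
    then show ?thesis using True exec.IfTrue[of b s c t _ d] by (intro exI[of _ "bexp_cost b + t + 1"]) auto
  next
    case False
    then obtain t where "t \<le> max_cost d" "exec d s t (run d s)" using If by fastforce
    then show ?thesis using False exec.IfFalse[of b s d t _ c] by (intro exI[of _ "bexp_cost b + t + 1"]) auto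
  qed
next
  case (Assign x e)
  show ?case by (simp only: run.simps max_cost.simps) (use exec.Assign in blast)
next
  case (Update a i e)
  show ?case by (simp only: run.simps max_cost.simps) (use exec.Update in blast)
next
  case Skip
  show ?case by (simp only: run.simps max_cost.simps) (use exec.Skip in blast)
qed auto

definition terminates :: "prog \<Rightarrow> store \<Rightarrow> nat \<Rightarrow> (store \<Rightarrow> bool) \<Rightarrow> bool" where
  "terminates c s T Q \<longleftrightarrow> (\<exists>t s'. exec c s t s' \<and> t \<le> T \<and> Q s')"

lemma terminates_run: "loopfree c \<Longrightarrow> Q (run c s) \<Longrightarrow> terminates c s (max_cost c) Q"
  using exec_run unfolding terminates_def by blast

lemma terminates_Seq:
  assumes "terminates c s T P" "\<And>s'. P s' \<Longrightarrow> terminates d s' U Q"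
  shows "terminates (Seq c d) s (T + U) Q"
  using assms unfolding terminates_def by (meson add_mono exec.Seq)

lemma terminates_mono: "terminates c s T Q \<Longrightarrow> T \<le> U \<Longrightarrow> (\<And>s'. Q s' \<Longrightarrow> R s') \<Longrightarrow> terminates c s U R"
  unfolding terminates_def by (meson le_trans)

text \<open>A loop-free body makes each round cost a constant. The measure bounds the rounds, and
  the extra one pays for the final test.\<close>

lemma terminates_While:
  assumes "loopfree c" "I m s"
    and "\<And>m s. I m s \<Longrightarrow> bexp_val b s \<Longrightarrow> \<exists>m'<m. I m' (run c s)"
  shows "terminates (While b c) s ((m + 1) * (max_cost c + bexp_cost b + 1)) (\<lambda>s. (\<exists>m. I m s) \<and> \<not> bexp_val b s)"
  using assms(2)
proof (induction m arbitrary: s rule: less_induct)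
  case (less m)
  let ?K = "max_cost c + bexp_cost b + 1"
  show ?case
  proof (cases "bexp_val b s")
    case False
    then have "exec (While b c) s (bexp_cost b + 1) s" by (rule exec.WhileFalse)
    moreover have "bexp_cost b + 1 \<le> (m + 1) * ?K" by (simp add: add_mono)
    ultimately show ?thesis using False less.prems unfolding terminates_def by blast
  next
    case True
    then obtain m' where m': "m' < m" "I m' (run c s)" using assms(3) less.prems by blast
    obtain t where t: "t \<le> max_cost c" "exec c s t (run c s)" using exec_run assms(1) by blast
    obtain u s' where u: "exec (While b c) (run c s) u s'" "u \<le> (m' + 1) * ?K" "\<exists>m. I m s'" "\<not> bexp_val b s'"
      using less.IH[OF m'] unfolding terminates_def by blast
    have "exec (While b c) s (bexp_cost b + t + u + 1) s'" using exec.WhileTrue[OF True t(2) u(1)] .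
    moreover have "(m' + 1) * ?K + ?K \<le> (m + 1) * ?K"
      using mult_le_mono1[of "m' + 2" "m + 1" ?K] m'(1) by simp
    then have "bexp_cost b + t + u + 1 \<le> (m + 1) * ?K" using t u by linarith
    ultimately show ?thesis using u unfolding terminates_def by blast
  qed
qed

section \<open>Scanning all darts to sort them and to find their twins\<close>

text \<open>The neighbours of \<open>w\<close> whose darts towards \<open>w\<close> come before position \<open>d\<close> in the list of \<open>u\<close>.\<close>

definition seen :: "(nat \<Rightarrow> nat) \<Rightarrow> (nat \<Rightarrow> nat) \<Rightarrow> nat graph \<Rightarrow> nat \<Rightarrow> nat \<Rightarrow> nat \<Rightarrow> nat set" where
  "seen off f G u d w = {v \<in> nbrs G w. v < u \<or> v = u \<and> w \<in> f ` {off u..<d}}"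

lemma seen_next:
  assumes "f ` {off u..<off (Suc u)} = nbrs G u"
  shows "seen off f G (Suc u) (off (Suc u)) w = seen off f G u (off (Suc u)) w"
  unfolding seen_def using assms nbrs_sym[of w G u] by (auto simp: less_Suc_eq)

lemma seen_step:
  assumes "f ` {off u..<off (Suc u)} = nbrs G u" "inj_on f {off u..<off (Suc u)}" "off u \<le> d" "d < off (Suc u)"
  shows "seen off f G u (Suc d) w = (if w = f d then insert u (seen off f G u d w) else seen off f G u d w)"
    "u \<notin> seen off f G u d (f d)" "u \<in> nbrs G (f d)" "f d \<in> nbrs G u"
proof -
  have "d \<in> {off u..<off (Suc u)}" using assms by auto
  then show fd: "f d \<in> nbrs G u" using assms(1) by blast
  then show u: "u \<in> nbrs G (f d)" using nbrs_sym by metis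
  have "{off u..<Suc d} = insert d {off u..<d}" using assms(3) by auto
  then show "seen off f G u (Suc d) w = (if w = f d then insert u (seen off f G u d w) else seen off f G u d w)"
    using u unfolding seen_def by auto
  have "f d \<notin> f ` {off u..<d}"
  proof
    assume "f d \<in> f ` {off u..<d}"
    then obtain e where "e \<in> {off u..<d}" "f e = f d" by auto
    then show False using inj_onD[OF assms(2), of e d] assms(3,4) by auto
  qed
  then show "u \<notin> seen off f G u d (f d)" by (simp add: seen_def)
qed

definition offsets :: "nat \<Rightarrow> (nat \<Rightarrow> nat) \<Rightarrow> (nat \<Rightarrow> nat) \<Rightarrow> nat graph \<Rightarrow> bool" where
  "offsets n off f G \<longleftrightarrow> off 0 = 0 \<and> (\<forall>v<n. off v \<le> off (Suc v) \<and>
     inj_on f {off v..<off (Suc v)} \<and> f ` {off v..<off (Suc v)} = nbrs G v)"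

text \<open>State of a scan at dart \<open>d\<close> of vertex \<open>u\<close>, where
  \<open>d\<close> may already stand at the end of that list. The conditional keeps the bound within
  the offsets, since \<open>off\<close> is meaningful only up to \<open>n\<close>.\<close>

definition pass_position :: "nat \<Rightarrow> (nat \<Rightarrow> nat) \<Rightarrow> nat \<Rightarrow> nat \<Rightarrow> bool" where
  "pass_position n off u d \<longleftrightarrow> u \<le> n \<and> off u \<le> d \<and> d \<le> off (if u < n then Suc u else n)"

text \<open>Counts vertices as well as darts, because a round that leaves a list consumes no
  dart.\<close>

definition pass_measure :: "nat \<Rightarrow> (nat \<Rightarrow> nat) \<Rightarrow> nat \<Rightarrow> nat \<Rightarrow> nat" where
  "pass_measure n off u d = (n - u) + (off n - d)"

lemma offsets_mono:
  assumes "offsets n off f G" "u \<le> v" "v \<le> n"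
  shows "off u \<le> off v"
  using assms(2,3)
proof (induction v rule: dec_induct)
  case (step v)
  then show ?case using assms(1) unfolding offsets_def by (metis Suc_leD Suc_le_lessD order_trans)
qed simp

lemma pass_position_start: "offsets n off f G \<Longrightarrow> pass_position n off 0 0"
  unfolding pass_position_def offsets_def by auto

lemma pass_position_dart:
  assumes "offsets n off f G" "pass_position n off u d" "u < n" "d < off (Suc u)"
  shows "pass_position n off u (Suc d)" "pass_measure n off u (Suc d) < pass_measure n off u d"
  using assms offsets_mono[OF assms(1), of "Suc u" n] unfolding pass_position_def pass_measure_def by auto

lemma pass_position_vertex:
  assumes "offsets n off f G" "pass_position n off u d" "u < n" "\<not> d < off (Suc u)"
  shows "d = off (Suc u)" "pass_position n off (Suc u) d" "pass_measure n off (Suc u) d < pass_measure n off u d"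
  using assms offsets_mono[OF assms(1), of "Suc u" "if Suc u < n then Suc (Suc u) else n"]
  unfolding pass_position_def pass_measure_def by (auto split: if_splits)

text \<open>Here \<open>en\<close> serves as a fill pointer. Lists come out increasing because the
  sources \<open>u\<close> are scanned in increasing order.\<close>

definition transposed :: "nat \<Rightarrow> (nat \<Rightarrow> nat) \<Rightarrow> (nat \<Rightarrow> nat) \<Rightarrow> nat graph \<Rightarrow> nat \<Rightarrow> nat \<Rightarrow> (nat \<Rightarrow> nat) \<Rightarrow> (nat \<Rightarrow> nat) \<Rightarrow> bool" where
  "transposed n off f G u d en he \<longleftrightarrow> (\<forall>w<n. en w = off w + card (seen off f G u d w) \<and>
     he ` {off w..<en w} = seen off f G u d w \<and> strict_mono_on {off w..<en w} he)"

lemma offsets_nbr_less: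
  assumes "simple_graph G" "verts G \<subseteq> {..<n}" "u \<in> nbrs G v"
  shows "u < n"
  using nbrs_verts[OF assms(1,3)] assms(2) by auto

lemma offsets_card:
  assumes "offsets n off f G" "v < n"
  shows "off (Suc v) = off v + card (nbrs G v)"
  using assms card_image[of f "{off v..<off (Suc v)}"] unfolding offsets_def by (metis card_atLeastLessThan le_add_diff_inverse)

lemma finite_seen: "simple_graph G \<Longrightarrow> finite (seen off f G u d w)"
  unfolding seen_def using finite_nbrs by auto

lemma transposed_start:
  assumes "simple_graph G" "offsets n off f G" "\<And>w. w < n \<Longrightarrow> en w = off w"
  shows "transposed n off f G 0 0 en he"
proof -
  have "off 0 = 0" using assms(2) by (simp add: offsets_def)
  then have "seen off f G 0 0 w = {}" for w by (auto simp: seen_def)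
  then show ?thesis using assms(3) unfolding transposed_def by (auto simp: strict_mono_on_def)
qed

text \<open>As \<open>u\<close> is a neighbour of \<open>f d\<close> that has not yet been recorded
  there, the block of \<open>f d\<close> has a free slot, and the write hits no other block. The new
  entry exceeds all recorded ones.\<close>

lemma transposed_dart:
  assumes G: "simple_graph G" "verts G \<subseteq> {..<n}" and off: "offsets n off f G"
    and t: "transposed n off f G u d en he" and u: "u < n" "off u \<le> d" "d < off (Suc u)"
  shows "transposed n off f G u (Suc d) (en(f d := Suc (en (f d)))) (he(en (f d) := u))"
  unfolding transposed_def
proof (intro allI impI)
  let ?x = "f d" and ?S = "seen off f G u"
  have off_u: "f ` {off u..<off (Suc u)} = nbrs G u" "inj_on f {off u..<off (Suc u)}"
    using off u by (auto simp: offsets_def)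
  note S = seen_step[OF off_u u(2,3)]
  have x: "?x < n" using offsets_nbr_less[OF G S(4)] .
  have sub: "?S d w \<subseteq> nbrs G w" for w by (auto simp: seen_def)
  have le: "en w \<le> off (Suc w)" if "w < n" for w
    using t that offsets_card[OF off that] card_mono[OF finite_nbrs[OF G(1)] sub[of w]] by (auto simp: transposed_def)
  have "?S d ?x \<subset> nbrs G ?x" using sub S(2,3) by blast
  then have "card (?S d ?x) < card (nbrs G ?x)" using finite_nbrs[OF G(1)] psubset_card_mono by blast
  then have lt: "en ?x < off (Suc ?x)" "off ?x \<le> en ?x" 
    using t x offsets_card[OF off x] by (auto simp: transposed_def)
  fix w assume w: "w < n"
  have tw: "en w = off w + card (?S d w)" "he ` {off w..<en w} = ?S d w" "strict_mono_on {off w..<en w} he"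
    using t w unfolding transposed_def by blast+
  show "(en(?x := Suc (en ?x))) w = off w + card (?S (Suc d) w) \<and>
    (he(en ?x := u)) ` {off w..<(en(?x := Suc (en ?x))) w} = ?S (Suc d) w \<and>
    strict_mono_on {off w..<(en(?x := Suc (en ?x))) w} (he(en ?x := u))"
  proof (cases "w = ?x")
    case False
    have "en ?x \<notin> {off w..<en w}"
    proof
      assume "en ?x \<in> {off w..<en w}"
      then have "en ?x < off (Suc w)" "off w \<le> en ?x" using le[OF w] by auto
      moreover have "off (Suc w) \<le> off ?x \<or> off (Suc ?x) \<le> off w"
        using False offsets_mono[OF off, of "Suc w" ?x] offsets_mono[OF off, of "Suc ?x" w] x w
        by (metis Suc_leI less_or_eq_imp_le linorder_neqE_nat)
      ultimately show False using lt by linarith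
    qed
    then have eq: "(he(en ?x := u)) i = he i" if "i \<in> {off w..<en w}" for i using that by auto
    have "(he(en ?x := u)) ` {off w..<en w} = he ` {off w..<en w}" using eq by (rule image_cong[OF refl])
    moreover have "strict_mono_on {off w..<en w} (he(en ?x := u))"
      using tw(3) eq unfolding strict_mono_on_def by metis
    ultimately show ?thesis using False tw S(1)[of w] by simp
  next
    case True
    have I: "{off w..<Suc (en w)} = insert (en w) {off w..<en w}" using lt True by auto
    have eq: "(he(en w := u)) i = he i" if "i \<in> {off w..<en w}" for i using that by auto
    have im: "(he(en w := u)) ` {off w..<Suc (en w)} = insert u (?S d w)"
      unfolding I tw(2)[symmetric] using eq by auto
    have less: "v < u" if "v \<in> ?S d w" for v
      using that S(2) True unfolding seen_def by auto
    have "strict_mono_on {off w..<Suc (en w)} (he(en w := u))"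
      unfolding strict_mono_on_def
    proof (intro allI impI)
      fix i j assume ij: "i \<in> {off w..<Suc (en w)} \<and> j \<in> {off w..<Suc (en w)} \<and> i < j"
      then have i: "i \<in> {off w..<en w}" by auto
      then have "he i < u" using less tw(2) by blast
      moreover have "he i < he j" if "j < en w" using tw(3) i ij that unfolding strict_mono_on_def by auto
      ultimately show "(he(en w := u)) i < (he(en w := u)) j" using i ij by auto
    qed
    moreover have "card (insert u (?S d w)) = Suc (card (?S d w))"
      using finite_seen[OF G(1)] S(2) True by simp
    ultimately show ?thesis using True tw im S(1)[of w] by simp
  qed
qed

lemma transposed_vertex:
  assumes off: "offsets n off f G" and t: "transposed n off f G u (off (Suc u)) en he" and u: "u < n"
  shows "transposed n off f G (Suc u) (off (Suc u)) en he"
proof -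
  have S: "seen off f G (Suc u) (off (Suc u)) w = seen off f G u (off (Suc u)) w" for w
    using seen_next[of f off u G] u off unfolding offsets_def by blast
  show ?thesis using t unfolding transposed_def S .
qed

lemma transposed_end:
  assumes G: "simple_graph G" "verts G \<subseteq> {..<n}" and off: "offsets n off f G"
    and t: "transposed n off f G n d en he"
  shows "offsets n off he G" "\<And>v. v < n \<Longrightarrow> en v = off (Suc v)" "\<And>v. v < n \<Longrightarrow> strict_mono_on {off v..<off (Suc v)} he"
proof -
  have S: "seen off f G n d w = nbrs G w" for w
    using offsets_nbr_less[OF G] by (auto simp: seen_def)
  show en: "en v = off (Suc v)" if "v < n" for v
    using t that offsets_card[OF off that] unfolding transposed_def S by simp
  show mono: "strict_mono_on {off v..<off (Suc v)} he" if "v < n" for v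
  proof -
    have "strict_mono_on {off v..<en v} he" using t that unfolding transposed_def by blast
    then show ?thesis using en[OF that] by simp
  qed
  have "he ` {off v..<off (Suc v)} = nbrs G v" if "v < n" for v
  proof -
    have "he ` {off v..<en v} = nbrs G v" using t that unfolding transposed_def S by blast
    then show ?thesis using en[OF that] by simp
  qed
  moreover have "inj_on he {off v..<off (Suc v)}" if "v < n" for v
    using strict_mono_on_imp_inj_on[OF mono[OF that]] .
  ultimately show "offsets n off he G" using off unfolding offsets_def by simp
qed

text \<open>\<open>cq w\<close> starts at the beginning of the list of \<open>w\<close> and advances
  with each dart into \<open>w\<close>. The lists being sorted, it always points at the twin of the
  next such dart.\<close>

definition twinned :: "nat \<Rightarrow> (nat \<Rightarrow> nat) \<Rightarrow> (nat \<Rightarrow> nat) \<Rightarrow> nat graph \<Rightarrow> nat \<Rightarrow> nat \<Rightarrow> (nat \<Rightarrow> nat) \<Rightarrow> (nat \<Rightarrow> nat) \<Rightarrow> bool" where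
  "twinned n off he G u d cq tw \<longleftrightarrow> (\<forall>w<n. cq w = off w + card (seen off he G u d w)) \<and>
     (\<forall>v<n. \<forall>e\<in>{off v..<off (Suc v)}. e < d \<longrightarrow> tw e \<in> {off (he e)..<off (Suc (he e))} \<and> he (tw e) = v)"

lemma strict_mono_on_rank:
  fixes h :: "nat \<Rightarrow> nat"
  assumes "strict_mono_on {a..<b} h" "i \<in> {a..<b}"
  shows "i = a + card {v \<in> h ` {a..<b}. v < h i}"
proof -
  have less: "h j < h k \<longleftrightarrow> j < k" if "j \<in> {a..<b}" "k \<in> {a..<b}" for j k
    using strict_mono_on_less[OF assms(1) that] .
  have "{v \<in> h ` {a..<b}. v < h i} = h ` {a..<i}"
  proof (intro set_eqI iffI)
    fix v assume "v \<in> {v \<in> h ` {a..<b}. v < h i}"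
    then obtain j where "j \<in> {a..<b}" "v = h j" "h j < h i" by blast
    then show "v \<in> h ` {a..<i}" using less[of j i] assms(2) by auto
  next
    fix v assume "v \<in> h ` {a..<i}"
    then obtain j where "j \<in> {a..<i}" "v = h j" by blast
    then show "v \<in> {v \<in> h ` {a..<b}. v < h i}" using less[of j i] assms(2) by auto
  qed
  moreover have "inj_on h {a..<i}"
    using strict_mono_on_imp_inj_on[OF assms(1)] by (rule inj_on_subset) (use assms(2) in auto)
  ultimately show ?thesis using assms(2) by (simp add: card_image)
qed

text \<open>When the dart from \<open>u\<close> to \<open>x\<close> is scanned, the neighbours of
  \<open>x\<close> already counted are those below \<open>u\<close>. Their number is the rank of
  \<open>u\<close> in the sorted list of \<open>x\<close>, so \<open>cq x\<close> is the dart from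
  \<open>x\<close> back to \<open>u\<close>.\<close>

lemma twinned_dart:
  assumes G: "simple_graph G" "verts G \<subseteq> {..<n}" and off: "offsets n off he G"
    and mono: "\<And>v. v < n \<Longrightarrow> strict_mono_on {off v..<off (Suc v)} he"
    and t: "twinned n off he G u d cq tw" and u: "u < n" "off u \<le> d" "d < off (Suc u)"
  shows "twinned n off he G u (Suc d) (cq(he d := Suc (cq (he d)))) (tw(d := cq (he d)))"
proof -
  let ?x = "he d" and ?S = "seen off he G u"
  have off_u: "he ` {off u..<off (Suc u)} = nbrs G u" "inj_on he {off u..<off (Suc u)}"
    using off u by (auto simp: offsets_def)
  note S = seen_step[OF off_u u(2,3)]
  have x: "?x < n" using offsets_nbr_less[OF G S(4)] .
  have im: "he ` {off ?x..<off (Suc ?x)} = nbrs G ?x" using off x by (simp add: offsets_def)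
  obtain i where i: "i \<in> {off ?x..<off (Suc ?x)}" "he i = u" using S(3) im by (metis imageE)
  have "?S d ?x = {v \<in> nbrs G ?x. v < u}" using S(2) unfolding seen_def by auto
  then have "cq ?x = i"
    using strict_mono_on_rank[OF mono[OF x] i(1)] t x i(2) unfolding twinned_def im by simp
  have 1: "(cq(?x := Suc (cq ?x))) w = off w + card (?S (Suc d) w)" if "w < n" for w
    using t that S(1)[of w] S(2) finite_seen[OF G(1)] unfolding twinned_def by simp
  moreover have "(tw(d := cq ?x)) e \<in> {off (he e)..<off (Suc (he e))} \<and> he ((tw(d := cq ?x)) e) = v"
    if e: "v < n" "e \<in> {off v..<off (Suc v)}" "e < Suc d" for v e
  proof (cases "e = d")
    case True
    have "v = u"
    proof (rule ccontr)
      assume "v \<noteq> u"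
      then have "off (Suc v) \<le> off u \<or> off (Suc u) \<le> off v"
        using offsets_mono[OF off, of "Suc v" u] offsets_mono[OF off, of "Suc u" v] u(1) e(1)
        by (metis Suc_leI less_or_eq_imp_le linorder_neqE_nat)
      then show False using e(2) u(2,3) True by auto
    qed
    then show ?thesis using True i \<open>cq ?x = i\<close> by simp
  next
    case False
    then show ?thesis using t e unfolding twinned_def by simp
  qed
  ultimately show ?thesis unfolding twinned_def by blast
qed

lemma twinned_vertex:
  assumes off: "offsets n off f G" and t: "twinned n off f G u (off (Suc u)) en he" and u: "u < n"
  shows "twinned n off f G (Suc u) (off (Suc u)) en he"
proof -
  have S: "seen off f G (Suc u) (off (Suc u)) w = seen off f G u (off (Suc u)) w" for w
    using seen_next[of f off u G] u off unfolding offsets_def by blast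
  show ?thesis using t unfolding twinned_def S .
qed

lemma twinned_start:
  assumes "simple_graph G" "offsets n off f G" "\<And>w. w < n \<Longrightarrow> cq w = off w"
  shows "twinned n off f G 0 0 cq tw"
proof -
  have "off 0 = 0" using assms(2) by (simp add: offsets_def)
  then have "seen off f G 0 0 w = {}" for w by (auto simp: seen_def)
  then show ?thesis using assms(3) unfolding twinned_def by auto
qed

lemma twinned_adjrep:
  assumes G: "simple_graph G" "verts G \<subseteq> {..<n}" and off: "offsets n off he G"
    and en: "\<And>v. v < n \<Longrightarrow> en v = off (Suc v)"
    and t: "twinned n off he G n d cq tw" and d: "pass_position n off n d"
  shows "adjrep n off en he tw G"
proof -
  have dn: "d = off n" using d by (simp add: pass_position_def)
  have "tw e \<in> {off (he e)..<en (he e)} \<and> he (tw e) = v" if v: "v < n" and e: "e \<in> {off v..<en v}" for v e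
  proof -
    have e': "e \<in> {off v..<off (Suc v)}" "e < d"
      using e en[OF v] offsets_mono[OF off, of "Suc v" n] v dn by auto
    have "he ` {off v..<off (Suc v)} = nbrs G v" using off v by (simp add: offsets_def)
    then have "he e \<in> nbrs G v" using e'(1) by blast
    then have "he e < n" using offsets_nbr_less[OF G] by blast
    then show ?thesis using t v e' en[of "he e"] unfolding twinned_def by auto
  qed
  then show ?thesis using G off en unfolding adjrep_def offsets_def by auto
qed

section \<open>The program\<close>

fun seqs :: "prog list \<Rightarrow> prog" where
  "seqs [] = Skip"
| "seqs (c # cs) = Seq c (seqs cs)"

definition Or :: "bexp \<Rightarrow> bexp \<Rightarrow> bexp" where
  "Or b c = Not (And (Not b) (Not c))"

lemma Or_val [simp]: "bexp_val (Or b c) s \<longleftrightarrow> bexp_val b s \<or> bexp_val c s"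
  by (simp add: Or_def)

text \<open>The machine can only add one, so a position in a list is reached by repeated
  \<open>Inc\<close>; indices up to three suffice.\<close>

fun slot :: "nat \<Rightarrow> exp \<Rightarrow> exp" where
  "slot 0 e = Elem ''off'' e"
| "slot (Suc i) e = Inc (slot i e)"

abbreviation nbr :: "nat \<Rightarrow> exp \<Rightarrow> exp" where
  "nbr i e \<equiv> Elem ''he'' (slot i e)"

definition cubic :: "exp \<Rightarrow> bexp" where
  "cubic e = Eq (slot 3 e) (Elem ''en'' e)"

text \<open>Looks at three positions only, so it decides adjacency just for a cubic first argument.
  The program uses it after testing \<open>cubic\<close>.\<close>

definition adjacent :: "exp \<Rightarrow> exp \<Rightarrow> bexp" where
  "adjacent e f = Or (Eq (nbr 0 e) f) (Or (Eq (nbr 1 e) f) (Eq (nbr 2 e) f))"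

lemma slot_val [simp]: "exp_val (slot i e) s = arrs s ''off'' (exp_val e s) + i"
  by (induction i) simp_all

text \<open>
  The darts of \<open>v\<close> occupy the positions from \<open>off[v]\<close> up to but excluding \<open>en[v]\<close>; \<open>he\<close> and \<open>tw\<close> hold the head and
  the twin of a dart. Deleted vertices have no darts, so the tests for degree three skip them. The stack
  is \<open>st\<close> with height \<open>t\<close>, the log of the reductions consists of \<open>l0\<close> (which kind) to \<open>l6\<close> with length \<open>k\<close>, and \<open>nx\<close>
  is the successor function of the cycle. Registers \<open>y\<close>, \<open>p\<close>, \<open>q\<close>, \<open>s\<close>, \<open>a\<close>, \<open>b\<close> hold the arguments
  \<open>y\<close>, \<open>u\<close>, \<open>w\<close>, \<open>s\<close>, \<open>a\<close>, \<open>b\<close> of \<open>confA\<close> and \<open>confB\<close>, and \<open>f\<close> tells whether a reduction was found in this round.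
\<close>

definition init_loop :: prog where
  "init_loop = While (Less (Reg ''t'') (Reg ''n'')) (seqs
     [Update ''en'' (Reg ''t'') (Elem ''off'' (Reg ''t'')),
      Update ''cq'' (Reg ''t'') (Elem ''off'' (Reg ''t'')),
      Update ''st'' (Reg ''t'') (Reg ''t''),
      Assign ''t'' (Inc (Reg ''t''))])"

text \<open>The scan over vertices and their lists is flattened into one loop, so that the body is
  loop-free and each round has constant cost even for empty lists.\<close>

definition dart_loop :: "prog \<Rightarrow> prog" where
  "dart_loop c = While (Less (Reg ''u'') (Reg ''n''))
     (If (Less (Reg ''d'') (Elem ''off'' (Inc (Reg ''u''))))
       (Seq c (Assign ''d'' (Inc (Reg ''d''))))
       (Assign ''u'' (Inc (Reg ''u''))))"

definition transpose_dart :: prog where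
  "transpose_dart = seqs
     [Assign ''w'' (Elem ''adj'' (Reg ''d'')),
      Update ''he'' (Elem ''en'' (Reg ''w'')) (Reg ''u''),
      Update ''en'' (Reg ''w'') (Inc (Elem ''en'' (Reg ''w'')))]"

definition twin_dart :: prog where
  "twin_dart = seqs
     [Assign ''w'' (Elem ''he'' (Reg ''d'')),
      Update ''tw'' (Reg ''d'') (Elem ''cq'' (Reg ''w'')),
      Update ''cq'' (Reg ''w'') (Inc (Elem ''cq'' (Reg ''w'')))]"

definition push :: "exp \<Rightarrow> prog" where
  "push e = Seq (Update ''st'' (Reg ''t'') e) (Assign ''t'' (Inc (Reg ''t'')))"

text \<open>Two of three distinct heads are skipped, so two conditional increments are
  enough.\<close>

definition find_outer :: "string \<Rightarrow> exp \<Rightarrow> exp \<Rightarrow> exp \<Rightarrow> prog" where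
  "find_outer r e f g =
    (let c = If (Or (Eq (Elem ''he'' (Reg r)) f) (Eq (Elem ''he'' (Reg r)) g)) (Assign r (Inc (Reg r))) Skip
     in seqs [Assign r (slot 0 e), c, c])"

definition log_step :: "nat \<Rightarrow> prog" where
  "log_step i = seqs
     [Update ''l0'' (Reg ''k'') (Const i), Update ''l1'' (Reg ''k'') (Reg ''y''),
      Update ''l2'' (Reg ''k'') (Reg ''p''), Update ''l3'' (Reg ''k'') (Reg ''q''),
      Update ''l4'' (Reg ''k'') (Reg ''s''), Update ''l5'' (Reg ''k'') (Reg ''a''),
      Update ''l6'' (Reg ''k'') (Reg ''b''), Assign ''k'' (Inc (Reg ''k''))]"

definition do_A :: "nat \<Rightarrow> nat \<Rightarrow> prog" where
  "do_A i j = seqs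
     [Assign ''g'' (Elem ''tw'' (Reg ''i'')), Assign ''h'' (Elem ''tw'' (Reg ''j'')),
      Assign ''z'' (slot i (Reg ''y'')), Assign ''e'' (slot j (Reg ''y'')),
      log_step 1, push (Reg ''y''), push (Reg ''a''), push (Reg ''b''),
      Update ''he'' (Reg ''z'') (Reg ''a''), Update ''he'' (Reg ''e'') (Reg ''b''),
      Update ''he'' (Reg ''g'') (Reg ''y''), Update ''he'' (Reg ''h'') (Reg ''y''),
      Update ''tw'' (Reg ''z'') (Reg ''g''), Update ''tw'' (Reg ''e'') (Reg ''h''),
      Update ''tw'' (Reg ''g'') (Reg ''z''), Update ''tw'' (Reg ''h'') (Reg ''e''),
      Update ''en'' (Reg ''p'') (slot 0 (Reg ''p'')), Update ''en'' (Reg ''q'') (slot 0 (Reg ''q'')),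
      Assign ''f'' (Const 1)]"

text \<open>The dart from \<open>s\<close> to \<open>y\<close> is overwritten by the last dart \<open>e\<close> of \<open>s\<close>, which keeps the list of \<open>s\<close> contiguous.\<close>

definition do_B :: "nat \<Rightarrow> nat \<Rightarrow> nat \<Rightarrow> prog" where
  "do_B i j k = seqs
     [Assign ''g'' (Elem ''tw'' (slot i (Reg ''y''))), Assign ''h'' (Elem ''tw'' (slot j (Reg ''y''))),
      Assign ''z'' (Elem ''tw'' (slot k (Reg ''y''))), Assign ''e'' (Dec (Elem ''en'' (Reg ''s''))),
      Assign ''a'' (Elem ''he'' (Reg ''e'')), Assign ''b'' (Elem ''tw'' (Reg ''e'')),
      log_step 2, push (Reg ''p''), push (Reg ''q''), push (Reg ''s''),
      Update ''he'' (Reg ''z'') (Reg ''a''), Update ''he'' (Reg ''g'') (Reg ''q''),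
      Update ''he'' (Reg ''h'') (Reg ''p''),
      Update ''tw'' (Reg ''z'') (Reg ''b''), Update ''tw'' (Reg ''b'') (Reg ''z''),
      Update ''tw'' (Reg ''g'') (Reg ''h''), Update ''tw'' (Reg ''h'') (Reg ''g''),
      Update ''en'' (Reg ''s'') (Reg ''e''), Update ''en'' (Reg ''y'') (slot 0 (Reg ''y'')),
      Assign ''f'' (Const 1)]"

definition try_triangle :: "nat \<Rightarrow> nat \<Rightarrow> prog" where
  "try_triangle i j = seqs
     [find_outer ''i'' (Reg ''p'') (Reg ''y'') (Reg ''q''), find_outer ''j'' (Reg ''q'') (Reg ''y'') (Reg ''p''),
      Assign ''a'' (Elem ''he'' (Reg ''i'')), Assign ''b'' (Elem ''he'' (Reg ''j'')),
      If (Or (Eq (Reg ''a'') (Reg ''b'')) (Or (Eq (Reg ''a'') (Reg ''s'')) (Eq (Reg ''b'') (Reg ''s''))))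
        Skip (do_A i j)]"

definition try_path :: "nat \<Rightarrow> nat \<Rightarrow> nat \<Rightarrow> prog" where
  "try_path i j k = If (And (adjacent (Reg ''p'') (Reg ''s'')) (adjacent (Reg ''q'') (Reg ''s''))) (do_B i j k) Skip"

definition try_pair :: "nat \<Rightarrow> nat \<Rightarrow> nat \<Rightarrow> prog" where
  "try_pair i j k = If (And (cubic (Reg ''p'')) (cubic (Reg ''q'')))
     (If (adjacent (Reg ''p'') (Reg ''q'')) (try_triangle i j) (try_path i j k)) Skip"

definition attempt :: "nat \<Rightarrow> nat \<Rightarrow> nat \<Rightarrow> prog" where
  "attempt i j k = If (And (Eq (Reg ''f'') (Const 0)) (cubic (Reg ''y'')))
     (seqs [Assign ''p'' (nbr i (Reg ''y'')), Assign ''q'' (nbr j (Reg ''y'')), Assign ''s'' (nbr k (Reg ''y'')), try_pair i j k])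
     Skip"

text \<open>Patterns are symmetric in \<open>p\<close> and \<open>q\<close>, so only the choice of
  the neighbour that plays \<open>s\<close> matters. After a success \<open>f\<close> turns the
  remaining attempts into no-ops.\<close>

definition center :: "exp \<Rightarrow> prog" where
  "center e = seqs [Assign ''y'' e, attempt 0 1 2, attempt 0 2 1, attempt 1 2 0]"

text \<open>\<open>x\<close> is popped only when nothing was found. After a success it stays below
  the three pushed vertices, as it may belong to further patterns.\<close>

definition reduce_body :: prog where
  "reduce_body = seqs
     [Assign ''x'' (Elem ''st'' (Dec (Reg ''t''))), Assign ''f'' (Const 0),
      If (cubic (Reg ''x''))
        (seqs [center (Reg ''x''), center (nbr 0 (Reg ''x'')), center (nbr 1 (Reg ''x'')), center (nbr 2 (Reg ''x''))])
        Skip,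
      If (Eq (Reg ''f'') (Const 0)) (Assign ''t'' (Dec (Reg ''t''))) Skip]"

definition reduce_loop :: prog where
  "reduce_loop = While (Less (Const 0) (Reg ''t'')) reduce_body"

definition find_alive :: prog where
  "find_alive = While (Eq (Elem ''off'' (Reg ''v'')) (Elem ''en'' (Reg ''v''))) (Assign ''v'' (Inc (Reg ''v'')))"

definition base_cycle :: prog where
  "base_cycle = seqs
     [Update ''nx'' (Reg ''v'') (nbr 0 (Reg ''v'')),
      Update ''nx'' (nbr 0 (Reg ''v'')) (nbr 1 (Reg ''v'')),
      Update ''nx'' (nbr 1 (Reg ''v'')) (nbr 2 (Reg ''v'')),
      Update ''nx'' (nbr 2 (Reg ''v'')) (Reg ''v'')]"

abbreviation next_of :: "string \<Rightarrow> exp" where "next_of r \<equiv> Elem ''nx'' (Reg r)"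
abbreviation link :: "string \<Rightarrow> string \<Rightarrow> prog" where "link r r' \<equiv> Update ''nx'' (Reg r) (Reg r')"

definition undo_A :: prog where
  "undo_A =
    If (Eq (next_of ''s'') (Reg ''y''))
      (If (Eq (next_of ''y'') (Reg ''a''))
        (seqs [link ''p'' ''a'', link ''q'' ''p'', link ''y'' ''q''])
        (seqs [link ''q'' ''b'', link ''p'' ''q'', link ''y'' ''p'']))
      (If (Eq (next_of ''a'') (Reg ''y''))
        (If (Eq (next_of ''y'') (Reg ''s''))
          (seqs [link ''a'' ''p'', link ''p'' ''q'', link ''q'' ''y''])
          (seqs [link ''a'' ''p'', link ''p'' ''y'', link ''q'' ''b'', link ''y'' ''q'']))
        (If (Eq (next_of ''y'') (Reg ''s''))
          (seqs [link ''b'' ''q'', link ''q'' ''p'', link ''p'' ''y''])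
          (seqs [link ''b'' ''q'', link ''q'' ''y'', link ''p'' ''a'', link ''y'' ''p''])))"

definition undo_B :: prog where
  "undo_B =
    If (Eq (next_of ''p'') (Reg ''q'')) (Seq (link ''y'' ''q'') (link ''p'' ''y''))
      (If (Eq (next_of ''q'') (Reg ''p'')) (Seq (link ''y'' ''p'') (link ''q'' ''y''))
        (If (Eq (next_of ''p'') (Reg ''s'')) (Seq (link ''y'' ''s'') (link ''p'' ''y''))
          (Seq (link ''y'' ''p'') (link ''s'' ''y''))))"

definition undo_body :: prog where
  "undo_body = seqs
     [Assign ''k'' (Dec (Reg ''k'')),
      Assign ''y'' (Elem ''l1'' (Reg ''k'')), Assign ''p'' (Elem ''l2'' (Reg ''k'')),
      Assign ''q'' (Elem ''l3'' (Reg ''k'')), Assign ''s'' (Elem ''l4'' (Reg ''k'')),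
      Assign ''a'' (Elem ''l5'' (Reg ''k'')), Assign ''b'' (Elem ''l6'' (Reg ''k'')),
      If (Eq (Elem ''l0'' (Reg ''k'')) (Const 1)) undo_A undo_B]"

definition undo_loop :: prog where
  "undo_loop = While (Less (Const 0) (Reg ''k'')) undo_body"

definition output_loop :: prog where
  "output_loop = While (Less (Reg ''o'') (Reg ''n'')) (seqs
     [Update ''cyc'' (Reg ''o'') (Reg ''c''),
      Assign ''c'' (Elem ''nx'' (Reg ''c'')),
      Assign ''o'' (Inc (Reg ''o''))])"

definition hamilton_prog :: prog where
  "hamilton_prog = Seq init_loop (Seq (dart_loop transpose_dart)
     (Seq (Seq (Assign ''u'' (Const 0)) (Assign ''d'' (Const 0))) (Seq (dart_loop twin_dart)
     (Seq reduce_loop (Seq (Assign ''v'' (Const 0)) (Seq find_alive (Seq base_cycle (Seq undo_loop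
     (Seq (Seq (Assign ''o'' (Const 0)) (Assign ''c'' (Const 0))) output_loop)))))))))"

section \<open>Effect of the loop-free blocks\<close>

lemma run_push:
  "run (push e) s = s\<lparr>regs := (regs s)(''t'' := Suc (regs s ''t'')),
     arrs := (arrs s)(''st'' := (arrs s ''st'')(regs s ''t'' := exp_val e s))\<rparr>"
  by (simp add: push_def)

lemma run_log_step:
  "run (log_step i) s = s\<lparr>regs := (regs s)(''k'' := Suc (regs s ''k'')),
     arrs := (arrs s)(''l0'' := (arrs s ''l0'')(regs s ''k'' := i), ''l1'' := (arrs s ''l1'')(regs s ''k'' := regs s ''y''),
       ''l2'' := (arrs s ''l2'')(regs s ''k'' := regs s ''p''), ''l3'' := (arrs s ''l3'')(regs s ''k'' := regs s ''q''),
       ''l4'' := (arrs s ''l4'')(regs s ''k'' := regs s ''s''), ''l5'' := (arrs s ''l5'')(regs s ''k'' := regs s ''a''),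
       ''l6'' := (arrs s ''l6'')(regs s ''k'' := regs s ''b''))\<rparr>"
  by (simp add: log_step_def)

lemma run_do_A:
  fixes s i j
  defines "t \<equiv> run (do_A i j) s"
    and "g \<equiv> arrs s ''tw'' (regs s ''i'')" and "h \<equiv> arrs s ''tw'' (regs s ''j'')"
    and "z \<equiv> arrs s ''off'' (regs s ''y'') + i" and "e \<equiv> arrs s ''off'' (regs s ''y'') + j"
    and "y \<equiv> regs s ''y''" and "p \<equiv> regs s ''p''" and "q \<equiv> regs s ''q''"
    and "a \<equiv> regs s ''a''" and "b \<equiv> regs s ''b''" and "k \<equiv> regs s ''k''" and "r \<equiv> regs s ''t''"
  shows "arrs t ''he'' = (arrs s ''he'')(z := a, e := b, g := y, h := y)"
    "arrs t ''tw'' = (arrs s ''tw'')(z := g, e := h, g := z, h := e)"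
    "arrs t ''en'' = (arrs s ''en'')(p := arrs s ''off'' p, q := arrs s ''off'' q)"
    "arrs t ''off'' = arrs s ''off''"
    "arrs t ''st'' = (arrs s ''st'')(r := y, Suc r := a, Suc (Suc r) := b)"
    "arrs t ''l0'' = (arrs s ''l0'')(k := 1)" "arrs t ''l1'' = (arrs s ''l1'')(k := y)"
    "arrs t ''l2'' = (arrs s ''l2'')(k := p)" "arrs t ''l3'' = (arrs s ''l3'')(k := q)"
    "arrs t ''l4'' = (arrs s ''l4'')(k := regs s ''s'')" "arrs t ''l5'' = (arrs s ''l5'')(k := a)"
    "arrs t ''l6'' = (arrs s ''l6'')(k := b)"
    "regs t ''k'' = Suc k" "regs t ''t'' = r + 3" "regs t ''f'' = 1" "regs t ''n'' = regs s ''n''"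
  unfolding assms by (simp_all add: do_A_def run_push run_log_step)

lemma run_do_B:
  fixes s i j k
  defines "t \<equiv> run (do_B i j k) s"
    and "g \<equiv> arrs s ''tw'' (arrs s ''off'' (regs s ''y'') + i)" and "h \<equiv> arrs s ''tw'' (arrs s ''off'' (regs s ''y'') + j)"
    and "z \<equiv> arrs s ''tw'' (arrs s ''off'' (regs s ''y'') + k)" and "e \<equiv> arrs s ''en'' (regs s ''s'') - 1"
    and "y \<equiv> regs s ''y''" and "p \<equiv> regs s ''p''" and "q \<equiv> regs s ''q''" and "x \<equiv> regs s ''s''"
    and "l \<equiv> regs s ''k''" and "r \<equiv> regs s ''t''"
  shows "arrs t ''he'' = (arrs s ''he'')(z := arrs s ''he'' e, g := q, h := p)"
    "arrs t ''tw'' = (arrs s ''tw'')(z := arrs s ''tw'' e, arrs s ''tw'' e := z, g := h, h := g)"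
    "arrs t ''en'' = (arrs s ''en'')(x := e, y := arrs s ''off'' y)"
    "arrs t ''off'' = arrs s ''off''"
    "arrs t ''st'' = (arrs s ''st'')(r := p, Suc r := q, Suc (Suc r) := x)"
    "arrs t ''l0'' = (arrs s ''l0'')(l := 2)" "arrs t ''l1'' = (arrs s ''l1'')(l := y)"
    "arrs t ''l2'' = (arrs s ''l2'')(l := p)" "arrs t ''l3'' = (arrs s ''l3'')(l := q)"
    "arrs t ''l4'' = (arrs s ''l4'')(l := x)"
    "\<exists>v. arrs t ''l5'' = (arrs s ''l5'')(l := v)" "\<exists>v. arrs t ''l6'' = (arrs s ''l6'')(l := v)"
    "regs t ''k'' = Suc l" "regs t ''t'' = r + 3" "regs t ''f'' = 1" "regs t ''n'' = regs s ''n''"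
  unfolding assms by (auto simp add: do_B_def run_push run_log_step)

lemma run_undo_A:
  "run undo_A s = s\<lparr>arrs := (arrs s)(''nx'' := undoA (regs s ''y'') (regs s ''p'') (regs s ''q'') (regs s ''s'')
     (regs s ''a'') (regs s ''b'') (arrs s ''nx''))\<rparr>"
  by (simp add: undo_A_def undoA_def)

lemma run_undo_B:
  "run undo_B s = s\<lparr>arrs := (arrs s)(''nx'' := undoB (regs s ''y'') (regs s ''p'') (regs s ''q'') (regs s ''s'') (arrs s ''nx''))\<rparr>"
  by (simp add: undo_B_def undoB_def)

section \<open>Correctness of the reduction loop\<close>

text \<open>Recursion peels off the latest reduction first, which is the order in which the cycle is
  lifted.\<close>

primrec logged :: "(string \<Rightarrow> nat \<Rightarrow> nat) \<Rightarrow> nat \<Rightarrow> nat graph \<Rightarrow> nat graph \<Rightarrow> bool" where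
  "logged A 0 G H \<longleftrightarrow> H = G"
| "logged A (Suc k) G H \<longleftrightarrow> (\<exists>K. logged A k G K \<and>
     (A ''l0'' k = 1 \<and> confA K (A ''l1'' k) (A ''l2'' k) (A ''l3'' k) (A ''l4'' k) (A ''l5'' k) (A ''l6'' k) \<and>
        H = redA K (A ''l1'' k) (A ''l2'' k) (A ''l3'' k) (A ''l4'' k) (A ''l5'' k) (A ''l6'' k) \<or>
      A ''l0'' k = 2 \<and> confB K (A ''l1'' k) (A ''l2'' k) (A ''l3'' k) (A ''l4'' k) \<and>
        H = redB K (A ''l1'' k) (A ''l2'' k) (A ''l3'' k)))"

lemma logged_cong:
  assumes "\<And>r i. r \<in> {''l0'', ''l1'', ''l2'', ''l3'', ''l4'', ''l5'', ''l6''} \<Longrightarrow> i < k \<Longrightarrow> A r i = B r i"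
  shows "logged A k G H \<longleftrightarrow> logged B k G H"
  using assms
proof (induction k arbitrary: H)
  case (Suc k)
  have "logged A k G K \<longleftrightarrow> logged B k G K" for K using Suc by simp
  moreover have "A ''l0'' k = B ''l0'' k" "A ''l1'' k = B ''l1'' k" "A ''l2'' k = B ''l2'' k"
    "A ''l3'' k = B ''l3'' k" "A ''l4'' k = B ''l4'' k" "A ''l5'' k = B ''l5'' k" "A ''l6'' k = B ''l6'' k"
    using Suc.prems by simp_all
  ultimately show ?case by simp
qed simp

lemma logged_simple: "logged A k G H \<Longrightarrow> simple_graph G \<Longrightarrow> simple_graph H"
proof (induction k arbitrary: H)
  case (Suc k)
  from Suc.prems(1) obtain K where K: "logged A k G K"
    and H: "A ''l0'' k = 1 \<and> confA K (A ''l1'' k) (A ''l2'' k) (A ''l3'' k) (A ''l4'' k) (A ''l5'' k) (A ''l6'' k) \<and>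
        H = redA K (A ''l1'' k) (A ''l2'' k) (A ''l3'' k) (A ''l4'' k) (A ''l5'' k) (A ''l6'' k) \<or>
      A ''l0'' k = 2 \<and> confB K (A ''l1'' k) (A ''l2'' k) (A ''l3'' k) (A ''l4'' k) \<and>
        H = redB K (A ''l1'' k) (A ''l2'' k) (A ''l3'' k)" by auto
  have "simple_graph K" using Suc.IH[OF K Suc.prems(2)] .
  then show ?case using H simple_redA simple_redB by metis
qed simp

text \<open>The stack must meet each pattern in one of its three cubic vertices. The vertex
  \<open>s\<close> does not count: its degree is unbounded, so a round could not examine all its
  neighbours.\<close>

definition covered :: "nat graph \<Rightarrow> nat set \<Rightarrow> bool" where
  "covered H S \<longleftrightarrow> (\<forall>y u w s a b. confA H y u w s a b \<longrightarrow> {y, u, w} \<inter> S \<noteq> {}) \<and>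
     (\<forall>y u w s. confB H y u w s \<longrightarrow> {y, u, w} \<inter> S \<noteq> {})"

definition stack :: "store \<Rightarrow> nat set" where
  "stack s = arrs s ''st'' ` {..<regs s ''t''}"

text \<open>A reduction pattern is determined by the neighbourhoods of its three cubic vertices.\<close>

lemma covered_transfer:
  assumes "covered H S"
    and "\<And>v. v \<notin> T \<Longrightarrow> nbrs K v = nbrs H v \<or> nbrs K v = {}"
  shows "covered K (S \<union> T)"
  unfolding covered_def
proof (intro conjI allI impI notI)
  fix y u w s a b assume c: "confA K y u w s a b" and i: "{y, u, w} \<inter> (S \<union> T) = {}"
  have "nbrs K y \<noteq> {}" "nbrs K u \<noteq> {}" "nbrs K w \<noteq> {}" using c by (auto simp: confA_def)
  then have "nbrs K y = nbrs H y" "nbrs K u = nbrs H u" "nbrs K w = nbrs H w" using assms(2) i by blast+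
  then have "confA H y u w s a b" using c by (simp add: confA_def)
  then show False using assms(1) i unfolding covered_def by blast
next
  fix y u w s assume c: "confB K y u w s" and i: "{y, u, w} \<inter> (S \<union> T) = {}"
  have "nbrs K y \<noteq> {}" "nbrs K u \<noteq> {}" "nbrs K w \<noteq> {}" using c by (auto simp: confB_def)
  then have "nbrs K y = nbrs H y" "nbrs K u = nbrs H u" "nbrs K w = nbrs H w" using assms(2) i by blast+
  then have "confB H y u w s" using c by (simp add: confB_def)
  then show False using assms(1) i unfolding covered_def by blast
qed

lemma covered_redA:
  assumes "covered H S" "confA H y u w s a b"
  shows "covered (redA H y u w s a b) (S \<union> {y, a, b})"
  using assms(1) by (rule covered_transfer) (simp add: nbrs_redA[OF assms(2)])

lemma covered_redB:
  assumes "covered H S" "confB H y u w s"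
  shows "covered (redB H y u w) (S \<union> {u, w, s})"
  using assms(1) by (rule covered_transfer) (simp add: nbrs_redB[OF assms(2)])

abbreviation represents :: "nat \<Rightarrow> nat graph \<Rightarrow> store \<Rightarrow> bool" where
  "represents n H s \<equiv> adjrep n (arrs s ''off'') (arrs s ''en'') (arrs s ''he'') (arrs s ''tw'') H"

definition core :: "nat \<Rightarrow> nat graph \<Rightarrow> nat graph \<Rightarrow> store \<Rightarrow> bool" where
  "core n G H s \<longleftrightarrow> represents n H s \<and>
     logged (arrs s) (regs s ''k'') G H \<and> can_reducible H \<and> regs s ''n'' = n \<and> stack s \<subseteq> {..<n} \<and> covered H (stack s)"

definition progress :: "nat \<Rightarrow> nat graph \<Rightarrow> nat graph \<Rightarrow> nat \<Rightarrow> store \<Rightarrow> bool" where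
  "progress n G H t s \<longleftrightarrow> regs s ''f'' = 1 \<and> regs s ''t'' = t + 3 \<and>
     (\<exists>H'. core n G H' s \<and> card (verts H') < card (verts H))"

lemma stack_push3:
  assumes "arrs s' ''st'' = (arrs s ''st'')(r := x, Suc r := y, Suc (Suc r) := z)" "r = regs s ''t''" "regs s' ''t'' = r + 3"
  shows "stack s' = stack s \<union> {x, y, z}"
proof -
  have "{..<r + 3} = {..<r} \<union> {r, Suc r, Suc (Suc r)}" by auto
  then show ?thesis using assms unfolding stack_def by (auto simp: image_iff)
qed

lemma progress_A:
  assumes core: "core n G H s" and c: "confA H (regs s ''y'') (regs s ''p'') (regs s ''q'') (regs s ''s'') (regs s ''a'') (regs s ''b'')"
    and cubic: "arrs s ''en'' (regs s ''y'') = arrs s ''off'' (regs s ''y'') + 3" "i < 3" "j < 3"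
    and ij: "arrs s ''he'' (arrs s ''off'' (regs s ''y'') + i) = regs s ''p''" "arrs s ''he'' (arrs s ''off'' (regs s ''y'') + j) = regs s ''q''"
    and d: "regs s ''i'' \<in> {arrs s ''off'' (regs s ''p'')..<arrs s ''en'' (regs s ''p'')}" "arrs s ''he'' (regs s ''i'') = regs s ''a''"
      "regs s ''j'' \<in> {arrs s ''off'' (regs s ''q'')..<arrs s ''en'' (regs s ''q'')}" "arrs s ''he'' (regs s ''j'') = regs s ''b''"
  shows "progress n G H (regs s ''t'') (run (do_A i j) s)"
proof -
  let ?s = "run (do_A i j) s"
  note R = run_do_A[of i j s]
  have rep: "represents n H s"
    and log: "logged (arrs s) (regs s ''k'') G H" and red: "can_reducible H" and n: "regs s ''n'' = n"
    and st: "stack s \<subseteq> {..<n}" "covered H (stack s)"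
    using core by (auto simp: core_def)
  note G = adjrep_simple[OF rep]
  let ?H = "redA H (regs s ''y'') (regs s ''p'') (regs s ''q'') (regs s ''s'') (regs s ''a'') (regs s ''b'')"
  have z: "arrs s ''off'' (regs s ''y'') + i \<in> {arrs s ''off'' (regs s ''y'')..<arrs s ''en'' (regs s ''y'')}"
    "arrs s ''off'' (regs s ''y'') + j \<in> {arrs s ''off'' (regs s ''y'')..<arrs s ''en'' (regs s ''y'')}"
    using cubic by auto
  have "represents n ?H ?s"
    unfolding R by (rule adjrep_redA[OF rep c z(1) ij(1) z(2) ij(2) d])
  moreover have step: "can_step H ?H" using c unfolding can_step_def by blast
  then have "can_reducible ?H" using can_reducible_step[OF G red] by blast
  moreover have "logged (arrs ?s) (regs s ''k'') G H \<longleftrightarrow> logged (arrs s) (regs s ''k'') G H"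
    by (rule logged_cong) (auto simp: R)
  then have "logged (arrs ?s) (regs ?s ''k'') G ?H"
    using log c unfolding R(13) by (auto simp: R)
  moreover have "stack ?s = stack s \<union> {regs s ''y'', regs s ''a'', regs s ''b''}"
    by (rule stack_push3[OF R(5) refl R(14)])
  then have "stack ?s \<subseteq> {..<n}" "covered ?H (stack ?s)"
    using st covered_redA[OF st(2) c] confA_verts[OF G c] adjrep_verts[OF rep] by auto
  ultimately have "core n G ?H ?s" using n R(16) by (simp add: core_def)
  then show ?thesis using R(14,15) card_can_step[OF G step] unfolding progress_def by blast
qed

lemma progress_B:
  assumes core: "core n G H s" and c: "confB H (regs s ''y'') (regs s ''p'') (regs s ''q'') (regs s ''s'')"
    and cubic: "arrs s ''en'' (regs s ''y'') = arrs s ''off'' (regs s ''y'') + 3" "i < 3" "j < 3" "k < 3"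
    and ijk: "arrs s ''he'' (arrs s ''off'' (regs s ''y'') + i) = regs s ''p''" "arrs s ''he'' (arrs s ''off'' (regs s ''y'') + j) = regs s ''q''"
      "arrs s ''he'' (arrs s ''off'' (regs s ''y'') + k) = regs s ''s''"
  shows "progress n G H (regs s ''t'') (run (do_B i j k) s)"
proof -
  let ?s = "run (do_B i j k) s"
  note R = run_do_B[of i j k s]
  have rep: "represents n H s"
    and log: "logged (arrs s) (regs s ''k'') G H" and red: "can_reducible H" and n: "regs s ''n'' = n"
    and st: "stack s \<subseteq> {..<n}" "covered H (stack s)"
    using core by (auto simp: core_def)
  note G = adjrep_simple[OF rep]
  let ?H = "redB H (regs s ''y'') (regs s ''p'') (regs s ''q'')"
  have y: "regs s ''y'' < n" using confB_verts[OF G c] adjrep_verts[OF rep] by auto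
  have z: "arrs s ''off'' (regs s ''y'') + l \<in> {arrs s ''off'' (regs s ''y'')..<arrs s ''en'' (regs s ''y'')}"
    if "l < 3" for l using cubic that by auto
  note T = adjrep_twin[OF rep y z]
  note T1 = T[OF cubic(2), unfolded ijk] and T2 = T[OF cubic(3), unfolded ijk] and T3 = T[OF cubic(4), unfolded ijk]
  have "represents n ?H ?s"
    unfolding R by (rule adjrep_redB[OF rep c T1 T2 T3 refl])
  moreover have step: "can_step H ?H" using c unfolding can_step_def by blast
  then have "can_reducible ?H" using can_reducible_step[OF G red] by blast
  moreover have "logged (arrs ?s) (regs s ''k'') G H \<longleftrightarrow> logged (arrs s) (regs s ''k'') G H"
    by (rule logged_cong) (use R(11,12) in \<open>auto simp: R(1-10)\<close>)
  then have "logged (arrs ?s) (regs ?s ''k'') G ?H"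
    using log c unfolding R(13) by (auto simp: R(1-10))
  moreover have "stack ?s = stack s \<union> {regs s ''p'', regs s ''q'', regs s ''s''}"
    by (rule stack_push3[OF R(5) refl R(14)])
  then have "stack ?s \<subseteq> {..<n}" "covered ?H (stack ?s)"
    using st covered_redB[OF st(2) c] confB_verts[OF G c] adjrep_verts[OF rep] by auto
  ultimately have "core n G ?H ?s" using n R(16) by (simp add: core_def)
  then show ?thesis using R(14,15) card_can_step[OF G step] unfolding progress_def by blast
qed

section \<open>Testing for a reduction pattern\<close>

lemma cubic_val: "bexp_val (cubic e) s \<longleftrightarrow> arrs s ''en'' (exp_val e s) = arrs s ''off'' (exp_val e s) + 3"
  by (simp add: cubic_def eval_nat_numeral eq_commute)

lemma adjacent_val:
  assumes rep: "represents n H s"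
    and "exp_val e s < n" "arrs s ''en'' (exp_val e s) = arrs s ''off'' (exp_val e s) + 3"
  shows "bexp_val (adjacent e f) s \<longleftrightarrow> exp_val f s \<in> nbrs H (exp_val e s)"
  unfolding adjrep_nbrs3(1)[OF rep assms(2,3)] adjacent_def
  by (auto simp: eval_nat_numeral)

lemma find_outer_run:
  assumes "r \<noteq> f" "r \<noteq> g"
    and distinct: "distinct [he off, he (Suc off), he (Suc (Suc off))]"
    and eq: "{he off, he (Suc off), he (Suc (Suc off))} = {regs s f, regs s g, a}" "a \<noteq> regs s f" "a \<noteq> regs s g"
    and he: "he = arrs s ''he''" and off: "off = arrs s ''off'' (regs s v)"
  obtains d where "run (find_outer r (Reg v) (Reg f) (Reg g)) s = s\<lparr>regs := (regs s)(r := d)\<rparr>"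
    "off \<le> d" "d < off + 3" "he d = a"
proof -
  have a: "a \<in> {he off, he (Suc off), he (Suc (Suc off))}" unfolding eq(1) by simp
  have m: "he x = regs s f \<or> he x = regs s g \<longleftrightarrow> he x \<noteq> a" if "x \<in> {off, Suc off, Suc (Suc off)}" for x
  proof -
    have "he x \<in> {regs s f, regs s g, a}" unfolding eq(1)[symmetric] using that by blast
    then show ?thesis using eq(2,3) by auto
  qed
  define d where "d = (if he off = a then off else if he (Suc off) = a then Suc off else Suc (Suc off))"
  have "run (find_outer r (Reg v) (Reg f) (Reg g)) s = s\<lparr>regs := (regs s)(r := d)\<rparr>"
  proof -
    let ?P = "\<lambda>x. he x = regs s f \<or> he x = regs s g"
    have "run (find_outer r (Reg v) (Reg f) (Reg g)) s =
      (let x = off; x = (if ?P x then Suc x else x) in s\<lparr>regs := (regs s)(r := if ?P x then Suc x else x)\<rparr>)"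
      using assms(1,2) by (simp add: find_outer_def Let_def he off)
    moreover have "?P off \<longleftrightarrow> he off \<noteq> a" "?P (Suc off) \<longleftrightarrow> he (Suc off) \<noteq> a" using m by blast+
    ultimately show ?thesis unfolding d_def Let_def by (simp only: if_not_P split: if_split) simp
  qed
  moreover have "off \<le> d" "d < off + 3" "he d = a" using a unfolding d_def by auto
  ultimately show thesis using that by blast
qed

text \<open>What a failed attempt preserves. \<open>y\<close> is included because the next attempt
  works at the same center.\<close>

definition quiet :: "store \<Rightarrow> store \<Rightarrow> bool" where
  "quiet s s' \<longleftrightarrow> arrs s' = arrs s \<and> (\<forall>r\<in>{''n'', ''t'', ''k'', ''x'', ''f'', ''y''}. regs s' r = regs s r)"

lemma core_quiet: "core n G H s \<Longrightarrow> quiet s s' \<Longrightarrow> core n G H s'"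
  unfolding core_def quiet_def stack_def by auto

text \<open>A failure has to certify that the pattern is absent, because a vertex may be popped only
  if no pattern is lost.\<close>

lemma attempt_spec:
  assumes core: "core n G H s" and y: "regs s ''y'' < n" and f: "regs s ''f'' = 0"
    and ijk: "{i, j, k} = {0, 1, 2}" and yc: "arrs s ''en'' (regs s ''y'') = arrs s ''off'' (regs s ''y'') + 3"
  defines "h \<equiv> \<lambda>l. arrs s ''he'' (arrs s ''off'' (regs s ''y'') + l)"
  shows "progress n G H (regs s ''t'') (run (attempt i j k) s) \<or> quiet s (run (attempt i j k) s) \<and>
     (\<forall>a b. \<not> confA H (regs s ''y'') (h i) (h j) (h k) a b) \<and> \<not> confB H (regs s ''y'') (h i) (h j) (h k)"
proof -
  have rep: "represents n H s"
    using core by (auto simp: core_def)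
  note G = adjrep_simple[OF rep]
  let ?y = "regs s ''y''"
  have ijk3: "i < 3" "j < 3" "k < 3" 
  proof -
    have "i \<in> {0, 1, 2}" "j \<in> {0, 1, 2}" "k \<in> {0, 1, 2}" unfolding ijk[symmetric] by auto
    then show "i < 3" "j < 3" "k < 3" by auto
  qed
  have neq: "i \<noteq> j" "i \<noteq> k" "j \<noteq> k"
  proof -
    have "card {i, j, k} = 3" unfolding ijk by simp
    then show "i \<noteq> j" "i \<noteq> k" "j \<noteq> k" by (auto simp: card_insert_if split: if_splits)
  qed
  have inj: "h l = h m \<longleftrightarrow> l = m" if "l < 3" "m < 3" for l m
    using inj_on_eq_iff[OF adjrep_inj[OF rep y], of "arrs s ''off'' ?y + l" "arrs s ''off'' ?y + m"] that yc
    unfolding h_def by auto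
  have nb: "nbrs H ?y = {h i, h j, h k}"
  proof -
    have "nbrs H ?y = h ` {0, 1, 2}" using adjrep_nbrs3(1)[OF rep y yc] by (auto simp: h_def numeral_2_eq_2)
    then show ?thesis unfolding ijk[symmetric] by auto
  qed
  have ny: "?y \<notin> nbrs H ?y" using nbrs_irrefl[OF G] .
  have dist: "distinct [?y, h i, h j, h k]" using neq inj ijk3 ny nb by auto
  have less: "h i < n" "h j < n" "h k < n" using adjrep_nbr_less(1)[OF rep, of _ ?y] nb by auto
  define s1 where "s1 = s\<lparr>regs := (regs s)(''p'' := h i, ''q'' := h j, ''s'' := h k)\<rparr>"
  have q1: "quiet s s1" by (simp add: quiet_def s1_def)
  have c1: "core n G H s1" using core_quiet[OF core q1] .
  have A1: "arrs s1 = arrs s" and R1: "regs s1 ''y'' = ?y" "regs s1 ''p'' = h i" "regs s1 ''q'' = h j" "regs s1 ''s'' = h k"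
    "regs s1 ''t'' = regs s ''t''" by (simp_all add: s1_def)
  have rep1: "represents n H s1" using rep A1 by simp
  let ?deg = "\<lambda>v. arrs s ''en'' v = arrs s ''off'' v + 3"
  have run: "run (attempt i j k) s = run (try_pair i j k) s1"
    unfolding attempt_def using f yc by (simp add: cubic_val s1_def h_def)
  have degA: "?deg (h i) \<and> ?deg (h j)" if "confA H ?y (h i) (h j) (h k) a b" for a b
    using that adjrep_deg3[OF rep less(1)] adjrep_deg3[OF rep less(2)] by (auto simp: confA_def)
  have degB: "?deg (h i) \<and> ?deg (h j)" if "confB H ?y (h i) (h j) (h k)"
    using that adjrep_deg3[OF rep less(1)] adjrep_deg3[OF rep less(2)] by (auto simp: confB_def)
  show ?thesis
  proof (cases "?deg (h i) \<and> ?deg (h j)")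
    case False
    then have "run (try_pair i j k) s1 = s1" by (auto simp: try_pair_def cubic_val A1 R1)
    then show ?thesis using q1 run degA degB False by auto
  next
    case deg: True
    note adj = adjacent_val[OF rep1]
    show ?thesis
    proof (cases "h j \<in> nbrs H (h i)")
      case True
      have sym: "h i \<in> nbrs H (h j)" "?y \<in> nbrs H (h i)" "?y \<in> nbrs H (h j)"
        using True nb nbrs_sym[of "h i" H] nbrs_sym[of ?y H] by auto
      have third: "\<exists>a. nbrs H u = {?y, w, a} \<and> a \<notin> {?y, u, w}"
        if "card (nbrs H u) = 3" "?y \<in> nbrs H u" "w \<in> nbrs H u" "?y \<noteq> w" for u w
      proof -
        have "card (nbrs H u - {?y, w}) = 1" using that by (subst card_Diff_subset) auto
        then obtain c where c: "nbrs H u - {?y, w} = {c}" using card_1_singletonE by blast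
        moreover have "u \<notin> nbrs H u" using nbrs_irrefl[OF G] .
        ultimately show ?thesis using that by (intro exI[of _ c]) blast
      qed
      have c3: "card (nbrs H (h i)) = 3" "card (nbrs H (h j)) = 3"
        using adjrep_deg3[OF rep less(1)] adjrep_deg3[OF rep less(2)] deg by auto
      obtain a where a: "nbrs H (h i) = {?y, h j, a}" "a \<notin> {?y, h i, h j}"
        using third[OF c3(1) sym(2) True] dist by auto
      obtain b where b: "nbrs H (h j) = {?y, h i, b}" "b \<notin> {?y, h i, h j}"
        using third[OF c3(2) sym(3) sym(1)] dist by auto
      note N1 = adjrep_nbrs3[OF rep less(1) conjunct1[OF deg]]
      note N2 = adjrep_nbrs3[OF rep less(2) conjunct2[OF deg]]
      obtain d where d: "run (find_outer ''i'' (Reg ''p'') (Reg ''y'') (Reg ''q'')) s1 = s1\<lparr>regs := (regs s1)(''i'' := d)\<rparr>"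
        "arrs s ''off'' (h i) \<le> d" "d < arrs s ''off'' (h i) + 3" "arrs s ''he'' d = a"
        by (rule find_outer_run[of "''i''" "''y''" "''q''" "arrs s ''he''" "arrs s ''off'' (h i)" s1 a "''p''"])
          (use N1 a A1 R1 in auto)
      define s2 where "s2 = s1\<lparr>regs := (regs s1)(''i'' := d)\<rparr>"
      obtain e where e: "run (find_outer ''j'' (Reg ''q'') (Reg ''y'') (Reg ''p'')) s2 = s2\<lparr>regs := (regs s2)(''j'' := e)\<rparr>"
        "arrs s ''off'' (h j) \<le> e" "e < arrs s ''off'' (h j) + 3" "arrs s ''he'' e = b"
        by (rule find_outer_run[of "''j''" "''y''" "''p''" "arrs s ''he''" "arrs s ''off'' (h j)" s2 b "''q''"])
          (use N2 b A1 R1 in \<open>auto simp: s2_def\<close>)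
      define s3 where "s3 = s2\<lparr>regs := (regs s2)(''j'' := e, ''a'' := a, ''b'' := b)\<rparr>"
      have A3: "arrs s3 = arrs s" and R3: "regs s3 ''y'' = ?y" "regs s3 ''p'' = h i" "regs s3 ''q'' = h j" "regs s3 ''s'' = h k"
        "regs s3 ''t'' = regs s ''t''" "regs s3 ''a'' = a" "regs s3 ''b'' = b" "regs s3 ''i'' = d" "regs s3 ''j'' = e"
        by (simp_all add: s3_def s2_def s1_def)
      have q3: "quiet s s3" by (simp add: quiet_def s3_def s2_def s1_def)
      define fin where "fin = If (Or (Eq (Reg ''a'') (Reg ''b'')) (Or (Eq (Reg ''a'') (Reg ''s'')) (Eq (Reg ''b'') (Reg ''s''))))
                 Skip (do_A i j)"
      have A2: "arrs s2 = arrs s" "regs s2 ''i'' = d" by (simp_all add: s2_def A1)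
      have "run (try_pair i j k) s1 = run (try_triangle i j) s1"
        using deg True adj[of "Reg ''p''" "Reg ''q''"] less by (simp add: try_pair_def cubic_val A1 R1)
      also have "\<dots> = run fin s3"
        unfolding try_triangle_def fin_def[symmetric]
        using d(1)[folded s2_def] e(1) d(4) e(4) A2 by (simp add: s3_def)
      finally have "run (try_pair i j k) s1 = run fin s3" .
      then have run3: "run (try_pair i j k) s1 = (if a = b \<or> a = h k \<or> b = h k then s3 else run (do_A i j) s3)" by (simp add: fin_def R3)
      \<comment> \<open>The outside neighbours are determined by \<open>y\<close> and the slots, so
        one failed comparison refutes every choice of them.\<close>
      have uniq: "a' = a \<and> b' = b" if "confA H ?y (h i) (h j) (h k) a' b'" for a' b'
      proof -
        have "a' \<in> nbrs H (h i)" "b' \<in> nbrs H (h j)" using that unfolding confA_def by blast+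
        then have "a' \<in> {?y, h j, a}" "b' \<in> {?y, h i, b}" using a b by simp_all
        moreover have "distinct [?y, h i, h j, h k, a', b']" using that by (simp add: confA_def)
        ultimately show ?thesis by auto
      qed
      show ?thesis
      proof (cases "a = b \<or> a = h k \<or> b = h k")
        case True
        have "\<not> confA H ?y (h i) (h j) (h k) a' b'" for a' b' using uniq[of a' b'] True by (auto simp: confA_def)
        moreover have "\<not> confB H ?y (h i) (h j) (h k)" using \<open>h j \<in> nbrs H (h i)\<close> by (simp add: confB_def)
        ultimately show ?thesis using run run3 True q3 by simp
      next
        case False
        have conf: "confA H ?y (h i) (h j) (h k) a b" using dist a b False nb by (auto simp: confA_def)
        have "progress n G H (regs s3 ''t'') (run (do_A i j) s3)"
          by (rule progress_A[OF core_quiet[OF core q3]])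
            (use conf yc ijk3 d e deg in \<open>simp_all add: R3 A3 h_def\<close>)
        then show ?thesis using run run3 False R3 by simp
      qed
    next
      case False
      then have nA: "\<not> confA H ?y (h i) (h j) (h k) a b" for a b by (auto simp: confA_def)
      have run3: "run (try_pair i j k) s1 = (if h k \<in> nbrs H (h i) \<and> h k \<in> nbrs H (h j) then run (do_B i j k) s1 else s1)"
        using deg False adj[of "Reg ''p''"] adj[of "Reg ''q''"] less
        by (simp add: try_pair_def try_path_def cubic_val A1 R1)
      show ?thesis
      proof (cases "h k \<in> nbrs H (h i) \<and> h k \<in> nbrs H (h j)")
        case True
        then have "confB H ?y (h i) (h j) (h k)"
          using dist nb False adjrep_deg3[OF rep less(1)] adjrep_deg3[OF rep less(2)] deg by (auto simp: confB_def)
        then have "progress n G H (regs s1 ''t'') (run (do_B i j k) s1)"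
          by (intro progress_B[OF c1]) (use yc ijk3 in \<open>simp_all add: R1 A1 h_def\<close>)
        then show ?thesis using run run3 True R1 by simp
      next
        case F: False
        then have "\<not> confB H ?y (h i) (h j) (h k)" by (auto simp: confB_def)
        then show ?thesis using run run3 F nA q1 by simp
      qed
    qed
  qed
qed

definition no_center :: "nat graph \<Rightarrow> nat \<Rightarrow> bool" where
  "no_center H y \<longleftrightarrow> (\<forall>u w s a b. \<not> confA H y u w s a b) \<and> (\<forall>u w s. \<not> confB H y u w s)"

text \<open>Weaker than \<open>quiet\<close> in that \<open>y\<close> may change, as it does from
  one center to the next.\<close>

definition still :: "store \<Rightarrow> store \<Rightarrow> bool" where
  "still s s' \<longleftrightarrow> arrs s' = arrs s \<and> (\<forall>r\<in>{''n'', ''t'', ''k'', ''x'', ''f''}. regs s' r = regs s r)"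

definition outcome :: "nat \<Rightarrow> nat graph \<Rightarrow> nat graph \<Rightarrow> store \<Rightarrow> nat set \<Rightarrow> store \<Rightarrow> bool" where
  "outcome n G H s F s' \<longleftrightarrow> progress n G H (regs s ''t'') s' \<or> still s s' \<and> (\<forall>y\<in>F. no_center H y)"

lemma run_attempt_idle:
  assumes "regs s ''f'' \<noteq> 0 \<or> arrs s ''en'' (regs s ''y'') \<noteq> arrs s ''off'' (regs s ''y'') + 3"
  shows "run (attempt i j k) s = s"
proof -
  have "\<not> bexp_val (And (Eq (Reg ''f'') (Const 0)) (cubic (Reg ''y''))) s"
    using assms by (simp add: cubic_val)
  then show ?thesis unfolding attempt_def by (simp only: run.simps if_False)
qed

lemma progress_set_y:
  assumes "progress n G H t s"
  shows "progress n G H t (s\<lparr>regs := (regs s)(''y'' := v)\<rparr>)"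
proof -
  have "core n G K (s\<lparr>regs := (regs s)(''y'' := v)\<rparr>) \<longleftrightarrow> core n G K s" for K
    by (simp add: core_def stack_def)
  then show ?thesis using assms by (simp add: progress_def)
qed

lemma confA_card:
  assumes "confA G y u w s a b"
  shows "card (nbrs G y) = 3" "card (nbrs G u) = 3" "card (nbrs G w) = 3"
  using assms by (simp_all add: confA_def)

lemma confB_card:
  assumes "confB G y u w s"
  shows "card (nbrs G y) = 3" "card (nbrs G u) = 3" "card (nbrs G w) = 3"
  using assms by (simp_all add: confB_def)

lemma no_center_cubic:
  assumes rep: "adjrep n off en he tw H" and y: "y < n" and "\<not> en y = off y + 3"
  shows "no_center H y"
proof -
  have "card (nbrs H y) \<noteq> 3" using adjrep_deg3[OF rep y] assms(3) by simp
  then show ?thesis using confA_card(1) confB_card(1) unfolding no_center_def by metis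
qed

lemma no_center_three:
  assumes nb: "nbrs H y = {a, b, c}"
    and "\<And>e f. \<not> confA H y a b c e f" "\<not> confB H y a b c"
    and "\<And>e f. \<not> confA H y a c b e f" "\<not> confB H y a c b"
    and "\<And>e f. \<not> confA H y b c a e f" "\<not> confB H y b c a"
  shows "no_center H y"
proof -
  have perm: "(u, w, s) \<in> {(a, b, c), (b, a, c), (a, c, b), (c, a, b), (b, c, a), (c, b, a)}"
    if "nbrs H y = {u, w, s}" "distinct [u, w, s]" for u w s
  proof -
    have "u \<in> {a, b, c}" "w \<in> {a, b, c}" "s \<in> {a, b, c}" using that nb by auto
    then show ?thesis using that(2) by auto
  qed
  have "\<not> confA H y u w s e f" for u w s e f
  proof
    assume c: "confA H y u w s e f"
    then have "nbrs H y = {u, w, s}" "distinct [u, w, s]" by (simp_all add: confA_def)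
    from perm[OF this] show False using c confA_swap[OF c] assms by auto
  qed
  moreover have "\<not> confB H y u w s" for u w s
  proof
    assume c: "confB H y u w s"
    then have "nbrs H y = {u, w, s}" "distinct [u, w, s]" by (simp_all add: confB_def)
    from perm[OF this] show False using c confB_swap[OF c] assms by auto
  qed
  ultimately show ?thesis by (simp add: no_center_def)
qed

lemma core_still: "core n G H s \<Longrightarrow> still s s' \<Longrightarrow> core n G H s'"
  unfolding core_def still_def stack_def by auto

text \<open>The value of \<open>e\<close> is known only as long as nothing has changed: after a
  reduction the expression may read other entries, but then the attempts do nothing.\<close>

lemma center_spec:
  assumes core: "core n G H s" and f: "regs s ''f'' = 0" and out: "outcome n G H s F s'"
    and v: "v < n" "still s s' \<Longrightarrow> exp_val e s' = v"
  shows "outcome n G H s (insert v F) (run (center e) s')"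
proof -
  let ?s = "s'\<lparr>regs := (regs s')(''y'' := exp_val e s')\<rparr>"
  let ?s1 = "run (attempt 0 1 2) ?s"
  let ?s2 = "run (attempt 0 2 1) ?s1"
  have run: "run (center e) s' = run (attempt 1 2 0) ?s2"
    unfolding center_def by simp
  have idle: "run (attempt i j k) t = t" if "progress n G H l t" for i j k l t
    using that by (intro run_attempt_idle) (simp add: progress_def)
  show ?thesis
  proof (cases "progress n G H (regs s ''t'') s'")
    case True
    then have "progress n G H (regs s ''t'') ?s" by (rule progress_set_y)
    then show ?thesis using run idle unfolding outcome_def by simp
  next
    case False
    then have still: "still s s'" and F: "\<forall>y\<in>F. no_center H y" using out by (auto simp: outcome_def)
    have e: "exp_val e s' = v" using v(2)[OF still] .
    have st: "still s ?s" using still by (simp add: still_def)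
    have c0: "core n G H ?s" using core_still[OF core st] .
    have y0: "regs ?s ''y'' = v" using e by simp
    have t0: "regs ?s ''t'' = regs s ''t''" "regs ?s ''f'' = 0" using st f by (auto simp: still_def)
    have rep: "represents n H ?s"
      using c0 by (auto simp: core_def)
    show ?thesis
    proof (cases "arrs ?s ''en'' v = arrs ?s ''off'' v + 3")
      case False
      then have "run (attempt i j k) ?s = ?s" for i j k
        using y0 by (intro run_attempt_idle) simp
      then have "run (center e) s' = ?s" using run by simp
      then show ?thesis using st F no_center_cubic[OF rep v(1) False] by (simp add: outcome_def)
    next
      case cubic: True
      define h where "h = (\<lambda>l. arrs ?s ''he'' (arrs ?s ''off'' v + l))"
      have att: "progress n G H (regs s ''t'') (run (attempt i j k) t) \<or> quiet ?s (run (attempt i j k) t) \<and>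
          (\<forall>a b. \<not> confA H v (h i) (h j) (h k) a b) \<and> \<not> confB H v (h i) (h j) (h k)"
        if q: "quiet ?s t" and ijk: "{i, j, k} = {0, 1, 2}" for t i j k
      proof -
        have r: "regs t ''y'' = v" "regs t ''f'' = 0" "regs t ''t'' = regs s ''t''" "arrs t = arrs ?s"
          using q t0 y0 by (auto simp: quiet_def)
        have "quiet ?s t'" if "quiet t t'" for t' using q that by (auto simp: quiet_def)
        then show ?thesis
          using attempt_spec[OF core_quiet[OF c0 q] _ r(2) ijk] v(1) cubic unfolding r h_def by auto
      qed
      have q0: "quiet ?s ?s" by (simp add: quiet_def)
      have three: "outcome n G H s (insert v F) (run (attempt 1 2 0) ?s2) \<or>
        quiet ?s (run (attempt 1 2 0) ?s2) \<and> no_center H v"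
      proof (cases "progress n G H (regs s ''t'') ?s1")
        case True
        then show ?thesis using idle unfolding outcome_def by simp
      next
        case False
        then have a1: "quiet ?s ?s1" "\<And>a b. \<not> confA H v (h 0) (h 1) (h 2) a b" "\<not> confB H v (h 0) (h 1) (h 2)"
          using att[OF q0, of 0 1 2] by auto
        show ?thesis
        proof (cases "progress n G H (regs s ''t'') ?s2")
          case True
          then show ?thesis using idle unfolding outcome_def by simp
        next
          case False
          then have a2: "quiet ?s ?s2" "\<And>a b. \<not> confA H v (h 0) (h 2) (h 1) a b" "\<not> confB H v (h 0) (h 2) (h 1)"
            using att[OF a1(1), of 0 2 1] by auto
          have "{1, 2, 0} = {0, 1, 2 :: nat}" by auto
          from att[OF a2(1) this] show ?thesis
          proof
            assume "progress n G H (regs s ''t'') (run (attempt 1 2 0) ?s2)"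
            then show ?thesis by (simp add: outcome_def)
          next
            assume a3: "quiet ?s (run (attempt 1 2 0) ?s2) \<and>
              (\<forall>a b. \<not> confA H v (h 1) (h 2) (h 0) a b) \<and> \<not> confB H v (h 1) (h 2) (h 0)"
            have "nbrs H v = {h 0, h 1, h 2}"
              using adjrep_nbrs3(1)[OF rep v(1) cubic] by (simp add: h_def numeral_2_eq_2)
            then show ?thesis using no_center_three a1 a2 a3 by blast
          qed
        qed
      qed
      then show ?thesis
      proof
        assume "quiet ?s (run (attempt 1 2 0) ?s2) \<and> no_center H v"
        moreover have "still s t" if "quiet ?s t" for t using st that by (auto simp: quiet_def still_def)
        ultimately show ?thesis using run F unfolding outcome_def by auto
      qed (simp add: run)
    qed
  qed
qed

text \<open>If the popped \<open>x\<close> lies in a triangle, a rotation makes \<open>x\<close> its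
  center. If it lies on a path, the middle is \<open>x\<close> or a neighbour of \<open>x\<close>.
  Either way an examined center would have shown the pattern.\<close>

lemma covered_pop:
  assumes G: "simple_graph H" and cov: "covered H S" and sub: "S \<subseteq> insert x S'"
    and nc: "card (nbrs H x) = 3 \<Longrightarrow> \<forall>y\<in>insert x (nbrs H x). no_center H y"
  shows "covered H S'"
  unfolding covered_def
proof (intro conjI allI impI notI)
  fix y u w s a b assume c: "confA H y u w s a b" and i: "{y, u, w} \<inter> S' = {}"
  then have "{y, u, w} \<inter> S \<noteq> {}" using cov unfolding covered_def by blast
  then have x: "x \<in> {y, u, w}" using i sub by blast
  then have "card (nbrs H x) = 3" using confA_card[OF c] by blast
  then have "no_center H x" using nc by simp
  then show False using x c confA_rot[OF c] confA_rot2[OF c] unfolding no_center_def by blast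
next
  fix y u w s assume c: "confB H y u w s" and i: "{y, u, w} \<inter> S' = {}"
  then have "{y, u, w} \<inter> S \<noteq> {}" using cov unfolding covered_def by blast
  then have x: "x \<in> {y, u, w}" using i sub by blast
  then have "card (nbrs H x) = 3" using confB_card[OF c] by blast
  moreover have "y \<in> insert x (nbrs H x)" using x c nbrs_sym[of y H x] by (auto simp: confB_def)
  ultimately have "no_center H y" using nc by blast
  then show False using c unfolding no_center_def by blast
qed

lemma reduce_body_spec:
  assumes core: "core n G H s" and t: "0 < regs s ''t''"
  shows "\<exists>H'. core n G H' (run reduce_body s) \<and>
    4 * card (verts H') + regs (run reduce_body s) ''t'' < 4 * card (verts H) + regs s ''t''"
proof -
  define x where "x = arrs s ''st'' (regs s ''t'' - 1)"
  define s1 where "s1 = s\<lparr>regs := (regs s)(''x'' := x, ''f'' := 0)\<rparr>"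
  define s2 where "s2 = run (If (cubic (Reg ''x''))
        (seqs [center (Reg ''x''), center (nbr 0 (Reg ''x'')), center (nbr 1 (Reg ''x'')), center (nbr 2 (Reg ''x''))])
        Skip) s1"
  have run: "run reduce_body s = (if regs s2 ''f'' = 0 then s2\<lparr>regs := (regs s2)(''t'' := regs s2 ''t'' - 1)\<rparr> else s2)"
    unfolding reduce_body_def s2_def s1_def x_def by (simp del: seqs.simps(2) add: seqs.simps(2)[of "Assign _ _"]
       seqs.simps(2)[of "If _ _ Skip"])
  have c1: "core n G H s1" using core by (simp add: core_def s1_def stack_def)
  have f1: "regs s1 ''f'' = 0" "regs s1 ''x'' = x" "regs s1 ''t'' = regs s ''t''" by (simp_all add: s1_def)
  have rep: "represents n H s1"
    using c1 by (auto simp: core_def)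
  have "x \<in> stack s" unfolding x_def stack_def using t by auto
  then have x: "x < n" using core by (auto simp: core_def)
  have o1: "outcome n G H s1 {} s1" by (simp add: outcome_def still_def)
  have o2: "outcome n G H s1 (if card (nbrs H x) = 3 then insert x (nbrs H x) else {}) s2"
  proof (cases "arrs s1 ''en'' x = arrs s1 ''off'' x + 3")
    case False
    then have "s2 = s1" using f1 by (simp add: s2_def cubic_val)
    then show ?thesis using o1 False adjrep_deg3[OF rep x] by simp
  next
    case True
    let ?h = "\<lambda>i. arrs s1 ''he'' (arrs s1 ''off'' x + i)"
    have nb: "nbrs H x = {?h 0, ?h 1, ?h 2}" using adjrep_nbrs3(1)[OF rep x True] by (simp add: numeral_2_eq_2)
    then have less: "?h 0 < n" "?h 1 < n" "?h 2 < n" using adjrep_nbr_less(1)[OF rep, of _ x] by auto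
    note C = center_spec[OF c1 f1(1)]
    have vx: "exp_val (Reg ''x'') t = x" "exp_val (nbr i (Reg ''x'')) t = ?h i" if "still s1 t" for t i
      using that f1 by (simp_all add: still_def)
    have "outcome n G H s1 (insert (?h 2) (insert (?h 1) (insert (?h 0) (insert x {}))))
      (run (center (nbr 2 (Reg ''x''))) (run (center (nbr 1 (Reg ''x''))) (run (center (nbr 0 (Reg ''x'')))
        (run (center (Reg ''x'')) s1))))"
      by (intro C o1 x less vx)
    moreover have "s2 = run (center (nbr 2 (Reg ''x''))) (run (center (nbr 1 (Reg ''x''))) (run (center (nbr 0 (Reg ''x'')))
        (run (center (Reg ''x'')) s1)))"
      using True f1(2) unfolding s2_def by (simp add: cubic_val)
    moreover have "insert (?h 2) (insert (?h 1) (insert (?h 0) (insert x {}))) = insert x (nbrs H x)"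
      unfolding nb by auto
    ultimately show ?thesis using True adjrep_deg3[OF rep x] by simp
  qed
  show ?thesis
  proof (cases "progress n G H (regs s ''t'') s2")
    case True
    then have "run reduce_body s = s2" using run by (simp add: progress_def)
    moreover obtain H' where H': "core n G H' s2" "card (verts H') < card (verts H)" "regs s2 ''t'' = regs s ''t'' + 3"
      using True by (auto simp: progress_def)
    \<comment> \<open>At least one vertex of weight four is gone and exactly three entries were
      pushed.\<close>
    ultimately show ?thesis by (intro exI[of _ H']) auto
  next
    case False
    then have still: "still s1 s2" and nc: "card (nbrs H x) = 3 \<Longrightarrow> \<forall>y\<in>insert x (nbrs H x). no_center H y"
      using o2 f1(3) unfolding outcome_def by auto
    let ?s = "s2\<lparr>regs := (regs s2)(''t'' := regs s2 ''t'' - 1)\<rparr>"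
    have r: "run reduce_body s = ?s" using run still f1 by (simp add: still_def)
    have t2: "regs s2 ''t'' = regs s ''t''" using still f1 by (simp add: still_def)
    have c2: "core n G H s2" using core_still[OF c1 still] .
    have A2: "arrs s2 = arrs s" using still by (simp add: still_def s1_def)
    have "stack s2 \<subseteq> insert x (stack ?s)"
    proof
      fix z assume "z \<in> stack s2"
      then obtain i where i: "i < regs s ''t''" "z = arrs s ''st'' i" unfolding stack_def t2 A2 by auto
      show "z \<in> insert x (stack ?s)"
      proof (cases "i = regs s ''t'' - 1")
        case True
        then show ?thesis using i by (simp add: x_def)
      next
        case False
        then have "i < regs s ''t'' - 1" using i by simp
        then show ?thesis using i unfolding stack_def by (simp add: t2 A2)
      qed
    qed
    then have "covered H (stack ?s)"
      using covered_pop[OF adjrep_simple[OF rep] _ _ nc] c2 by (auto simp: core_def)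
    moreover have "stack ?s \<subseteq> stack s2" by (auto simp: stack_def)
    ultimately have "core n G H ?s" using c2 unfolding core_def by auto
    then show ?thesis using r t t2 by (intro exI[of _ H]) simp
  qed
qed

lemma loopfree_reduce_body: "loopfree reduce_body"
  by (simp add: reduce_body_def center_def attempt_def try_pair_def try_triangle_def
      try_path_def find_outer_def Let_def do_A_def do_B_def push_def log_step_def)

text \<open>With an empty stack, \<open>covered\<close> leaves no pattern at all. A reducible graph
  without steps can only be \<open>K4\<close>.\<close>

lemma core_end_K4:
  assumes "core n G H s" "regs s ''t'' = 0"
  shows "iso_graphs H K4"
proof -
  have "stack s = {}" using assms(2) by (simp add: stack_def)
  then have "\<not> can_step H K" for K using assms(1) unfolding core_def covered_def can_step_def by auto
  moreover have "simple_graph H" "can_reducible H" using assms(1) adjrep_simple unfolding core_def by blast+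
  ultimately show ?thesis using can_reducible_cases by blast
qed

section \<open>Linear time\<close>

text \<open>Bounds the measures of all loops: the reduction loop starts at four per vertex plus one
  stack entry per vertex, and a scan needs one round per vertex and dart. The final one makes the
  bounds strict.\<close>

definition input_size :: "nat list list \<Rightarrow> nat" where
  "input_size xs = 5 * length xs + length (concat xs) + 1"

definition linear :: "(nat graph \<Rightarrow> nat list list \<Rightarrow> store \<Rightarrow> bool) \<Rightarrow> prog \<Rightarrow>
    (nat graph \<Rightarrow> nat list list \<Rightarrow> store \<Rightarrow> bool) \<Rightarrow> bool" where
  "linear P c Q \<longleftrightarrow> (\<exists>K. \<forall>G xs s. P G xs s \<longrightarrow> terminates c s (K * input_size xs) (Q G xs))"

lemma linear_Seq: "linear P c Q \<Longrightarrow> linear Q d R \<Longrightarrow> linear P (Seq c d) R"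
  unfolding linear_def
proof (elim exE)
  fix K L
  assume K: "\<forall>G xs s. P G xs s \<longrightarrow> terminates c s (K * input_size xs) (Q G xs)"
    and L: "\<forall>G xs s. Q G xs s \<longrightarrow> terminates d s (L * input_size xs) (R G xs)"
  show "\<exists>K. \<forall>G xs s. P G xs s \<longrightarrow> terminates (Seq c d) s (K * input_size xs) (R G xs)"
  proof (intro exI allI impI)
    fix G xs s assume "P G xs s"
    then show "terminates (Seq c d) s ((K + L) * input_size xs) (R G xs)"
      unfolding distrib_right using terminates_Seq K L by blast
  qed
qed

lemma linear_run:
  assumes "loopfree c" "\<And>G xs s. P G xs s \<Longrightarrow> Q G xs (run c s)"
  shows "linear P c Q"
  unfolding linear_def
proof (intro exI allI impI)
  fix G xs s assume "P G xs s"
  then have "terminates c s (max_cost c) (Q G xs)" using terminates_run assms by blast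
  then show "terminates c s (max_cost c * input_size xs) (Q G xs)"
    by (rule terminates_mono) (simp_all add: input_size_def)
qed

lemma linear_While:
  assumes c: "loopfree c"
    and start: "\<And>G xs s. P G xs s \<Longrightarrow> \<exists>m<input_size xs. I G xs m s"
    and step: "\<And>G xs m s. I G xs m s \<Longrightarrow> bexp_val b s \<Longrightarrow> \<exists>m'<m. I G xs m' (run c s)"
    and exit: "\<And>G xs m s. I G xs m s \<Longrightarrow> \<not> bexp_val b s \<Longrightarrow> Q G xs s"
  shows "linear P (While b c) Q"
  unfolding linear_def
proof (intro exI allI impI)
  fix G xs s assume "P G xs s"
  then obtain m where m: "m < input_size xs" "I G xs m s" using start by blast
  have "terminates (While b c) s ((m + 1) * (max_cost c + bexp_cost b + 1)) (\<lambda>s. (\<exists>m. I G xs m s) \<and> \<not> bexp_val b s)"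
    by (rule terminates_While[where I = "I G xs", OF c m(2)]) (rule step)
  moreover have "(m + 1) * (max_cost c + bexp_cost b + 1) \<le> (max_cost c + bexp_cost b + 1) * input_size xs"
    using mult_le_mono1[of "m + 1" "input_size xs" "max_cost c + bexp_cost b + 1"] m(1) by (simp add: mult.commute)
  ultimately show "terminates (While b c) s ((max_cost c + bexp_cost b + 1) * input_size xs) (Q G xs)"
    by (rule terminates_mono) (use exit in blast)
qed

section \<open>The input layout and its size\<close>

definition problem :: "nat graph \<Rightarrow> nat list list \<Rightarrow> bool" where
  "problem G xs \<longleftrightarrow> simple_graph G \<and> D3_reducible G \<and> adjacency_lists G xs"

abbreviation offs :: "nat list list \<Rightarrow> nat \<Rightarrow> nat" where
  "offs xs \<equiv> arrs (input_store xs) ''off''"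

abbreviation adjs :: "nat list list \<Rightarrow> nat \<Rightarrow> nat" where
  "adjs xs \<equiv> arrs (input_store xs) ''adj''"

lemma offs_end: "offs xs (length xs) = length (concat xs)"
  by (simp add: input_store_def)

lemma problem_offsets:
  assumes "adjacency_lists G xs"
  shows "offsets (length xs) (offs xs) (adjs xs) G"
proof -
  have suc: "offs xs (Suc v) = offs xs v + length (xs ! v)" if "v < length xs" for v
    using that by (simp add: input_store_def take_Suc_conv_app_nth)
  have entry: "adjs xs (offs xs v + i) = xs ! v ! i" if v: "v < length xs" and i: "i < length (xs ! v)" for v i
  proof -
    have "concat xs = concat (take v xs) @ xs ! v @ concat (drop (Suc v) xs)"
      using id_take_nth_drop[OF v] by (metis concat.simps(2) concat_append)
    then show ?thesis using v i by (simp add: input_store_def nth_append)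
  qed
  have "inj_on (adjs xs) {offs xs v..<offs xs (Suc v)} \<and> adjs xs ` {offs xs v..<offs xs (Suc v)} = nbrs G v"
    if v: "v < length xs" for v
  proof -
    have I: "{offs xs v..<offs xs (Suc v)} = (+) (offs xs v) ` {..<length (xs ! v)}"
    proof (intro set_eqI iffI)
      fix x assume "x \<in> {offs xs v..<offs xs (Suc v)}"
      then show "x \<in> (+) (offs xs v) ` {..<length (xs ! v)}"
        unfolding suc[OF v] by (intro image_eqI[of _ _ "x - offs xs v"]) auto
    next
      fix x assume "x \<in> (+) (offs xs v) ` {..<length (xs ! v)}"
      then show "x \<in> {offs xs v..<offs xs (Suc v)}" unfolding suc[OF v] by auto
    qed
    have "distinct (xs ! v)" and nb: "set (xs ! v) = nbrs G v" using assms v by (simp_all add: adjacency_lists_def)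
    then have "inj_on (\<lambda>i. xs ! v ! i) {..<length (xs ! v)}" by (simp add: inj_on_nth)
    then have "inj_on (adjs xs) {offs xs v..<offs xs (Suc v)}"
      unfolding I inj_on_def using entry[OF v] by auto
    moreover have "adjs xs ` {offs xs v..<offs xs (Suc v)} = set (xs ! v)"
      unfolding I image_image using entry[OF v] by (auto simp: set_conv_nth)
    ultimately show ?thesis using nb by simp
  qed
  moreover have "offs xs 0 = 0" by (simp add: input_store_def)
  ultimately show ?thesis unfolding offsets_def using suc by simp
qed

lemma problem_verts: "problem G xs \<Longrightarrow> verts G = {..<length xs}"
  by (simp add: problem_def adjacency_lists_def)

lemma length_concat_le:
  assumes G: "simple_graph G" and a: "adjacency_lists G xs"
  shows "length (concat xs) \<le> 2 * card (edges G)"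
proof -
  let ?D = "SIGMA v:{..<length xs}. nbrs G v"
  have fin: "finite (edges G)"
    using G by (auto simp: simple_graph_def intro: finite_subset[of _ "Pow (verts G)"])
  have "length (concat xs) = (\<Sum>v<length xs. length (xs ! v))"
    by (simp add: length_concat sum_list_sum_nth atLeast0LessThan)
  also have "\<dots> = (\<Sum>v<length xs. card (nbrs G v))"
    using a by (intro sum.cong) (auto simp: adjacency_lists_def distinct_card[symmetric])
  also have "\<dots> = card ?D" using finite_nbrs[OF G] by simp
  also have "\<dots> \<le> card (edges G \<times> (UNIV :: bool set))"
  proof (rule card_inj_on_le)
    \<comment> \<open>An edge carries at most two darts; the comparison of its ends tells them
      apart.\<close>
    show "inj_on (\<lambda>(v, u). ({v, u}, v < u)) ?D"
      using nbrs_irrefl[OF G] by (auto simp: inj_on_def doubleton_eq_iff)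
    show "(\<lambda>(v, u). ({v, u}, v < u)) ` ?D \<subseteq> edges G \<times> UNIV" by (auto simp: in_nbrs)
    show "finite (edges G \<times> (UNIV :: bool set))" using fin by simp
  qed
  also have "\<dots> = 2 * card (edges G)" by (simp add: card_cartesian_product)
  finally show ?thesis .
qed

abbreviation initialised :: "nat graph \<Rightarrow> nat list list \<Rightarrow> store \<Rightarrow> bool" where
  "initialised G xs s \<equiv> problem G xs \<and> regs s ''n'' = length xs \<and> regs s ''t'' = length xs \<and> regs s ''u'' = 0 \<and> regs s ''d'' = 0 \<and>
       regs s ''k'' = 0 \<and> arrs s ''off'' = offs xs \<and> arrs s ''adj'' = adjs xs \<and>
       (\<forall>i<length xs. arrs s ''en'' i = offs xs i \<and> arrs s ''cq'' i = offs xs i \<and> arrs s ''st'' i = i)"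

abbreviation sorted_darts :: "nat graph \<Rightarrow> nat list list \<Rightarrow> store \<Rightarrow> bool" where
  "sorted_darts G xs s \<equiv> problem G xs \<and> regs s ''n'' = length xs \<and> regs s ''t'' = length xs \<and>
       regs s ''k'' = 0 \<and> arrs s ''off'' = offs xs \<and> offsets (length xs) (offs xs) (arrs s ''he'') G \<and>
       (\<forall>v<length xs. arrs s ''en'' v = offs xs (Suc v) \<and> strict_mono_on {offs xs v..<offs xs (Suc v)} (arrs s ''he'')) \<and>
       (\<forall>i<length xs. arrs s ''st'' i = i)"

section \<open>Linear running time of each phase\<close>

lemma init_linear:
  "linear (\<lambda>G xs s. problem G xs \<and> s = input_store xs) init_loop
    initialised"
  unfolding init_loop_def
proof (rule linear_While[where I = "\<lambda>G xs m s. problem G xs \<and> regs s ''n'' = length xs \<and> regs s ''t'' \<le> length xs \<and>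
       regs s ''u'' = 0 \<and> regs s ''d'' = 0 \<and> regs s ''k'' = 0 \<and> arrs s ''off'' = offs xs \<and> arrs s ''adj'' = adjs xs \<and>
       (\<forall>i<regs s ''t''. arrs s ''en'' i = offs xs i \<and> arrs s ''cq'' i = offs xs i \<and> arrs s ''st'' i = i) \<and>
       m = length xs - regs s ''t''"], goal_cases)
  case (2 G xs s)
  then show ?case by (intro exI[of _ "length xs"]) (simp add: input_size_def input_store_def)
next
  case (3 G xs m s)
  then show ?case by (intro exI[of _ "length xs - Suc (regs s ''t'')"]) (auto simp: less_Suc_eq)
qed auto

lemma transpose_linear:
  "linear initialised
    (dart_loop transpose_dart)
    (\<lambda>G xs s. sorted_darts G xs s \<and> (\<forall>i<length xs. arrs s ''cq'' i = offs xs i))"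
  unfolding dart_loop_def
proof (rule linear_While[where I = "\<lambda>G xs m s. problem G xs \<and> regs s ''n'' = length xs \<and> regs s ''t'' = length xs \<and>
       regs s ''k'' = 0 \<and> arrs s ''off'' = offs xs \<and> arrs s ''adj'' = adjs xs \<and>
       (\<forall>i<length xs. arrs s ''cq'' i = offs xs i \<and> arrs s ''st'' i = i) \<and>
       pass_position (length xs) (offs xs) (regs s ''u'') (regs s ''d'') \<and>
       transposed (length xs) (offs xs) (adjs xs) G (regs s ''u'') (regs s ''d'') (arrs s ''en'') (arrs s ''he'') \<and>
       m = pass_measure (length xs) (offs xs) (regs s ''u'') (regs s ''d'')"], goal_cases)
  case 1
  then show ?case by (simp add: transpose_dart_def)
next
  case (2 G xs s)
  then have off: "offsets (length xs) (offs xs) (adjs xs) G" and G: "simple_graph G"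
    using problem_offsets by (auto simp: problem_def)
  have "pass_measure (length xs) (offs xs) 0 0 < input_size xs"
    using offs_end[of xs] by (simp add: pass_measure_def input_size_def)
  then show ?case
    using 2 pass_position_start[OF off] transposed_start[OF G off, of "arrs s ''en''" "arrs s ''he''"] by auto
next
  case (3 G xs m s)
  then have off: "offsets (length xs) (offs xs) (adjs xs) G" and G: "simple_graph G"
    and V: "verts G \<subseteq> {..<length xs}"
    using problem_offsets problem_verts by (auto simp: problem_def)
  have pos: "pass_position (length xs) (offs xs) (regs s ''u'') (regs s ''d'')"
    and t: "transposed (length xs) (offs xs) (adjs xs) G (regs s ''u'') (regs s ''d'') (arrs s ''en'') (arrs s ''he'')"
    and u: "regs s ''u'' < length xs" and o: "arrs s ''off'' = offs xs" "arrs s ''adj'' = adjs xs" using 3 by simp_all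
  show ?case
  proof (cases "regs s ''d'' < offs xs (Suc (regs s ''u''))")
    case True
    have "offs xs (regs s ''u'') \<le> regs s ''d''" using pos by (simp add: pass_position_def)
    note T = transposed_dart[OF G V off t u this True]
    show ?thesis
      using 3 True T pass_position_dart[OF off pos u True] o
      by (intro exI[of _ "pass_measure (length xs) (offs xs) (regs s ''u'') (Suc (regs s ''d''))"])
         (simp add: transpose_dart_def)
  next
    case False
    note p = pass_position_vertex[OF off pos u False]
    have "transposed (length xs) (offs xs) (adjs xs) G (Suc (regs s ''u'')) (regs s ''d'') (arrs s ''en'') (arrs s ''he'')"
      using transposed_vertex[OF off _ u] t unfolding p(1) .
    then show ?thesis
      using 3 False p(2,3) o
      by (intro exI[of _ "pass_measure (length xs) (offs xs) (Suc (regs s ''u'')) (regs s ''d'')"]) simp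
  qed
next
  case (4 G xs m s)
  then have off: "offsets (length xs) (offs xs) (adjs xs) G" and G: "simple_graph G"
    and V: "verts G \<subseteq> {..<length xs}"
    using problem_offsets problem_verts by (auto simp: problem_def)
  have "regs s ''u'' = length xs" using 4 by (simp add: pass_position_def)
  then have "transposed (length xs) (offs xs) (adjs xs) G (length xs) (regs s ''d'') (arrs s ''en'') (arrs s ''he'')"
    using 4 by simp
  from transposed_end[OF G V off this] show ?case using 4 by simp
qed

lemma twin_linear:
  "linear (\<lambda>G xs s. sorted_darts G xs s \<and> regs s ''u'' = 0 \<and> regs s ''d'' = 0 \<and> (\<forall>i<length xs. arrs s ''cq'' i = offs xs i))
    (dart_loop twin_dart)
    (\<lambda>G xs s. problem G xs \<and> core (length xs) G G s \<and> regs s ''t'' = length xs)"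
  unfolding dart_loop_def
proof (rule linear_While[where I = "\<lambda>G xs m s. sorted_darts G xs s \<and>
       pass_position (length xs) (offs xs) (regs s ''u'') (regs s ''d'') \<and>
       twinned (length xs) (offs xs) (arrs s ''he'') G (regs s ''u'') (regs s ''d'') (arrs s ''cq'') (arrs s ''tw'') \<and>
       m = pass_measure (length xs) (offs xs) (regs s ''u'') (regs s ''d'')"], goal_cases)
  case 1
  then show ?case by (simp add: twin_dart_def)
next
  case (2 G xs s)
  then have off: "offsets (length xs) (offs xs) (arrs s ''he'') G" and G: "simple_graph G"
    by (auto simp: problem_def)
  have "pass_measure (length xs) (offs xs) 0 0 < input_size xs"
    using offs_end[of xs] by (simp add: pass_measure_def input_size_def)
  then show ?case
    using 2 pass_position_start[OF off] twinned_start[OF G off, of "arrs s ''cq''" "arrs s ''tw''"] by auto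
next
  case (3 G xs m s)
  then have off: "offsets (length xs) (offs xs) (arrs s ''he'') G" and G: "simple_graph G"
    and V: "verts G \<subseteq> {..<length xs}"
    using problem_verts by (auto simp: problem_def)
  have pos: "pass_position (length xs) (offs xs) (regs s ''u'') (regs s ''d'')"
    and t: "twinned (length xs) (offs xs) (arrs s ''he'') G (regs s ''u'') (regs s ''d'') (arrs s ''cq'') (arrs s ''tw'')"
    and u: "regs s ''u'' < length xs" and o: "arrs s ''off'' = offs xs" using 3 by simp_all
  have mono: "strict_mono_on {offs xs v..<offs xs (Suc v)} (arrs s ''he'')" if "v < length xs" for v using 3 that by blast
  show ?case
  proof (cases "regs s ''d'' < offs xs (Suc (regs s ''u''))")
    case True
    have "offs xs (regs s ''u'') \<le> regs s ''d''" using pos by (simp add: pass_position_def)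
    note T = twinned_dart[OF G V off mono t u this True]
    show ?thesis
      using 3 True T pass_position_dart[OF off pos u True] o
      by (intro exI[of _ "pass_measure (length xs) (offs xs) (regs s ''u'') (Suc (regs s ''d''))"])
         (simp add: twin_dart_def)
  next
    case False
    note p = pass_position_vertex[OF off pos u False]
    have "twinned (length xs) (offs xs) (arrs s ''he'') G (Suc (regs s ''u'')) (regs s ''d'') (arrs s ''cq'') (arrs s ''tw'')"
      using twinned_vertex[OF off _ u] t unfolding p(1) .
    then show ?thesis
      using 3 False p(2,3) o
      by (intro exI[of _ "pass_measure (length xs) (offs xs) (Suc (regs s ''u'')) (regs s ''d'')"]) simp
  qed
next
  case (4 G xs m s)
  then have off: "offsets (length xs) (offs xs) (arrs s ''he'') G" and G: "simple_graph G" "D3_reducible G"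
    and V: "verts G = {..<length xs}"
    using problem_verts by (auto simp: problem_def)
  have u: "regs s ''u'' = length xs" using 4 by (simp add: pass_position_def)
  have "adjrep (length xs) (offs xs) (arrs s ''en'') (arrs s ''he'') (arrs s ''tw'') G"
    by (rule twinned_adjrep[OF G(1) _ off, of _ "regs s ''d''" "arrs s ''cq''"]) (use 4 u V in auto)
  moreover have "stack s = {..<length xs}" using 4 by (auto simp: stack_def)
  moreover have "covered G {..<length xs}"
  proof -
    have "{y, u, w} \<inter> verts G \<noteq> {}" if "confA G y u w r a b" for y u w r a b
      using confA_verts[OF G(1) that] by simp
    moreover have "{y, u, w} \<inter> verts G \<noteq> {}" if "confB G y u w r" for y u w r
      using confB_verts[OF G(1) that] by simp
    ultimately show ?thesis unfolding covered_def V by (intro conjI allI impI)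
  qed
  ultimately have "core (length xs) G G s"
    using 4 D3_reducible_can_reducible[OF G] by (simp add: core_def)
  then show ?case using 4 by simp
qed

lemma reduce_linear:
  "linear (\<lambda>G xs s. problem G xs \<and> core (length xs) G G s \<and> regs s ''t'' = length xs)
    reduce_loop
    (\<lambda>G xs s. problem G xs \<and> (\<exists>H. core (length xs) G H s \<and> iso_graphs H K4))"
  unfolding reduce_loop_def
proof (rule linear_While[where I = "\<lambda>G xs m s. problem G xs \<and> (\<exists>H. core (length xs) G H s \<and>
      m = 4 * card (verts H) + regs s ''t'')"], goal_cases)
  case 1
  then show ?case by (rule loopfree_reduce_body)
next
  case (2 G xs s)
  then show ?case using problem_verts[of G xs]
    by (intro exI[of _ "5 * length xs"] conjI exI[of _ G]) (auto simp: input_size_def)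
next
  case (3 G xs m s)
  then show ?case using reduce_body_spec[of "length xs" G _ s] by fastforce
next
  case (4 G xs m s)
  then show ?case using core_end_K4[of "length xs" G _ s] by auto
qed

text \<open>The measure is the distance to some vertex of the remaining \<open>K4\<close>, whose
  list is not empty, so the search cannot run past it.\<close>

lemma alive_linear:
  "linear (\<lambda>G xs s. problem G xs \<and> (\<exists>H. core (length xs) G H s \<and> iso_graphs H K4) \<and> regs s ''v'' = 0)
    find_alive
    (\<lambda>G xs s. problem G xs \<and> (\<exists>H. core (length xs) G H s \<and> iso_graphs H K4 \<and>
       regs s ''v'' < length xs \<and> nbrs H (regs s ''v'') \<noteq> {}))"
  unfolding find_alive_def
proof (rule linear_While[where I = "\<lambda>G xs m s. problem G xs \<and> (\<exists>H v. core (length xs) G H s \<and> iso_graphs H K4 \<and>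
       regs s ''v'' \<le> v \<and> v < length xs \<and> arrs s ''off'' v \<noteq> arrs s ''en'' v \<and> m = v - regs s ''v'')"], goal_cases)
  case (2 G xs s)
  then obtain H where H: "core (length xs) G H s" "iso_graphs H K4" by blast
  then have rep: "represents (length xs) H s"
    by (simp add: core_def)
  note K = iso_K4[OF adjrep_simple[OF rep] H(2)]
  have "verts H \<noteq> {}" using K(1) by auto
  then obtain v where v: "v \<in> verts H" by blast
  have "card (nbrs H v) = 3" using K v by simp
  then have "arrs s ''off'' v \<noteq> arrs s ''en'' v" "v < length xs"
    using adjrep_card[OF rep] adjrep_verts[OF rep v] by auto
  then show ?case using 2 H by (intro exI[of _ v]) (auto simp: input_size_def)
next
  case (3 G xs m s)
  then obtain H v where H: "core (length xs) G H s" "iso_graphs H K4" 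
       "regs s ''v'' \<le> v" "v < length xs" "arrs s ''off'' v \<noteq> arrs s ''en'' v" "m = v - regs s ''v''" by blast
  have "regs s ''v'' \<noteq> v" using 3(2) H(5) by auto
  then have "v - Suc (regs s ''v'') < m" "Suc (regs s ''v'') \<le> v" using H by auto
  moreover have "core (length xs) G H (run (Assign ''v'' (Inc (Reg ''v''))) s)"
    using H(1) by (simp add: core_def stack_def)
  ultimately show ?case using 3(1) H by (intro exI[of _ "v - Suc (regs s ''v'')"]) auto
next
  case (4 G xs m s)
  then obtain H v where H: "core (length xs) G H s" "iso_graphs H K4" "regs s ''v'' \<le> v" "v < length xs" by blast
  then have rep: "represents (length xs) H s"
    by (simp add: core_def)
  have v: "regs s ''v'' < length xs" using H by simp
  have "arrs s ''off'' (regs s ''v'') < arrs s ''en'' (regs s ''v'')"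
    using 4(2) adjrep_bounds(1)[OF rep v] by simp
  then have "nbrs H (regs s ''v'') \<noteq> {}" using adjrep_image[OF rep v] by auto
  then show ?case using 4(1) H v by blast
qed simp

lemma logged_card:
  assumes "simple_graph G" "logged A k G H"
  shows "card (verts H) + k \<le> card (verts G)"
  using assms(2)
proof (induction k arbitrary: H)
  case (Suc k)
  from Suc.prems obtain K where K: "logged A k G K" "can_step K H"
    unfolding logged.simps can_step_def by blast
  then have "card (verts H) < card (verts K)" using card_can_step logged_simple assms(1) by blast
  then show ?case using Suc.IH[OF K(1)] by simp
qed simp

lemma base_linear:
  "linear (\<lambda>G xs s. problem G xs \<and> (\<exists>H. core (length xs) G H s \<and> iso_graphs H K4 \<and>
       regs s ''v'' < length xs \<and> nbrs H (regs s ''v'') \<noteq> {}))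
    base_cycle
    (\<lambda>G xs s. problem G xs \<and> regs s ''n'' = length xs \<and>
      (\<exists>H. logged (arrs s) (regs s ''k'') G H \<and> ham H (arrs s ''nx'')))"
proof (rule linear_run, goal_cases)
  case (2 G xs s)
  then obtain H where H: "core (length xs) G H s" "iso_graphs H K4"
    and v: "regs s ''v'' < length xs" "nbrs H (regs s ''v'') \<noteq> {}" by blast
  then have rep: "represents (length xs) H s"
    by (simp add: core_def)
  note G = adjrep_simple[OF rep]
  note K = iso_K4[OF G H(2)]
  have vH: "regs s ''v'' \<in> verts H" using nbrs_verts[OF G] v(2) by auto
  have "card (nbrs H (regs s ''v'')) = 3" using K vH by simp
  then have c: "arrs s ''en'' (regs s ''v'') = arrs s ''off'' (regs s ''v'') + 3" using adjrep_deg3[OF rep v(1)] by simp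
  define h where "h = (\<lambda>i. arrs s ''he'' (arrs s ''off'' (regs s ''v'') + i))"
  have nb: "nbrs H (regs s ''v'') = {h 0, h 1, h 2}" "distinct [h 0, h 1, h 2]"
    using adjrep_nbrs3[OF rep v(1) c] by (simp_all add: h_def numeral_2_eq_2)
  have V: "verts H = {regs s ''v'', h 0, h 1, h 2}" using K(2)[OF vH] vH nb by auto
  have d: "distinct [regs s ''v'', h 0, h 1, h 2]" using nb nbrs_irrefl[OF G, of "regs s ''v''"] by auto
  have nx: "arrs (run base_cycle s) ''nx'' = (arrs s ''nx'')(regs s ''v'' := h 0, h 0 := h 1, h 1 := h 2, h 2 := regs s ''v'')"
    by (simp add: base_cycle_def h_def)
  have "ham H (arrs (run base_cycle s) ''nx'')"
    unfolding nx by (rule ham_complete4[OF V d]) (use d V K(2) in auto)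
  moreover have "logged (arrs (run base_cycle s)) (regs (run base_cycle s) ''k'') G H"
  proof -
    have "logged (arrs (run base_cycle s)) (regs s ''k'') G H \<longleftrightarrow> logged (arrs s) (regs s ''k'') G H"
      by (rule logged_cong) (auto simp: base_cycle_def)
    then show ?thesis using H(1) by (simp add: core_def base_cycle_def)
  qed
  moreover have "regs (run base_cycle s) ''n'' = length xs" using H(1) by (simp add: core_def base_cycle_def)
  ultimately show ?case using 2 by blast
qed (simp add: base_cycle_def)

lemma undo_linear:
  "linear (\<lambda>G xs s. problem G xs \<and> regs s ''n'' = length xs \<and>
      (\<exists>H. logged (arrs s) (regs s ''k'') G H \<and> ham H (arrs s ''nx'')))
    undo_loop
    (\<lambda>G xs s. problem G xs \<and> regs s ''n'' = length xs \<and> ham G (arrs s ''nx''))"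
  unfolding undo_loop_def
proof (rule linear_While[where I = "\<lambda>G xs m s. problem G xs \<and> regs s ''n'' = length xs \<and>
      (\<exists>H. logged (arrs s) (regs s ''k'') G H \<and> ham H (arrs s ''nx'')) \<and> m = regs s ''k''"], goal_cases)
  case 1
  then show ?case by (simp add: undo_body_def undo_A_def undo_B_def)
next
  case (2 G xs s)
  then obtain H where "logged (arrs s) (regs s ''k'') G H" "simple_graph G" by (auto simp: problem_def)
  then have "regs s ''k'' \<le> card (verts G)" using logged_card[of G "arrs s" "regs s ''k''" H] by simp
  then show ?case using 2 problem_verts[of G xs] by (intro exI[of _ "regs s ''k''"]) (simp add: input_size_def)
next
  case (3 G xs m s)
  then obtain H where H: "logged (arrs s) (regs s ''k'') G H" "ham H (arrs s ''nx'')" by blast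
  have G: "simple_graph G" using 3 by (simp add: problem_def)
  obtain k where k: "regs s ''k'' = Suc k" using 3(2) by (auto simp: gr0_conv_Suc)
  let ?A = "arrs s"
  obtain K where K: "logged ?A k G K"
    and step: "?A ''l0'' k = 1 \<and> confA K (?A ''l1'' k) (?A ''l2'' k) (?A ''l3'' k) (?A ''l4'' k) (?A ''l5'' k) (?A ''l6'' k) \<and>
        H = redA K (?A ''l1'' k) (?A ''l2'' k) (?A ''l3'' k) (?A ''l4'' k) (?A ''l5'' k) (?A ''l6'' k) \<or>
      ?A ''l0'' k = 2 \<and> confB K (?A ''l1'' k) (?A ''l2'' k) (?A ''l3'' k) (?A ''l4'' k) \<and>
        H = redB K (?A ''l1'' k) (?A ''l2'' k) (?A ''l3'' k)"
    using H(1) unfolding k by auto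
  have sK: "simple_graph K" using logged_simple[OF K G] .
  let ?nx = "if ?A ''l0'' k = 1 then undoA (?A ''l1'' k) (?A ''l2'' k) (?A ''l3'' k) (?A ''l4'' k) (?A ''l5'' k) (?A ''l6'' k) (?A ''nx'')
     else undoB (?A ''l1'' k) (?A ''l2'' k) (?A ''l3'' k) (?A ''l4'' k) (?A ''nx'')"
  have ham: "ham K ?nx" using step ham_undoA[OF sK] ham_undoB[OF sK] H(2) by auto
  have A: "arrs (run undo_body s) = ?A(''nx'' := ?nx)" and R: "regs (run undo_body s) ''k'' = k" "regs (run undo_body s) ''n'' = regs s ''n''"
    using k by (simp_all add: undo_body_def run_undo_A run_undo_B)
  have "logged (arrs (run undo_body s)) k G K \<longleftrightarrow> logged ?A k G K"
    unfolding A by (rule logged_cong) auto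
  then have "logged (arrs (run undo_body s)) (regs (run undo_body s) ''k'') G K" using K unfolding R by simp
  moreover have "ham K (arrs (run undo_body s) ''nx'')" using ham unfolding A by simp
  moreover have "problem G xs" "regs (run undo_body s) ''n'' = length xs" "k < m" "k = regs (run undo_body s) ''k''"
    using 3(1) k unfolding R by simp_all
  ultimately show ?case by blast
next
  case (4 G xs m s)
  then show ?case by auto
qed

lemma output_linear:
  "linear (\<lambda>G xs s. problem G xs \<and> regs s ''n'' = length xs \<and> ham G (arrs s ''nx'') \<and> regs s ''o'' = 0 \<and> regs s ''c'' = 0)
    output_loop
    (\<lambda>G xs s. hamiltonian_cycle G (output_list (length xs) s))"
  unfolding output_loop_def
proof (rule linear_While[where I = "\<lambda>G xs m s. problem G xs \<and> regs s ''n'' = length xs \<and>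
      (\<exists>l. ham G (arrs s ''nx'') \<and> cyclic_list (arrs s ''nx'') l \<and> set l = verts G \<and> length l = length xs \<and>
        regs s ''o'' \<le> length xs \<and> regs s ''c'' = l ! (regs s ''o'' mod length xs) \<and>
        (\<forall>j<regs s ''o''. arrs s ''cyc'' j = l ! j)) \<and> m = length xs - regs s ''o''"], goal_cases)
  case (2 G xs s)
  have V: "verts G = {..<length xs}" using 2 problem_verts by blast
  have h: "ham G (arrs s ''nx'')" using 2 by blast
  obtain c where c: "cyclic_list (arrs s ''nx'') c" "set c = verts G" using h by (auto simp: ham_def cyclic_on_def)
  have "card (verts G) \<ge> 3" using h by (simp add: ham_def)
  then have "length xs \<ge> 3" unfolding V by simp
  \<comment> \<open>The output starts at vertex 0, so the cycle is rotated to begin there.\<close>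
  then have "0 \<in> set c" unfolding c(2) V by auto
  then obtain d where d: "cyclic_list (arrs s ''nx'') (0 # d)" "set (0 # d) = verts G"
    using cyclic_list_start[OF c(1)] c(2) by metis
  have l: "length (0 # d) = length xs" using d V by (metis cyclic_list_def distinct_card card_lessThan)
  have "regs s ''c'' = (0 # d) ! (regs s ''o'' mod length xs)" using 2 by simp
  then show ?case
    by (intro exI[of _ "length xs"] conjI exI[of _ "0 # d"]) (use 2 d h l in \<open>simp_all add: input_size_def\<close>)
next
  case (3 G xs m s)
  then obtain l where l: "ham G (arrs s ''nx'')" "cyclic_list (arrs s ''nx'') l" "set l = verts G" "length l = length xs"
    "regs s ''c'' = l ! (regs s ''o'' mod length xs)" "\<forall>j<regs s ''o''. arrs s ''cyc'' j = l ! j" by blast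
  have lt: "regs s ''o'' < length xs" using 3 by simp
  then have c: "regs s ''c'' = l ! regs s ''o''" using l(5) by simp
  \<comment> \<open>The index is taken modulo the length because \<open>c\<close> returns to the
    first vertex after the last entry is written.\<close>
  then have n: "arrs s ''nx'' (regs s ''c'') = l ! (Suc (regs s ''o'') mod length xs)"
    using l(2,4) lt unfolding cyclic_list_def by simp
  show ?case
    by (intro exI[of _ "length xs - Suc (regs s ''o'')"] conjI exI[of _ l])
      (use 3 l lt c n in \<open>simp_all add: less_Suc_eq\<close>)
next
  case (4 G xs m s)
  then obtain l where l: "ham G (arrs s ''nx'')" "cyclic_list (arrs s ''nx'') l" "set l = verts G" "length l = length xs"
    "regs s ''o'' \<le> length xs" "\<forall>j<regs s ''o''. arrs s ''cyc'' j = l ! j" by blast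
  have "regs s ''o'' = length xs" using 4 l(5) by simp
  then have "output_list (length xs) s = l"
    using l(4,6) by (intro nth_equalityI) (auto simp: output_list_def)
  then show ?case using ham_cycle[OF l(1,2,3)] by simp
qed simp

lemma hamilton_prog_linear:
  "linear (\<lambda>G xs s. problem G xs \<and> s = input_store xs) hamilton_prog (\<lambda>G xs s. hamiltonian_cycle G (output_list (length xs) s))"
  unfolding hamilton_prog_def
  apply (rule linear_Seq[OF init_linear])
  apply (rule linear_Seq[OF transpose_linear])
  apply (rule linear_Seq[OF linear_run linear_Seq[OF twin_linear]])
    apply simp
   apply simp
  apply (rule linear_Seq[OF reduce_linear])
  apply (rule linear_Seq[OF linear_run linear_Seq[OF alive_linear]])
    apply simp
   apply (auto simp: core_def stack_def)[1]
  apply (rule linear_Seq[OF base_linear])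
  apply (rule linear_Seq[OF undo_linear])
  apply (rule linear_Seq[OF linear_run output_linear])
   apply simp
  apply simp
  done

theorem theorem7:
  shows "(\<forall>G :: 'a graph. simple_graph G \<longrightarrow> D3_reducible G \<longrightarrow> (\<exists>c. hamiltonian_cycle G c)) \<and>
    (\<exists>prg K. \<forall>G xs. simple_graph G \<longrightarrow> D3_reducible G \<longrightarrow> adjacency_lists G xs \<longrightarrow>
      (\<exists>t s. exec prg (input_store xs) t s \<and> t \<le> K * graph_size G \<and>
        hamiltonian_cycle G (output_list (length xs) s)))"
proof (intro conjI)
  show "\<forall>G :: 'a graph. simple_graph G \<longrightarrow> D3_reducible G \<longrightarrow> (\<exists>c. hamiltonian_cycle G c)"
    using D3_reducible_hamiltonian by blast
  obtain K where K: "problem G xs \<Longrightarrow> terminates hamilton_prog (input_store xs) (K * input_size xs)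
      (\<lambda>s. hamiltonian_cycle G (output_list (length xs) s))" for G xs
    using hamilton_prog_linear unfolding linear_def by blast
  have "\<exists>t s. exec hamilton_prog (input_store xs) t s \<and> t \<le> (6 * K) * graph_size G \<and>
      hamiltonian_cycle G (output_list (length xs) s)"
    if "simple_graph G" "D3_reducible G" "adjacency_lists G xs" for G xs
  proof -
    have i: "problem G xs" using that by (simp add: problem_def)
    have "\<exists>c. hamiltonian_cycle G c" using D3_reducible_hamiltonian that(1,2) by blast
    then have "verts G \<noteq> {}" by (auto simp: hamiltonian_cycle_def)
    then have "0 < length xs" unfolding problem_verts[OF i] by auto
    \<comment> \<open>The number of darts is at most twice that of edges, and a nonempty vertex set
      absorbs the additive one; hence the factor 6.\<close>
    moreover have "5 * n + c + 1 \<le> 6 * (n + e)" if "0 < n" "c \<le> 2 * e" for n c e :: nat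
      using that by presburger
    moreover have "card (verts G) = length xs" unfolding problem_verts[OF i] by simp
    ultimately have "input_size xs \<le> 6 * graph_size G"
      using length_concat_le[OF that(1,3)] unfolding input_size_def graph_size_def by metis
    then have "K * input_size xs \<le> K * (6 * graph_size G)" by (rule mult_le_mono2)
    then have "K * input_size xs \<le> (6 * K) * graph_size G" by (simp only: ac_simps)
    then show ?thesis using K[OF i] unfolding terminates_def by (meson le_trans)
  qed
  then show "\<exists>prg K. \<forall>G xs. simple_graph G \<longrightarrow> D3_reducible G \<longrightarrow> adjacency_lists G xs \<longrightarrow>
      (\<exists>t s. exec prg (input_store xs) t s \<and> t \<le> K * graph_size G \<and>
        hamiltonian_cycle G (output_list (length xs) s))" by blast
qed

end
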